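(* Let $G$ be a partial 2-tree (a graph of treewidth at most 2). Then $G$ is $X$-induced-minor-free if and only if $\mathsf{mtw}(G) \le 3$.
   Context: $X$ is the graph on vertices $u_0,\dots,u_5,u_1',u_3',u_5'$ with edges $u_0u_1,u_1u_2,u_2u_3,u_3u_4,u_4u_5,u_5u_0$ and $u_0u_1',u_1'u_2,u_2u_3',u_3'u_4,u_4u_5',u_5'u_0$ (9 vertices, 12 edges). A graph $F$ is an induced minor of $G$ if $F$ can be obtained from an induced subgraph of $G$ by contracting edges; $G$ is $F$-induced-minor-free if $F$ is not an induced minor of $G$. A tree decomposition of $G$ is a tree with bags $B(t)\subseteq V(G)$ such that every edge lies in some bag and, for each vertex, the bags containing it form a nonempty connected subtree; width is maximum bag size minus one. A bag is matched if the subgraph of $G$ induced by the bag has a perfect matching, or has a matching leaving exactly one vertex $v$ of the bag unmatched with $v$ adjacent to some matched vertex. $\mathsf{mtw}(G)$ is the minimum width of a tree decomposition all of whose bags are matched.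
   Formalization: The formal theorem assumes in addition that G has no isolated vertices, which is exactly the condition for mtw(G) to be defined; for example, a single vertex is X-induced-minor-free but has no tree decomposition with all bags matched. *)

theory Defs
  imports Main "HOL-Library.Extended_Nat"
begin

record 'a ugraph =
  verts :: "'a set"
  edges :: "'a set set"

definition finite_simple_graph :: "'a ugraph \<Rightarrow> bool" where
  "finite_simple_graph G \<longleftrightarrow>
     finite (verts G) \<and> (\<forall>e \<in> edges G. e \<subseteq> verts G \<and> card e = 2)"

definition no_isolated_vertices :: "'a ugraph \<Rightarrow> bool" where
  "no_isolated_vertices G \<longleftrightarrow> (\<forall>v \<in> verts G. \<exists>e \<in> edges G. v \<in> e)"

definition induced_subgraph :: "'a ugraph \<Rightarrow> 'a set \<Rightarrow> 'a ugraph" where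
  "induced_subgraph G S = \<lparr>verts = S, edges = {e \<in> edges G. e \<subseteq> S}\<rparr>"

definition graph_iso :: "'a ugraph \<Rightarrow> 'b ugraph \<Rightarrow> bool" where
  "graph_iso G H \<longleftrightarrow>
     (\<exists>f. bij_betw f (verts G) (verts H) \<and>
          (\<forall>x \<in> verts G. \<forall>y \<in> verts G. {x, y} \<in> edges G \<longleftrightarrow> {f x, f y} \<in> edges H))"

text \<open>Contraction of the edge \<open>{x, y}\<close>: the vertex \<open>y\<close> is merged into \<open>x\<close>. Parallel edges
  collapse because edges form a set, and the loop arising from \<open>{x, y}\<close> is dropped.\<close>

definition contract_edge :: "'a ugraph \<Rightarrow> 'a \<Rightarrow> 'a \<Rightarrow> 'a ugraph" where
  "contract_edge G x y =
     \<lparr>verts = verts G - {y},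
      edges = {(\<lambda>v. if v = y then x else v) ` e | e. e \<in> edges G \<and> e \<noteq> {x, y}}\<rparr>"

inductive contracts_to :: "'a ugraph \<Rightarrow> 'a ugraph \<Rightarrow> bool" where
  refl: "contracts_to G G"
| step: "contracts_to G H \<Longrightarrow> {x, y} \<in> edges H \<Longrightarrow> contracts_to G (contract_edge H x y)"

definition induced_minor :: "'b ugraph \<Rightarrow> 'a ugraph \<Rightarrow> bool" where
  "induced_minor F G \<longleftrightarrow>
     (\<exists>S H. S \<subseteq> verts G \<and> contracts_to (induced_subgraph G S) H \<and> graph_iso F H)"

definition induced_minor_free :: "'b ugraph \<Rightarrow> 'a ugraph \<Rightarrow> bool" where
  "induced_minor_free F G \<longleftrightarrow> \<not> induced_minor F G"

definition connected_graph :: "'a ugraph \<Rightarrow> bool" where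
  "connected_graph G \<longleftrightarrow>
     verts G \<noteq> {} \<and>
     (\<forall>u \<in> verts G. \<forall>v \<in> verts G. (u, v) \<in> {(x, y). {x, y} \<in> edges G}\<^sup>*)"

definition is_cycle :: "'a ugraph \<Rightarrow> 'a list \<Rightarrow> bool" where
  "is_cycle G c \<longleftrightarrow>
     3 \<le> length c \<and> distinct c \<and>
     (\<forall>i < length c. {c ! i, c ! (Suc i mod length c)} \<in> edges G)"

definition is_tree :: "'a ugraph \<Rightarrow> bool" where
  "is_tree T \<longleftrightarrow> finite_simple_graph T \<and> connected_graph T \<and> (\<nexists>c. is_cycle T c)"

definition tree_decomposition :: "'a ugraph \<Rightarrow> 't ugraph \<Rightarrow> ('t \<Rightarrow> 'a set) \<Rightarrow> bool" where
  "tree_decomposition G T B \<longleftrightarrow>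
     is_tree T \<and>
     (\<forall>t \<in> verts T. B t \<subseteq> verts G) \<and>
     (\<forall>e \<in> edges G. \<exists>t \<in> verts T. e \<subseteq> B t) \<and>
     (\<forall>v \<in> verts G. connected_graph (induced_subgraph T {t \<in> verts T. v \<in> B t}))"

text \<open>The subtraction truncates only if all bags are empty, i.e. for the graph without vertices,
  whose width is thus \<open>0\<close> instead of \<open>-1\<close>.\<close>

definition width :: "'t ugraph \<Rightarrow> ('t \<Rightarrow> 'a set) \<Rightarrow> nat" where
  "width T B = Max ((\<lambda>t. card (B t)) ` verts T) - 1"

text \<open>Trees are finite, so it is no restriction to take their nodes from \<^typ>\<open>nat\<close>. The order on
  \<^typ>\<open>enat\<close> is a well-order, so the infimum of a nonempty set is its minimum; the infimum of the
  empty set is \<open>\<infinity>\<close>.\<close>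

definition treewidth :: "'a ugraph \<Rightarrow> enat" where
  "treewidth G =
     Inf {enat (width T B) | (T :: nat ugraph) B. tree_decomposition G T B}"

definition matching :: "'a ugraph \<Rightarrow> 'a set set \<Rightarrow> bool" where
  "matching G M \<longleftrightarrow> M \<subseteq> edges G \<and> (\<forall>e \<in> M. \<forall>e' \<in> M. e \<noteq> e' \<longrightarrow> e \<inter> e' = {})"

definition matched_bag :: "'a ugraph \<Rightarrow> 'a set \<Rightarrow> bool" where
  "matched_bag G S \<longleftrightarrow>
     (\<exists>M. matching (induced_subgraph G S) M \<and>
          (\<Union>M = S \<or>
           (\<exists>v \<in> S. \<Union>M = S - {v} \<and> (\<exists>w \<in> \<Union>M. {v, w} \<in> edges G))))"

definition matched_tree_decomposition ::
    "'a ugraph \<Rightarrow> 't ugraph \<Rightarrow> ('t \<Rightarrow> 'a set) \<Rightarrow> bool" where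
  "matched_tree_decomposition G T B \<longleftrightarrow>
     tree_decomposition G T B \<and> (\<forall>t \<in> verts T. matched_bag G (B t))"

definition mtw :: "'a ugraph \<Rightarrow> enat" where
  "mtw G =
     Inf {enat (width T B) | (T :: nat ugraph) B. matched_tree_decomposition G T B}"

text \<open>A vertex of a matched bag always has a neighbour in that bag, so a graph with an isolated
  vertex has no matched tree decomposition at all.\<close>

lemma matched_tree_decomposition_no_isolated:
  assumes "matched_tree_decomposition G T B"
  shows "no_isolated_vertices G"
  unfolding no_isolated_vertices_def
proof
  fix v assume "v \<in> verts G"
  then obtain t where t: "t \<in> verts T" "v \<in> B t"
    using assms
    by (force simp: matched_tree_decomposition_def tree_decomposition_def connected_graph_def
        induced_subgraph_def)
  then have "matched_bag G (B t)"
    using assms by (simp add: matched_tree_decomposition_def)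
  then obtain M where M: "matching (induced_subgraph G (B t)) M"
    and cov: "\<Union>M = B t \<or>
      (\<exists>u \<in> B t. \<Union>M = B t - {u} \<and> (\<exists>w \<in> \<Union>M. {u, w} \<in> edges G))"
    unfolding matched_bag_def by (elim exE conjE)
  from M have sub: "M \<subseteq> edges G"
    by (auto simp: matching_def induced_subgraph_def)
  show "\<exists>e \<in> edges G. v \<in> e"
  proof (cases "v \<in> \<Union>M")
    case True
    then show ?thesis using sub by blast
  next
    case False
    then have "\<Union>M \<noteq> B t" using t(2) by metis
    with cov obtain u w where u: "\<Union>M = B t - {u}" "{u, w} \<in> edges G" by metis
    have "v = u" using False t(2) u(1) by (metis Diff_iff singletonD)
    then show ?thesis using u(2) by (intro bexI[of _ "{u, w}"]) simp_all
  qed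
qed

datatype X_vertex = U0 | U1 | U2 | U3 | U4 | U5 | U1' | U3' | U5'

definition X_graph :: "X_vertex ugraph" where
  "X_graph =
     \<lparr>verts = {U0, U1, U2, U3, U4, U5, U1', U3', U5'},
      edges = {{U0, U1}, {U1, U2}, {U2, U3}, {U3, U4}, {U4, U5}, {U5, U0},
               {U0, U1'}, {U1', U2}, {U2, U3'}, {U3', U4}, {U4, U5'}, {U5', U0}}\<rparr>"

end

theory Submission
  imports Defs
begin

text \<open>
  Suppose that \<open>X\<close> is an induced minor and every bag is matched and has at most four vertices. The
  sets formed by one of \<open>u\<^sub>0, u\<^sub>2, u\<^sub>4\<close> and one common neighbour with each of the other two are
  connected and touch pairwise, so some bag meets all of them (Helly property), and therefore it
  meets three pairwise nonadjacent branch sets. This is impossible: each matching edge of the bag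
  meets at most one of them.

  Conversely, a minimal counterexample is 2-connected. Eliminating the vertices of a partial 2-tree
  down to the ends of an edge exhibits the graph as built by series and parallel compositions of
  two-terminal pieces. Call a piece good if it has a matched decomposition of width 3 with a
  bag containing both terminals, and thick if its terminals are nonadjacent and joined by two
  parallel strands. Goodness is preserved by parallel composition and by series composition
  with an edge. A piece with nonadjacent terminals and only one strand is a series of edges and thick
  pieces. If it contains at most one thick piece, it is good; if it contains two of them and is
  parallel to two further strands, or if a cycle contains three thick pieces, then \<open>X\<close> is an induced
  minor. A cycle with two thick pieces is handled by cutting it at one of them.
\<close>

section \<open>Connected sets\<close>

text \<open>Series composition is the obstacle. Pieces \<open>p\<close>-\<open>v\<close> and
  \<open>v\<close>-\<open>q\<close> are joined most naturally by a bag through \<open>p\<close>,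
  \<open>v\<close> and \<open>q\<close>, but three pairwise nonadjacent vertices never share a
  matched bag of at most four vertices. An edge \<open>vq\<close> removes the difficulty, provided
  that a fourth place is left for a neighbour of \<open>p\<close>. So the links that are not edges
  have to be counted. Minimality disposes of proper pieces with adjacent terminals: such a piece is
  a smaller induced subgraph without isolated vertices, and in any matched decomposition of it the
  edge between the terminals lies in a bag. Hence only pieces with nonadjacent terminals need an
  analysis. Elimination fills in edges that the graph lacks, and the Helly argument uses sharing a
  bag as adjacency; this is why connectedness, series and parallel composition are phrased for a
  relation on the vertices instead of a graph.\<close>

definition adj :: "'a ugraph \<Rightarrow> 'a \<Rightarrow> 'a \<Rightarrow> bool" where
  "adj G x y \<longleftrightarrow> {x, y} \<in> edges G"

lemma adj_sym: "adj G x y \<Longrightarrow> adj G y x"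
  by (simp add: adj_def insert_commute)

lemma adj_neq: "finite_simple_graph G \<Longrightarrow> adj G x y \<Longrightarrow> x \<noteq> y"
  by (fastforce simp: adj_def finite_simple_graph_def)

lemma adj_verts: "finite_simple_graph G \<Longrightarrow> adj G x y \<Longrightarrow> x \<in> verts G \<and> y \<in> verts G"
  by (fastforce simp: adj_def finite_simple_graph_def)

lemma edge_adjE:
  assumes "finite_simple_graph G" "e \<in> edges G"
  obtains x y where "e = {x, y}" "adj G x y" "x \<noteq> y" "x \<in> verts G" "y \<in> verts G"
proof -
  have "card e = 2" "e \<subseteq> verts G" using assms by (auto simp: finite_simple_graph_def)
  then obtain x y where "e = {x, y}" "x \<noteq> y" by (auto simp: card_2_iff)
  then show thesis using that assms \<open>e \<subseteq> verts G\<close> by (auto simp: adj_def)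
qed

text \<open>Connectedness as the lack of a proper nonempty closed subset; for symmetric
  \<open>r\<close> it agrees with connectedness by paths. Proofs then exhibit a closed set instead
  of building a path.\<close>

definition conn :: "('a \<Rightarrow> 'a \<Rightarrow> bool) \<Rightarrow> 'a set \<Rightarrow> bool" where
  "conn r A \<longleftrightarrow> A \<noteq> {} \<and>
     (\<forall>Q \<subseteq> A. Q \<noteq> {} \<longrightarrow> (\<forall>x \<in> Q. \<forall>y \<in> A. r x y \<longrightarrow> y \<in> Q) \<longrightarrow> Q = A)"

definition touch :: "('a \<Rightarrow> 'a \<Rightarrow> bool) \<Rightarrow> 'a set \<Rightarrow> 'a set \<Rightarrow> bool" where
  "touch r A B \<longleftrightarrow> (\<exists>x \<in> A. \<exists>y \<in> B. r x y)"

definition anti :: "('a \<Rightarrow> 'a \<Rightarrow> bool) \<Rightarrow> 'a set \<Rightarrow> 'a set \<Rightarrow> bool" where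
  "anti r A B \<longleftrightarrow> A \<inter> B = {} \<and> \<not> touch r A B"

lemma connI:
  assumes "A \<noteq> {}"
    and "\<And>Q. Q \<subseteq> A \<Longrightarrow> Q \<noteq> {} \<Longrightarrow> (\<And>x y. x \<in> Q \<Longrightarrow> y \<in> A \<Longrightarrow> r x y \<Longrightarrow> y \<in> Q) \<Longrightarrow> A \<subseteq> Q"
  shows "conn r A"
  using assms unfolding conn_def by (metis subset_antisym)

lemma connD:
  assumes "conn r A" "Q \<subseteq> A" "Q \<noteq> {}" "\<And>x y. x \<in> Q \<Longrightarrow> y \<in> A \<Longrightarrow> r x y \<Longrightarrow> y \<in> Q"
  shows "Q = A"
  using assms unfolding conn_def by blast

lemma conn_closed_superset:
  assumes "conn r A" "a \<in> A" "a \<in> Q" "\<And>x y. x \<in> Q \<Longrightarrow> x \<in> A \<Longrightarrow> y \<in> A \<Longrightarrow> r x y \<Longrightarrow> y \<in> Q"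
  shows "A \<subseteq> Q"
  using connD[OF assms(1), of "Q \<inter> A"] assms by blast

lemma conn_nonempty: "conn r A \<Longrightarrow> A \<noteq> {}"
  by (simp add: conn_def)

lemma conn_singleton: "conn r {x}"
  by (auto simp: conn_def)

lemma conn_mono:
  assumes "conn r A" "\<And>x y. x \<in> A \<Longrightarrow> y \<in> A \<Longrightarrow> r x y \<Longrightarrow> r' x y"
  shows "conn r' A"
  using assms unfolding conn_def by (meson subset_iff)

lemma conn_Un:
  assumes "symp r" "conn r A" "conn r B" "A \<inter> B \<noteq> {} \<or> touch r A B"
  shows "conn r (A \<union> B)"
proof (rule connI)
  show "A \<union> B \<noteq> {}" using conn_nonempty[OF assms(2)] by blast
  fix Q assume Q: "Q \<subseteq> A \<union> B" "Q \<noteq> {}" "\<And>x y. x \<in> Q \<Longrightarrow> y \<in> A \<union> B \<Longrightarrow> r x y \<Longrightarrow> y \<in> Q"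
  have A: "A \<subseteq> Q" if "a \<in> A" "a \<in> Q" for a
    by (rule conn_closed_superset[OF assms(2) that]) (use Q(3) in blast)
  have B: "B \<subseteq> Q" if "a \<in> B" "a \<in> Q" for a
    by (rule conn_closed_superset[OF assms(3) that]) (use Q(3) in blast)
  have AB: "\<exists>b \<in> B. b \<in> Q" if "A \<subseteq> Q"
    using assms(4) that Q(3) unfolding touch_def by blast
  have BA: "\<exists>a \<in> A. a \<in> Q" if "B \<subseteq> Q"
    using assms(4) that Q(3) sympD[OF assms(1)] unfolding touch_def by blast
  from Q(1,2) consider a where "a \<in> A" "a \<in> Q" | b where "b \<in> B" "b \<in> Q" by blast
  then show "A \<union> B \<subseteq> Q" by cases (use A B AB BA in blast)+
qed

lemma conn_insert:
  assumes "symp r" "conn r A" "a \<in> A" "r a b"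
  shows "conn r (insert b A)"
  using conn_Un[OF assms(1,2) conn_singleton[of r b]] assms(3,4) by (auto simp: touch_def)

text \<open>A maximal connected subset of \<open>D\<close> through \<open>d\<close> is closed, since
  any neighbour in \<open>D\<close> could be added to it.\<close>

lemma component_exists:
  assumes "symp r" "finite D" "d \<in> D"
  obtains S where "S \<subseteq> D" "d \<in> S" "conn r S" "\<And>x y. x \<in> S \<Longrightarrow> y \<in> D \<Longrightarrow> r x y \<Longrightarrow> y \<in> S"
proof -
  define \<C> where "\<C> = {S. S \<subseteq> D \<and> d \<in> S \<and> conn r S}"
  have fin: "finite \<C>"
    using assms(2) by (auto simp: \<C>_def intro: finite_subset[OF _ finite_Pow_iff[THEN iffD2]])
  have "{d} \<in> \<C>" using assms(3) by (auto simp: \<C>_def conn_singleton)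
  then obtain S where S: "S \<in> \<C>" "\<And>S'. S' \<in> \<C> \<Longrightarrow> S \<subseteq> S' \<Longrightarrow> S' = S"
    using finite_has_maximal[OF fin] by blast
  have "y \<in> S" if "x \<in> S" "y \<in> D" "r x y" for x y
  proof -
    have "insert y S \<in> \<C>"
      using S(1) that conn_insert[OF assms(1)] by (auto simp: \<C>_def)
    then show ?thesis using S(2) by blast
  qed
  then show thesis using that S(1) by (auto simp: \<C>_def)
qed

lemma anti_sym: "symp r \<Longrightarrow> anti r A B \<Longrightarrow> anti r B A"
  by (auto simp: anti_def touch_def dest: sympD)

lemma touch_sym: "symp r \<Longrightarrow> touch r A B \<Longrightarrow> touch r B A"
  by (auto simp: touch_def dest: sympD)

lemma connected_graph_induced_iff:
  "connected_graph (induced_subgraph T A) \<longleftrightarrow> conn (adj T) A"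
proof
  let ?R = "{(x, y). {x, y} \<in> edges (induced_subgraph T A)}"
  assume L: "connected_graph (induced_subgraph T A)"
  show "conn (adj T) A"
  proof (rule connI)
    show "A \<noteq> {}" using L by (auto simp: connected_graph_def induced_subgraph_def)
    fix Q assume Q: "Q \<subseteq> A" "Q \<noteq> {}" "\<And>x y. x \<in> Q \<Longrightarrow> y \<in> A \<Longrightarrow> adj T x y \<Longrightarrow> y \<in> Q"
    then obtain q where q: "q \<in> Q" by blast
    show "A \<subseteq> Q"
    proof
      fix a assume "a \<in> A"
      then have "(q, a) \<in> ?R\<^sup>*" using L q Q(1) by (auto simp: connected_graph_def induced_subgraph_def)
      then show "a \<in> Q"
        by induction (use q Q(3) in \<open>auto simp: induced_subgraph_def adj_def\<close>)
    qed
  qed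
next
  let ?R = "{(x, y). {x, y} \<in> edges (induced_subgraph T A)}"
  assume R: "conn (adj T) A"
  have "(u, v) \<in> ?R\<^sup>*" if "u \<in> A" "v \<in> A" for u v
  proof -
    have "A \<subseteq> {v. (u, v) \<in> ?R\<^sup>*}"
    proof (rule conn_closed_superset[OF R that(1)])
      show "u \<in> {v. (u, v) \<in> ?R\<^sup>*}" by simp
      fix x y assume "x \<in> {v. (u, v) \<in> ?R\<^sup>*}" "x \<in> A" "y \<in> A" "adj T x y"
      then have "(u, x) \<in> ?R\<^sup>*" "(x, y) \<in> ?R" by (auto simp: adj_def induced_subgraph_def)
      then show "y \<in> {v. (u, v) \<in> ?R\<^sup>*}" by (auto intro: rtrancl_into_rtrancl)
    qed
    then show ?thesis using that by blast
  qed
  then show "connected_graph (induced_subgraph T A)"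
    using conn_nonempty[OF R] by (auto simp: connected_graph_def induced_subgraph_def)
qed

lemma connected_graph_iff:
  assumes "finite_simple_graph T"
  shows "connected_graph T \<longleftrightarrow> conn (adj T) (verts T)"
proof -
  have "induced_subgraph T (verts T) = T"
    using assms by (cases T) (auto simp: induced_subgraph_def finite_simple_graph_def)
  then show ?thesis using connected_graph_induced_iff[of T "verts T"] by simp
qed

lemma symp_adj: "symp (adj G)"
  by (auto intro: sympI adj_sym)

section \<open>Tree decompositions as sets of bags\<close>

text \<open>Trees grown from a root by adding leaves. This supplies an induction principle that
  connectedness without cycles does not offer, and any vertex of the tree may be taken as the
  root.\<close>

inductive leaf_tree :: "'t \<Rightarrow> 't set \<Rightarrow> 't set set \<Rightarrow> bool" for t\<^sub>0 where
  root: "leaf_tree t\<^sub>0 {t\<^sub>0} {}"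
| leaf: "leaf_tree t\<^sub>0 S F \<Longrightarrow> s \<in> S \<Longrightarrow> t \<notin> S \<Longrightarrow> leaf_tree t\<^sub>0 (insert t S) (insert {s, t} F)"

lemma leaf_tree_root: "leaf_tree t\<^sub>0 S F \<Longrightarrow> t\<^sub>0 \<in> S"
  by (induction rule: leaf_tree.induct) auto

lemma leaf_tree_simple:
  "leaf_tree t\<^sub>0 S F \<Longrightarrow> finite_simple_graph \<lparr>verts = S, edges = F\<rparr>"
  by (induction rule: leaf_tree.induct) (auto simp: finite_simple_graph_def card_2_iff)

lemma leaf_tree_edge_subset: "leaf_tree t\<^sub>0 S F \<Longrightarrow> e \<in> F \<Longrightarrow> e \<subseteq> S"
  by (drule leaf_tree_simple) (auto simp: finite_simple_graph_def)

lemma leaf_tree_connected: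
  "leaf_tree t\<^sub>0 S F \<Longrightarrow> conn (\<lambda>x y. {x, y} \<in> F) S"
proof (induction rule: leaf_tree.induct)
  case root
  show ?case by (rule conn_singleton)
next
  case (leaf S F s t)
  have "conn (\<lambda>x y. {x, y} \<in> insert {s, t} F) S"
    by (rule conn_mono[OF leaf.IH]) auto
  then show ?case
    by (rule conn_insert[rotated]) (use leaf.hyps in \<open>auto intro!: sympI simp: insert_commute\<close>)
qed

text \<open>On a cycle the two neighbours of the new vertex \<open>t\<close> would both be
  \<open>s\<close>, its only neighbour, although a cycle has at least three distinct
  entries.\<close>

lemma leaf_tree_acyclic:
  "leaf_tree t\<^sub>0 S F \<Longrightarrow> \<not> is_cycle \<lparr>verts = S, edges = F\<rparr> c"
proof (induction rule: leaf_tree.induct)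
  case root
  show ?case by (auto simp: is_cycle_def intro!: exI[of _ 0])
next
  case (leaf S F s t)
  show ?case
  proof
    let ?n = "length c"
    assume cyc: "is_cycle \<lparr>verts = insert t S, edges = insert {s, t} F\<rparr> c"
    then have n: "3 \<le> ?n" and dist: "distinct c"
      and ed: "\<And>i. i < ?n \<Longrightarrow> {c ! i, c ! (Suc i mod ?n)} \<in> insert {s, t} F"
      by (auto simp: is_cycle_def)
    have tF: "{t, x} \<notin> F" for x
      using leaf_tree_edge_subset[OF leaf.hyps(1)] leaf.hyps(3) by blast
    have nbr: "x = s" if "{t, x} \<in> insert {s, t} F" for x
      using that tF[of x] leaf.hyps by (auto simp: doubleton_eq_iff)
    show False
    proof (cases "t \<in> set c")
      case True
      then obtain i where i: "i < ?n" "c ! i = t" by (auto simp: in_set_conv_nth)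
      \<comment> \<open>The cyclic predecessor of \<open>i\<close>; it equals the cyclic successor
        only on lists of length at most 2.\<close>
      define j where "j = (if i = 0 then ?n - 1 else i - 1)"
      have j: "j < ?n" "Suc j mod ?n = i" using i n by (auto simp: j_def)
      have "c ! (Suc i mod ?n) = s" using ed[OF i(1)] nbr i(2) by simp
      moreover have "c ! j = s" using ed[OF j(1)] nbr i(2) j(2) by (simp add: insert_commute)
      moreover have "Suc i mod ?n < ?n" using n by (intro mod_less_divisor) auto
      ultimately have "Suc i mod ?n = j" using dist j(1) nth_eq_iff_index_eq by metis
      then show False using i(1) n by (auto simp: j_def mod_Suc split: if_splits)
    next
      case False
      have "{c ! i, c ! (Suc i mod ?n)} \<in> F" if i: "i < ?n" for i
      proof -
        have "c ! i \<noteq> t" "c ! (Suc i mod ?n) \<noteq> t"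
          using False i n by (metis nth_mem, metis nth_mem mod_less_divisor less_le_trans zero_less_numeral)
        then show ?thesis using ed[OF i] by (auto simp: doubleton_eq_iff)
      qed
      then show False using leaf.IH n dist by (auto simp: is_cycle_def)
    qed
  qed
qed

lemma leaf_tree_is_tree: "leaf_tree t\<^sub>0 S F \<Longrightarrow> is_tree \<lparr>verts = S, edges = F\<rparr>"
  using leaf_tree_simple leaf_tree_connected leaf_tree_acyclic
  by (fastforce simp: is_tree_def connected_graph_iff adj_def[abs_def])

text \<open>In \<open>tree_leaf_tree\<close> such a path closes a cycle together with a new vertex
  adjacent to both of its ends.\<close>

lemma leaf_tree_path:
  assumes "leaf_tree t\<^sub>0 S F" "x \<in> S" "y \<in> S"
  shows "\<exists>xs. xs \<noteq> [] \<and> hd xs = x \<and> last xs = y \<and> distinct xs \<and> set xs \<subseteq> S \<and>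
    successively (\<lambda>a b. {a, b} \<in> F) xs"
  using assms
proof (induction arbitrary: x y rule: leaf_tree.induct)
  case root
  then show ?case by (intro exI[of _ "[x]"]) auto
next
  case (leaf S F s t)
  have up: "successively (\<lambda>a b. {a, b} \<in> insert {s, t} F) xs"
    if "successively (\<lambda>a b. {a, b} \<in> F) xs" for xs
    by (rule successively_mono[OF that]) auto
  consider "x = t" "y = t" | "x = t" "y \<in> S" | "x \<in> S" "y = t" | "x \<in> S" "y \<in> S"
    using leaf.prems by blast
  then show ?case
  proof cases
    case 1
    then show ?thesis by (intro exI[of _ "[t]"]) auto
  next
    case 2
    from leaf.IH[OF leaf.hyps(2) 2(2)] obtain xs where xs: "xs \<noteq> []" "hd xs = s" "last xs = y"
      "distinct xs" "set xs \<subseteq> S" "successively (\<lambda>a b. {a, b} \<in> F) xs" by blast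
    then show ?thesis using 2 leaf.hyps up[OF xs(6)]
      by (intro exI[of _ "t # xs"]) (auto simp: successively_Cons insert_commute)
  next
    case 3
    from leaf.IH[OF 3(1) leaf.hyps(2)] obtain xs where xs: "xs \<noteq> []" "hd xs = x" "last xs = s"
      "distinct xs" "set xs \<subseteq> S" "successively (\<lambda>a b. {a, b} \<in> F) xs" by blast
    then show ?thesis using 3 leaf.hyps up[OF xs(6)]
      by (intro exI[of _ "xs @ [t]"]) (auto simp: successively_append_iff)
  next
    case 4
    from leaf.IH[OF 4] show ?thesis using up by blast
  qed
qed

text \<open>Take a maximal vertex set on which \<open>T\<close> induces a tree grown from the root.
  If it is not everything, connectedness gives an edge leaving it, and the outer end
  \<open>t\<close> has only one neighbour \<open>s\<close> inside, as a second one would close a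
  cycle with the path between them. So \<open>t\<close> could be added as a leaf.\<close>

lemma tree_leaf_tree:
  assumes T: "is_tree T" and t0: "t\<^sub>0 \<in> verts T"
  shows "leaf_tree t\<^sub>0 (verts T) (edges T)"
proof -
  have simple: "finite_simple_graph T" and acyc: "\<And>c. \<not> is_cycle T c"
    and con: "conn (adj T) (verts T)"
    using T by (auto simp: is_tree_def connected_graph_iff)
  define E where "E S = {e \<in> edges T. e \<subseteq> S}" for S
  define \<C> where "\<C> = {S. S \<subseteq> verts T \<and> leaf_tree t\<^sub>0 S (E S)}"
  have fin: "finite \<C>"
    using simple by (auto simp: \<C>_def finite_simple_graph_def
        intro: finite_subset[OF _ finite_Pow_iff[THEN iffD2]])
  have "E {t\<^sub>0} = {}"
    using edge_adjE[OF simple] unfolding E_def by (smt (verit, best) Collect_empty_eq insert_subset singletonD)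
  then have "{t\<^sub>0} \<in> \<C>" using t0 leaf_tree.root[of t\<^sub>0] by (auto simp: \<C>_def)
  then obtain S where S: "S \<in> \<C>" "\<And>S'. S' \<in> \<C> \<Longrightarrow> S \<subseteq> S' \<Longrightarrow> S' = S"
    using finite_has_maximal[OF fin] by blast
  then have lt: "leaf_tree t\<^sub>0 S (E S)" and sub: "S \<subseteq> verts T" by (auto simp: \<C>_def)
  have "S = verts T"
  proof (rule ccontr)
    assume "S \<noteq> verts T"
    then obtain s t where st: "s \<in> S" "t \<in> verts T" "t \<notin> S" "adj T s t"
      using connD[OF con sub] leaf_tree_root[OF lt] by blast
    have uniq: "s' = s" if s': "s' \<in> S" "adj T s' t" for s'
    proof (rule ccontr)
      assume ne: "s' \<noteq> s"
      obtain xs where xs: "xs \<noteq> []" "hd xs = s" "last xs = s'" "distinct xs" "set xs \<subseteq> S"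
        "successively (\<lambda>a b. {a, b} \<in> E S) xs"
        using leaf_tree_path[OF lt st(1) s'(1)] by blast
      have len: "2 \<le> length xs" using xs ne by (cases xs; cases "tl xs") auto
      have "is_cycle T (xs @ [t])" unfolding is_cycle_def
      proof (intro conjI allI impI)
        show "3 \<le> length (xs @ [t])" using len by simp
        show "distinct (xs @ [t])" using xs st by auto
        fix i assume i: "i < length (xs @ [t])"
        consider "Suc i < length xs" | "Suc i = length xs" | "i = length xs" using i by force
        then show "{(xs @ [t]) ! i, (xs @ [t]) ! (Suc i mod length (xs @ [t]))} \<in> edges T"
        proof cases
          case 1
          then have "{xs ! i, xs ! Suc i} \<in> E S" using xs(6) by (auto simp: successively_conv_nth)
          then show ?thesis using 1 by (auto simp: nth_append E_def)
        next
          case 2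
          then have "xs ! i = s'" using xs by (metis diff_Suc_1 last_conv_nth)
          then show ?thesis using 2 s'(2) by (auto simp: nth_append adj_def)
        next
          case 3
          then show ?thesis using xs st(4)
            by (auto simp: nth_append adj_def hd_conv_nth insert_commute)
        qed
      qed
      then show False using acyc by blast
    qed
    have "E (insert t S) = insert {s, t} (E S)"
    proof
      show "insert {s, t} (E S) \<subseteq> E (insert t S)" using st by (auto simp: E_def adj_def)
      show "E (insert t S) \<subseteq> insert {s, t} (E S)"
      proof
        fix e assume "e \<in> E (insert t S)"
        then have e: "e \<in> edges T" "e \<subseteq> insert t S" by (auto simp: E_def)
        from e(1) obtain x y where xy: "e = {x, y}" "adj T x y" "x \<noteq> y"
          using edge_adjE[OF simple] by metis
        show "e \<in> insert {s, t} (E S)"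
        proof (cases "t \<in> e")
          case True
          then obtain z where z: "e = {z, t}" "z \<noteq> t" using xy by blast
          then have "z \<in> S" "adj T z t" using e by (auto simp: adj_def)
          then show ?thesis using uniq z by blast
        next
          case False
          then show ?thesis using e by (auto simp: E_def)
        qed
      qed
    qed
    then have "insert t S \<in> \<C>"
      using leaf_tree.leaf[OF lt st(1,3)] sub st by (auto simp: \<C>_def)
    then show False using S(2) st by blast
  qed
  moreover have "E (verts T) = edges T"
    using simple by (auto simp: E_def finite_simple_graph_def)
  ultimately show ?thesis using lt by simp
qed

text \<open>The second tree is regrown leaf by leaf onto the first, its root being the first leaf
  attached.\<close>

lemma leaf_tree_join:
  assumes "leaf_tree t\<^sub>2 S\<^sub>2 F\<^sub>2" "leaf_tree t\<^sub>1 S\<^sub>1 F\<^sub>1" "t \<in> S\<^sub>1" "S\<^sub>1 \<inter> S\<^sub>2 = {}"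
  shows "leaf_tree t\<^sub>1 (S\<^sub>1 \<union> S\<^sub>2) (insert {t, t\<^sub>2} (F\<^sub>1 \<union> F\<^sub>2))"
  using assms
proof (induction rule: leaf_tree.induct)
  case root
  then show ?case using leaf_tree.leaf[of t\<^sub>1 S\<^sub>1 F\<^sub>1 t t\<^sub>2] by auto
next
  case (leaf S F s u)
  then have "leaf_tree t\<^sub>1 (S\<^sub>1 \<union> S) (insert {t, t\<^sub>2} (F\<^sub>1 \<union> F))" by blast
  from leaf_tree.leaf[OF this, of s u] leaf show ?case by (simp add: insert_commute)
qed

text \<open>The decomposition tree is left implicit: since a new bag meets the old vertices only inside the
  bag it is attached to, every vertex occurs in a connected set of bags.\<close>

inductive rooted_bags :: "'a set \<Rightarrow> 'a set \<Rightarrow> 'a set set \<Rightarrow> bool" for b\<^sub>0 where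
  root: "rooted_bags b\<^sub>0 b\<^sub>0 {b\<^sub>0}"
| leaf: "rooted_bags b\<^sub>0 V \<B> \<Longrightarrow> b \<in> \<B> \<Longrightarrow> S \<inter> V \<subseteq> b \<Longrightarrow> rooted_bags b\<^sub>0 (V \<union> S) (insert S \<B>)"

text \<open>A vertex of the last bag \<open>B t\<close> that occurs in an earlier bag is also in
  \<open>B s\<close>, since the only way out of the leaf \<open>t\<close> is through
  \<open>s\<close>; this is the side condition of \<open>rooted_bags\<close>. Deleting a leaf does
  not disconnect the set of nodes whose bags contain a given vertex.\<close>

lemma leaf_tree_rooted_bags:
  assumes "leaf_tree t\<^sub>0 S F" "\<And>v. v \<in> \<Union>(B ` S) \<Longrightarrow> conn (\<lambda>x y. {x, y} \<in> F) {t \<in> S. v \<in> B t}"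
  shows "rooted_bags (B t\<^sub>0) (\<Union>(B ` S)) (B ` S)"
  using assms
proof (induction rule: leaf_tree.induct)
  case root
  show ?case by (simp add: rooted_bags.root)
next
  case (leaf S F s t)
  have tF: "{t, x} \<notin> F" "{x, t} \<notin> F" for x
    using leaf_tree_edge_subset[OF leaf.hyps(1)] leaf.hyps(3) by blast+
  have key: "v \<in> B s" if v: "v \<in> B t" "u \<in> S" "v \<in> B u" for v u
  proof (rule ccontr)
    assume "v \<notin> B s"
    then have "{t} = {x \<in> insert t S. v \<in> B x}"
      using v by (intro connD[OF leaf.prems[of v]])
        (auto simp: doubleton_eq_iff tF)
    moreover have "u \<in> {x \<in> insert t S. v \<in> B x}" using v by simp
    ultimately show False using v leaf.hyps(3) by auto
  qed
  have "rooted_bags (B t\<^sub>0) (\<Union>(B ` S)) (B ` S)"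
  proof (rule leaf.IH)
    fix v assume "v \<in> \<Union>(B ` S)"
    then obtain u where u: "u \<in> S" "v \<in> B u" by blast
    show "conn (\<lambda>x y. {x, y} \<in> F) {t \<in> S. v \<in> B t}"
    proof (rule connI)
      show "{t \<in> S. v \<in> B t} \<noteq> {}" using u by blast
      fix Q assume Q: "Q \<subseteq> {t \<in> S. v \<in> B t}" "Q \<noteq> {}"
        "\<And>x y. x \<in> Q \<Longrightarrow> y \<in> {t \<in> S. v \<in> B t} \<Longrightarrow> {x, y} \<in> F \<Longrightarrow> y \<in> Q"
      then obtain q where q: "q \<in> Q" by blast
      \<comment> \<open>A set closed in the smaller tree becomes closed in the larger one if
        \<open>t\<close> is added exactly when its neighbour \<open>s\<close> is present.\<close>
      have "{x \<in> insert t S. v \<in> B x} \<subseteq> Q \<union> (if s \<in> Q then {t} else {})"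
      proof (rule conn_closed_superset[OF leaf.prems[of v], of q])
        show "v \<in> \<Union>(B ` insert t S)" "q \<in> {x \<in> insert t S. v \<in> B x}" using u q Q by blast+
        show "q \<in> Q \<union> (if s \<in> Q then {t} else {})" using q by simp
        fix x y assume x: "x \<in> Q \<union> (if s \<in> Q then {t} else {})"
          and y: "y \<in> {x \<in> insert t S. v \<in> B x}" and e: "{x, y} \<in> insert {s, t} F"
        show "y \<in> Q \<union> (if s \<in> Q then {t} else {})"
        proof (cases "{x, y} \<in> F")
          case True
          then have "x \<noteq> t" "y \<noteq> t" using tF by auto
          then show ?thesis using x y True Q(3)[of x y] by (auto split: if_splits)
        next
          case False
          then have "x = s \<and> y = t \<or> x = t \<and> y = s" using e by (auto simp: doubleton_eq_iff)
          then show ?thesis using x Q(1) leaf.hyps by (auto split: if_splits)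
        qed
      qed
      then show "{t \<in> S. v \<in> B t} \<subseteq> Q" using leaf.hyps by (auto split: if_splits)
    qed
  qed
  from rooted_bags.leaf[OF this, of "B s" "B t"] show ?case
    using leaf.hyps key by (auto simp: Un_commute)
qed

lemma tree_decomposition_rooted_bags:
  assumes "tree_decomposition G T B" "t\<^sub>0 \<in> verts T"
  shows "rooted_bags (B t\<^sub>0) (verts G) (B ` verts T)"
proof -
  have c: "conn (adj T) {t \<in> verts T. v \<in> B t}" if "v \<in> verts G" for v
    using assms that by (auto simp: tree_decomposition_def connected_graph_induced_iff)
  have V: "\<Union>(B ` verts T) = verts G"
  proof
    show "\<Union>(B ` verts T) \<subseteq> verts G" using assms(1) by (auto simp: tree_decomposition_def)
    show "verts G \<subseteq> \<Union>(B ` verts T)" using conn_nonempty[OF c] by blast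
  qed
  have "is_tree T" using assms by (simp add: tree_decomposition_def)
  from leaf_tree_rooted_bags[OF tree_leaf_tree[OF this assms(2)], of B] V c show ?thesis
    by (simp add: adj_def[abs_def])
qed

lemma rooted_bags_Union: "rooted_bags b\<^sub>0 V \<B> \<Longrightarrow> \<Union>\<B> = V"
  by (induction rule: rooted_bags.induct) auto

text \<open>This passes to the induced subgraph on \<open>W\<close>, so that elimination can be
  applied to any vertex subset.\<close>

lemma rooted_bags_restrict:
  "rooted_bags b\<^sub>0 V \<B> \<Longrightarrow> rooted_bags (b\<^sub>0 \<inter> W) (V \<inter> W) ((\<lambda>S. S \<inter> W) ` \<B>)"
proof (induction rule: rooted_bags.induct)
  case root
  show ?case using rooted_bags.root[of "b\<^sub>0 \<inter> W"] by simp
next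
  case (leaf V \<B> b S)
  from rooted_bags.leaf[OF leaf.IH, of "b \<inter> W" "S \<inter> W"] leaf.hyps show ?case
    by (auto simp: Int_Un_distrib2)
qed

section \<open>Building tree decompositions by gluing two bags\<close>

inductive glued_bags :: "'a set \<Rightarrow> 'a set set \<Rightarrow> bool" where
  single: "glued_bags S {S}"
| glue: "glued_bags V\<^sub>1 \<B>\<^sub>1 \<Longrightarrow> glued_bags V\<^sub>2 \<B>\<^sub>2 \<Longrightarrow> b\<^sub>1 \<in> \<B>\<^sub>1 \<Longrightarrow> b\<^sub>2 \<in> \<B>\<^sub>2 \<Longrightarrow>
    V\<^sub>1 \<inter> V\<^sub>2 \<subseteq> b\<^sub>1 \<inter> b\<^sub>2 \<Longrightarrow> glued_bags (V\<^sub>1 \<union> V\<^sub>2) (\<B>\<^sub>1 \<union> \<B>\<^sub>2)"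

lemma glued_bags_Union: "glued_bags V \<B> \<Longrightarrow> \<Union>\<B> = V"
  by (induction rule: glued_bags.induct) auto

lemma glued_bags_nonempty: "glued_bags V \<B> \<Longrightarrow> \<B> \<noteq> {}"
  by (induction rule: glued_bags.induct) auto

text \<open>Each gluing becomes a tree edge between nodes for \<open>b\<^sub>1\<close> and
  \<open>b\<^sub>2\<close>. A vertex of both sides lies in both of these bags, so its two connected
  sets of nodes touch along the new edge. The finite set \<open>N\<close> of forbidden names makes
  the two trees disjoint.\<close>

lemma glued_bags_tree:
  assumes "glued_bags V \<B>" "finite N"
  shows "\<exists>(T :: nat ugraph) B. is_tree T \<and> verts T \<inter> N = {} \<and> B ` verts T = \<B> \<and>
    (\<forall>v \<in> V. conn (adj T) {t \<in> verts T. v \<in> B t})"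
  using assms
proof (induction arbitrary: N rule: glued_bags.induct)
  case (single S)
  then obtain n where n: "n \<notin> N" using ex_new_if_finite infinite_UNIV_nat by blast
  have "is_tree \<lparr>verts = {n}, edges = {}\<rparr>"
    by (rule leaf_tree_is_tree[OF leaf_tree.root])
  moreover have "conn (adj \<lparr>verts = {n}, edges = {}\<rparr>) {t \<in> {n}. v \<in> S}" if "v \<in> S" for v
    using that conn_singleton[of _ n] by simp
  ultimately show ?case using n
    by (intro exI[of _ "\<lparr>verts = {n}, edges = {}\<rparr>"] exI[of _ "\<lambda>_. S"]) auto
next
  case (glue V1 \<B>1 V2 \<B>2 b1 b2)
  from glue.IH(1)[OF glue.prems] obtain T1 :: "nat ugraph" and B1 where
    T1: "is_tree T1" "verts T1 \<inter> N = {}" "B1 ` verts T1 = \<B>1"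
    "\<And>v. v \<in> V1 \<Longrightarrow> conn (adj T1) {t \<in> verts T1. v \<in> B1 t}" by blast
  have "finite (N \<union> verts T1)" using T1(1) glue.prems by (auto simp: is_tree_def finite_simple_graph_def)
  from glue.IH(2)[OF this] obtain T2 :: "nat ugraph" and B2 where
    T2: "is_tree T2" "verts T2 \<inter> (N \<union> verts T1) = {}" "B2 ` verts T2 = \<B>2"
    "\<And>v. v \<in> V2 \<Longrightarrow> conn (adj T2) {t \<in> verts T2. v \<in> B2 t}" by blast
  obtain t1 t2 where t: "t1 \<in> verts T1" "B1 t1 = b1" "t2 \<in> verts T2" "B2 t2 = b2"
    using glue.hyps T1(3) T2(3) by blast
  define T where "T = \<lparr>verts = verts T1 \<union> verts T2, edges = insert {t1, t2} (edges T1 \<union> edges T2)\<rparr>"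
  define B where "B t = (if t \<in> verts T1 then B1 t else B2 t)" for t
  have "is_tree T" unfolding T_def
    by (rule leaf_tree_is_tree[OF leaf_tree_join[OF tree_leaf_tree[OF T2(1) t(3)]
      tree_leaf_tree[OF T1(1) t(1)] t(1)]]) (use T2(2) in blast)
  moreover have "verts T \<inter> N = {}" using T1 T2 by (auto simp: T_def)
  moreover have "B ` verts T = \<B>1 \<union> \<B>2"
  proof -
    have "B ` verts T1 = \<B>1" using T1(3) by (auto simp: B_def)
    moreover have "B ` verts T2 = \<B>2" using T2(2,3) by (force simp: B_def)
    ultimately show ?thesis by (auto simp: T_def)
  qed
  moreover have "conn (adj T) {t \<in> verts T. v \<in> B t}" if "v \<in> V1 \<union> V2" for v
  proof -
    let ?A1 = "{t \<in> verts T1. v \<in> B1 t}" and ?A2 = "{t \<in> verts T2. v \<in> B2 t}"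
    have split: "{t \<in> verts T. v \<in> B t} = ?A1 \<union> ?A2"
      using T2(2) by (auto simp: T_def B_def)
    have c1: "conn (adj T) ?A1" if "v \<in> V1"
      by (rule conn_mono[OF T1(4)[OF that]]) (auto simp: adj_def T_def)
    have c2: "conn (adj T) ?A2" if "v \<in> V2"
      by (rule conn_mono[OF T2(4)[OF that]]) (auto simp: adj_def T_def)
    have e1: "?A1 = {}" if "v \<notin> V1" using that glued_bags_Union[OF glue.hyps(1)] T1(3) by blast
    have e2: "?A2 = {}" if "v \<notin> V2" using that glued_bags_Union[OF glue.hyps(2)] T2(3) by blast
    show ?thesis
    proof (cases "v \<in> V1 \<and> v \<in> V2")
      case True
      then have "t1 \<in> ?A1" "t2 \<in> ?A2" using glue.hyps(5) t by auto
      then have "touch (adj T) ?A1 ?A2" unfolding touch_def adj_def T_def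
        by (intro bexI[of _ t1] bexI[of _ t2]) auto
      then show ?thesis unfolding split using conn_Un[OF symp_adj c1 c2] True by blast
    next
      case False
      then show ?thesis unfolding split using that c1 c2 e1 e2 by (metis Un_iff sup_bot.left_neutral sup_bot.right_neutral)
    qed
  qed
  ultimately show ?case by blast
qed

text \<open>The Helly property of subtrees of a tree, phrased for bags.\<close>

lemma bramble_hit_by_bag:
  assumes "rooted_bags b\<^sub>0 V \<B>"
    and "\<And>C. C \<in> \<C> \<Longrightarrow> C \<subseteq> V \<and> conn (\<lambda>x y. \<exists>S \<in> \<B>. x \<in> S \<and> y \<in> S) C"
    and "\<And>C C'. C \<in> \<C> \<Longrightarrow> C' \<in> \<C> \<Longrightarrow> touch (\<lambda>x y. \<exists>S \<in> \<B>. x \<in> S \<and> y \<in> S) C C'"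
  shows "\<exists>S \<in> \<B>. \<forall>C \<in> \<C>. S \<inter> C \<noteq> {}"
  using assms
proof (induction arbitrary: \<C> rule: rooted_bags.induct)
  case root
  have "b\<^sub>0 \<inter> C \<noteq> {}" if "C \<in> \<C>" for C
    using root(1)[OF that] conn_nonempty by blast
  then show ?case by blast
next
  case (leaf V \<B> b S)
  let ?R = "\<lambda>\<B> x y. \<exists>S \<in> \<B>. x \<in> S \<and> y \<in> S"
  have UV: "\<Union>\<B> = V" using rooted_bags_Union leaf.hyps by blast
  show ?case
  proof (cases "\<exists>C \<in> \<C>. C \<inter> V = {}")
    case True
    then obtain C where C: "C \<in> \<C>" "C \<inter> V = {}" by blast
    \<comment> \<open>A vertex outside \<open>V\<close> lies in no bag but \<open>S\<close>, so
      \<open>C\<close> can touch the other sets only through \<open>S\<close>.\<close>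
    have "S \<inter> C' \<noteq> {}" if "C' \<in> \<C>" for C'
      using leaf.prems(2)[OF C(1) that] C(2) UV unfolding touch_def by blast
    then show ?thesis by blast
  next
    case False
    \<comment> \<open>Otherwise no bag would link \<open>C \<inter> V\<close> to the rest of
      \<open>C\<close>, and \<open>C\<close> would lie in \<open>V\<close> altogether.\<close>
    have meet: "C \<inter> V \<inter> S \<noteq> {}" if C: "C \<in> \<C>" "C \<inter> S \<noteq> {}" for C
    proof
      assume e: "C \<inter> V \<inter> S = {}"
      have "C \<inter> V = C"
        by (rule connD[of "?R (insert S \<B>)"]) (use leaf.prems(1)[OF C(1)] C(1) False e UV in blast)+
      then show False using e C(2) by blast
    qed
    have "\<exists>S' \<in> \<B>. \<forall>C \<in> (\<lambda>C. C \<inter> V) ` \<C>. S' \<inter> C \<noteq> {}"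
    proof (rule leaf.IH)
      fix C' assume "C' \<in> (\<lambda>C. C \<inter> V) ` \<C>"
      then obtain C where C: "C \<in> \<C>" "C' = C \<inter> V" by blast
      have cC: "conn (?R (insert S \<B>)) C" using leaf.prems(1)[OF C(1)] by blast
      have "conn (?R \<B>) (C \<inter> V)"
      proof (rule connI)
        show "C \<inter> V \<noteq> {}" using False C by blast
        fix Q assume Q: "Q \<subseteq> C \<inter> V" "Q \<noteq> {}" "\<And>x y. x \<in> Q \<Longrightarrow> y \<in> C \<inter> V \<Longrightarrow> ?R \<B> x y \<Longrightarrow> y \<in> Q"
        then obtain q where q: "q \<in> Q" by blast
        \<comment> \<open>In \<open>C\<close> one may also step through the bag \<open>S\<close>.
          Adding \<open>C \<inter> S\<close> once \<open>Q\<close> meets \<open>S\<close> closes the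
          set under such steps, and it adds nothing inside \<open>V\<close>, because
          \<open>S \<inter> V\<close> lies in the old bag \<open>b\<close>.\<close>
        let ?Q = "Q \<union> {x \<in> C \<inter> S. Q \<inter> S \<noteq> {}}"
        have SV: "y \<in> Q" if "x \<in> Q" "x \<in> S" "y \<in> S" "y \<in> C" "y \<in> V" for x y
          using that Q leaf.hyps by blast
        have "C \<subseteq> ?Q"
        proof (rule conn_closed_superset[OF cC, of q])
          show "q \<in> C" "q \<in> ?Q" using q Q by blast+
          fix x y assume x: "x \<in> ?Q" "y \<in> C" "?R (insert S \<B>) x y"
          show "y \<in> ?Q"
          proof (cases "x \<in> S \<and> y \<in> S")
            case True
            then show ?thesis using x by blast
          next
            case False
            then obtain S' where S': "S' \<in> \<B>" "x \<in> S'" "y \<in> S'" using x(3) by blast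
            then have "x \<in> V" "y \<in> V" using UV by blast+
            then have "x \<in> Q" using x(1) SV by blast
            then show ?thesis using Q(3) S' x(2) \<open>y \<in> V\<close> by blast
          qed
        qed
        then show "C \<inter> V \<subseteq> Q" using SV by blast
      qed
      then show "C' \<subseteq> V \<and> conn (?R \<B>) C'" using C by blast
    next
      fix C C' assume "C \<in> (\<lambda>C. C \<inter> V) ` \<C>" "C' \<in> (\<lambda>C. C \<inter> V) ` \<C>"
      then obtain D D' where D: "D \<in> \<C>" "C = D \<inter> V" "D' \<in> \<C>" "C' = D' \<inter> V" by blast
      from leaf.prems(2)[OF D(1,3)] obtain x y S' where
        xy: "x \<in> D" "y \<in> D'" "S' \<in> insert S \<B>" "x \<in> S'" "y \<in> S'" unfolding touch_def by blast
      show "touch (?R \<B>) C C'"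
      proof (cases "S' \<in> \<B>")
        case True
        then show ?thesis using xy D UV unfolding touch_def by blast
      next
        case False
        then have "D \<inter> S \<noteq> {}" "D' \<inter> S \<noteq> {}" using xy by auto
        then obtain u w where "u \<in> D \<inter> V \<inter> S" "w \<in> D' \<inter> V \<inter> S"
          using meet[OF D(1)] meet[OF D(3)] by blast
        then show ?thesis using D(2,4) leaf.hyps(2,3) unfolding touch_def by blast
      qed
    qed
    then obtain S' where S': "S' \<in> \<B>" "\<And>C. C \<in> \<C> \<Longrightarrow> S' \<inter> (C \<inter> V) \<noteq> {}" by auto
    have "S' \<inter> C \<noteq> {}" if "C \<in> \<C>" for C using S'(2)[OF that] by blast
    then show ?thesis using S'(1) by (intro bexI[of _ S']) auto
  qed
qed

section \<open>Induced minor models\<close>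

text \<open>Branch sets of an induced minor: vertices outside all of them are deleted, and the
  equivalence for \<open>touch\<close> is what makes the minor induced.\<close>

definition induced_minor_model ::
    "'b ugraph \<Rightarrow> ('a \<Rightarrow> 'a \<Rightarrow> bool) \<Rightarrow> 'a set \<Rightarrow> ('b \<Rightarrow> 'a set) \<Rightarrow> bool" where
  "induced_minor_model F r V \<phi> \<longleftrightarrow>
     (\<forall>x \<in> verts F. \<phi> x \<subseteq> V \<and> conn r (\<phi> x)) \<and>
     (\<forall>x \<in> verts F. \<forall>y \<in> verts F. x \<noteq> y \<longrightarrow>
        \<phi> x \<inter> \<phi> y = {} \<and> (touch r (\<phi> x) (\<phi> y) \<longleftrightarrow> adj F x y))"

lemma simple_contract_edge:
  assumes "finite_simple_graph H" "adj H x y"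
  shows "finite_simple_graph (contract_edge H x y)"
  unfolding finite_simple_graph_def
proof (intro conjI ballI)
  show "finite (verts (contract_edge H x y))"
    using assms by (simp add: finite_simple_graph_def contract_edge_def)
  fix e assume "e \<in> edges (contract_edge H x y)"
  then obtain e' where e': "e' \<in> edges H" "e' \<noteq> {x, y}" "e = (\<lambda>v. if v = y then x else v) ` e'"
    by (auto simp: contract_edge_def)
  obtain a b where ab: "e' = {a, b}" "a \<noteq> b" "a \<in> verts H" "b \<in> verts H"
    using edge_adjE[OF assms(1) e'(1)] by metis
  define g where "g v = (if v = y then x else v)" for v
  have e: "e = {g a, g b}" using e'(3) ab(1) by (simp add: g_def)
  have "g a \<noteq> g b" using e'(2) ab(1,2) by (auto simp: g_def split: if_splits)
  then show "card e = 2" unfolding e by simp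
  show "e \<subseteq> verts (contract_edge H x y)"
    unfolding e using ab adj_verts[OF assms] adj_neq[OF assms] by (simp add: g_def contract_edge_def)
qed

lemma adj_contract_edge:
  assumes "finite_simple_graph H" "adj H x y" "u \<noteq> v" "u \<noteq> y" "v \<noteq> y"
  shows "adj (contract_edge H x y) u v \<longleftrightarrow>
    adj H u v \<or> (u = x \<and> adj H y v) \<or> (v = x \<and> adj H y u)"
proof
  assume "adj (contract_edge H x y) u v"
  then obtain e' where e': "e' \<in> edges H" "e' \<noteq> {x, y}"
      "{u, v} = (\<lambda>v. if v = y then x else v) ` e'"
    by (auto simp: contract_edge_def adj_def)
  obtain a b where ab: "e' = {a, b}" "a \<noteq> b" "adj H a b"
    using edge_adjE[OF assms(1) e'(1)] by metis
  define g where "g v = (if v = y then x else v)" for v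
  have "{u, v} = {g a, g b}" using e'(3) ab(1) by (simp add: g_def)
  then consider "u = g a" "v = g b" | "u = g b" "v = g a" by (auto simp: doubleton_eq_iff)
  then show "adj H u v \<or> (u = x \<and> adj H y v) \<or> (v = x \<and> adj H y u)"
    using ab(2,3) adj_sym[OF ab(3)] by cases (auto simp: g_def split: if_splits)
next
  have img: "adj (contract_edge H x y) u v"
    if "adj H a b" "{a, b} \<noteq> {x, y}" "{u, v} = (\<lambda>v. if v = y then x else v) ` {a, b}" for a b
    using that unfolding contract_edge_def adj_def by auto
  assume "adj H u v \<or> (u = x \<and> adj H y v) \<or> (v = x \<and> adj H y u)"
  then consider "adj H u v" | "u = x" "adj H y v" | "v = x" "adj H y u" by blast
  then show "adj (contract_edge H x y) u v"
  proof cases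
    case 1
    then show ?thesis by (rule img) (use assms in \<open>auto simp: doubleton_eq_iff\<close>)
  next
    case 2
    then show ?thesis by (intro img[of y v]) (use assms in \<open>auto simp: doubleton_eq_iff\<close>)
  next
    case 3
    then show ?thesis by (intro img[of y u]) (use assms in \<open>auto simp: doubleton_eq_iff\<close>)
  qed
qed

lemma simple_induced_subgraph:
  assumes "finite_simple_graph G" "S \<subseteq> verts G"
  shows "finite_simple_graph (induced_subgraph G S)"
  using assms by (auto simp: finite_simple_graph_def induced_subgraph_def intro: finite_subset)

text \<open>Each vertex of \<open>H\<close> carries the set of vertices contracted into it.
  Contracting an edge unites the sets at its two ends, which touch because of the edge.\<close>

lemma contracts_to_model:
  assumes "contracts_to G H" "finite_simple_graph G"
  shows "finite_simple_graph H \<and> (\<exists>\<beta>. induced_minor_model H (adj G) (verts G) \<beta>)"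
  using assms
proof (induction rule: contracts_to.induct)
  case (refl G)
  have "induced_minor_model G (adj G) (verts G) (\<lambda>v. {v})"
    by (auto simp: induced_minor_model_def conn_singleton touch_def)
  then show ?case using refl by blast
next
  case (step G H x y)
  then obtain \<beta> where H: "finite_simple_graph H" and \<beta>: "induced_minor_model H (adj G) (verts G) \<beta>"
    by blast
  have xy: "adj H x y" using step.hyps by (simp add: adj_def)
  have xyV: "x \<in> verts H" "y \<in> verts H" "x \<noteq> y"
    using adj_verts[OF H xy] adj_neq[OF H xy] by auto
  define \<gamma> where "\<gamma> v = (if v = x then \<beta> x \<union> \<beta> y else \<beta> v)" for v
  let ?H = "contract_edge H x y"
  have V: "verts ?H = verts H - {y}" by (simp add: contract_edge_def)
  have b: "\<And>v. v \<in> verts H \<Longrightarrow> \<beta> v \<subseteq> verts G \<and> conn (adj G) (\<beta> v)"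
    "\<And>u v. u \<in> verts H \<Longrightarrow> v \<in> verts H \<Longrightarrow> u \<noteq> v \<Longrightarrow> \<beta> u \<inter> \<beta> v = {}"
    "\<And>u v. u \<in> verts H \<Longrightarrow> v \<in> verts H \<Longrightarrow> u \<noteq> v \<Longrightarrow> touch (adj G) (\<beta> u) (\<beta> v) \<longleftrightarrow> adj H u v"
    using \<beta> by (auto simp: induced_minor_model_def)
  have tU: "touch (adj G) (A \<union> B) C \<longleftrightarrow> touch (adj G) A C \<or> touch (adj G) B C"
    "touch (adj G) C (A \<union> B) \<longleftrightarrow> touch (adj G) C A \<or> touch (adj G) C B" for A B C
    by (auto simp: touch_def)
  have "induced_minor_model ?H (adj G) (verts G) \<gamma>"
    unfolding induced_minor_model_def V
  proof (intro conjI ballI impI)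
    fix v assume v: "v \<in> verts H - {y}"
    show "\<gamma> v \<subseteq> verts G" using b(1) v xyV by (auto simp: \<gamma>_def)
    show "conn (adj G) (\<gamma> v)"
      using b(1) v xyV conn_Un[OF symp_adj, of G "\<beta> x" "\<beta> y"] b(3)[OF xyV] xy by (auto simp: \<gamma>_def)
  next
    fix u v assume uv: "u \<in> verts H - {y}" "v \<in> verts H - {y}" "u \<noteq> v"
    then have uv': "u \<in> verts H" "v \<in> verts H" "u \<noteq> y" "v \<noteq> y" by auto
    note d = b(2)[OF uv'(1,2) uv(3)] b(2)[OF xyV(1) uv'(2)] b(2)[OF xyV(2) uv'(2)]
      b(2)[OF uv'(1) xyV(1)] b(2)[OF uv'(1) xyV(2)]
    show "\<gamma> u \<inter> \<gamma> v = {}" using d uv uv' by (auto simp: \<gamma>_def)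
    show "touch (adj G) (\<gamma> u) (\<gamma> v) \<longleftrightarrow> adj ?H u v"
      unfolding adj_contract_edge[OF H xy uv(3) uv'(3,4)]
      using b(3) uv uv' xyV by (auto simp: \<gamma>_def tU dest: adj_sym)
  qed
  then show ?case using simple_contract_edge[OF H xy] by blast
qed

text \<open>\<open>f\<close> labels the vertices of \<open>H\<close> by the vertices of
  \<open>F\<close> whose branch sets they lie in. If two vertices share a label, connectedness gives
  an edge inside their branch set; contracting it keeps all hypotheses and loses a vertex. Once the
  labels are distinct, the inverse of \<open>f\<close> is an isomorphism.\<close>

lemma contracts_to_of_model:
  assumes "contracts_to G H" "finite_simple_graph H" "finite_simple_graph F"
    and "f ` verts H = verts F"
    and "\<And>w. w \<in> verts F \<Longrightarrow> conn (adj H) {v \<in> verts H. f v = w}"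
    and "\<And>u w. u \<in> verts F \<Longrightarrow> w \<in> verts F \<Longrightarrow> u \<noteq> w \<Longrightarrow>
      adj F u w \<longleftrightarrow> touch (adj H) {v \<in> verts H. f v = u} {v \<in> verts H. f v = w}"
  shows "\<exists>H'. contracts_to G H' \<and> graph_iso F H'"
  using assms
proof (induction "card (verts H)" arbitrary: H rule: less_induct)
  case less
  show ?case
  proof (cases "inj_on f (verts H)")
    case True
    define g where "g = inv_into (verts H) f"
    have bij: "bij_betw g (verts F) (verts H)"
      unfolding g_def using True less.prems(4) by (intro bij_betw_inv_into) (simp add: bij_betw_def)
    have fib: "{v \<in> verts H. f v = u} = {g u}" if u: "u \<in> verts F" for u
    proof -
      have "g u \<in> verts H" "f (g u) = u"
        using u less.prems(4) by (auto simp: g_def inv_into_into f_inv_into_f)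
      then show ?thesis using True by (auto simp: inj_on_def)
    qed
    have "{x, y} \<in> edges F \<longleftrightarrow> {g x, g y} \<in> edges H" if "x \<in> verts F" "y \<in> verts F" for x y
    proof (cases "x = y")
      case True
      then show ?thesis using less.prems(2,3) by (auto simp: finite_simple_graph_def)
    next
      case False
      then show ?thesis
        using less.prems(6)[OF that] fib that by (auto simp: adj_def touch_def)
    qed
    then show ?thesis using bij less.prems(1) unfolding graph_iso_def by blast
  next
    case False
    then obtain a b where ab: "a \<in> verts H" "b \<in> verts H" "a \<noteq> b" "f a = f b"
      by (auto simp: inj_on_def)
    have "\<exists>y \<in> verts H. f y = f a \<and> adj H a y"
    proof (rule ccontr)
      assume none: "\<not> ?thesis"
      have "f a \<in> verts F" using ab less.prems(4) by blast
      from connD[OF less.prems(5)[OF this], of "{a}"] none ab show False by auto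
    qed
    then obtain y where y: "y \<in> verts H" "f y = f a" "adj H a y" by blast
    let ?H = "contract_edge H a y"
    have ay: "a \<noteq> y" using adj_neq[OF less.prems(2) y(3)] .
    have V: "verts ?H = verts H - {y}" by (simp add: contract_edge_def)
    note adj = adj_contract_edge[OF less.prems(2) y(3)]
    \<comment> \<open>The contraction as a map on vertices; it preserves labels, and adjacency
      whenever the images differ.\<close>
    define g where "g v = (if v = y then a else v)" for v
    have gadj: "adj ?H (g u) (g v)" if "adj H u v" "g u \<noteq> g v" for u v
      using that ay adj[of "g u" "g v"] by (auto simp: g_def dest: adj_sym)
    have fg: "f (g v) = f v" for v using y by (auto simp: g_def)
    have gV: "g v \<in> verts ?H" if "v \<in> verts H" for v using that V ab ay by (auto simp: g_def)
    show ?thesis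
    proof (rule less.hyps[of ?H])
      have "finite (verts H)" using less.prems(2) by (simp add: finite_simple_graph_def)
      then show "card (verts ?H) < card (verts H)" unfolding V using y(1)
        by (intro psubset_card_mono) auto
      show "contracts_to G ?H" using contracts_to.step[OF less.prems(1)] y(3) by (simp add: adj_def)
      show "finite_simple_graph ?H" by (rule simple_contract_edge[OF less.prems(2) y(3)])
      show "finite_simple_graph F" by (rule less.prems(3))
      have "f v \<in> f ` (verts H - {y})" if "v \<in> verts H" for v
        using that ab(1) ay y(2) by (cases "v = y") auto
      then have "f ` verts H \<subseteq> f ` (verts H - {y})" by (rule image_subsetI)
      then show "f ` verts ?H = verts F" unfolding V less.prems(4)[symmetric]
        using image_mono[of "verts H - {y}" "verts H" f] by (intro subset_antisym) auto
    next
      fix w assume w: "w \<in> verts F"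
      show "conn (adj ?H) {v \<in> verts ?H. f v = w}"
      proof (rule connI)
        obtain v where v: "v \<in> verts H" "f v = w" using w less.prems(4)[symmetric] by auto
        then have "g v \<in> {v \<in> verts ?H. f v = w}" using gV fg by auto
        then show "{v \<in> verts ?H. f v = w} \<noteq> {}" by blast
        fix Q assume Q: "Q \<subseteq> {v \<in> verts ?H. f v = w}" "Q \<noteq> {}"
          "\<And>x z. x \<in> Q \<Longrightarrow> z \<in> {v \<in> verts ?H. f v = w} \<Longrightarrow> adj ?H x z \<Longrightarrow> z \<in> Q"
        then obtain q where q: "q \<in> Q" by blast
        then have qy: "q \<in> verts H" "q \<noteq> y" "f q = w" using Q(1) V by auto
        \<comment> \<open>The preimage of a closed set under \<open>g\<close> is closed in the
          branch set before the contraction.\<close>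
        have "{v \<in> verts H. f v = w} \<subseteq> {v. g v \<in> Q}"
        proof (rule conn_closed_superset[OF less.prems(5)[OF w], of q])
          show "q \<in> {v \<in> verts H. f v = w}" "q \<in> {v. g v \<in> Q}" using qy q by (auto simp: g_def)
          fix x z assume xz: "x \<in> {v. g v \<in> Q}" "z \<in> {v \<in> verts H. f v = w}" "adj H x z"
          show "z \<in> {v. g v \<in> Q}"
          proof (cases "g x = g z")
            case True
            then show ?thesis using xz by simp
          next
            case False
            have "g z \<in> {v \<in> verts ?H. f v = w}" using xz(2) gV fg by auto
            then show ?thesis using Q(3)[of "g x" "g z"] gadj[OF xz(3) False] xz(1) by simp
          qed
        qed
        moreover have "g v = v" if "v \<in> verts ?H" for v using that V by (auto simp: g_def)
        ultimately show "{v \<in> verts ?H. f v = w} \<subseteq> Q" using V by fastforce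
      qed
    next
      fix u w assume uw: "u \<in> verts F" "w \<in> verts F" "u \<noteq> w"
      have "touch (adj H) {v \<in> verts H. f v = u} {v \<in> verts H. f v = w} \<longleftrightarrow>
        touch (adj ?H) {v \<in> verts ?H. f v = u} {v \<in> verts ?H. f v = w}" (is "?L \<longleftrightarrow> ?R")
      proof
        assume ?L
        then obtain s t where st: "s \<in> verts H" "f s = u" "t \<in> verts H" "f t = w" "adj H s t"
          by (auto simp: touch_def)
        then have "adj ?H (g s) (g t)" using gadj fg uw(3) by metis
        then show ?R unfolding touch_def
          using st gV fg by (intro bexI[of _ "g s"] bexI[of _ "g t"]) auto
      next
        assume ?R
        then obtain s t where st: "s \<in> verts H" "s \<noteq> y" "f s = u" "t \<in> verts H" "t \<noteq> y" "f t = w"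
          "adj ?H s t" by (auto simp: touch_def V)
        then have "adj H s t \<or> (s = a \<and> adj H y t) \<or> (t = a \<and> adj H y s)"
          using adj[of s t] uw(3) by auto
        then show ?L unfolding touch_def using st y by (auto dest: adj_sym)
      qed
      then show "adj F u w \<longleftrightarrow> touch (adj ?H) {v \<in> verts ?H. f v = u} {v \<in> verts ?H. f v = w}"
        using less.prems(6)[OF uw] by simp
    qed
  qed
qed

lemma induced_minor_iff_model:
  assumes G: "finite_simple_graph G" and F: "finite_simple_graph F"
  shows "induced_minor F G \<longleftrightarrow> (\<exists>\<phi>. induced_minor_model F (adj G) (verts G) \<phi>)"
proof
  assume "induced_minor F G"
  then obtain S H f where S: "S \<subseteq> verts G" and H: "contracts_to (induced_subgraph G S) H"
    and bij: "bij_betw f (verts F) (verts H)"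
    and f: "\<And>x y. x \<in> verts F \<Longrightarrow> y \<in> verts F \<Longrightarrow> adj F x y \<longleftrightarrow> adj H (f x) (f y)"
    by (auto simp: induced_minor_def graph_iso_def adj_def)
  let ?G = "induced_subgraph G S"
  from contracts_to_model[OF H simple_induced_subgraph[OF G S]] obtain \<beta>
    where \<beta>: "induced_minor_model H (adj ?G) (verts ?G) \<beta>" by blast
  have VS: "verts ?G = S" by (simp add: induced_subgraph_def)
  have eq: "adj ?G x y \<longleftrightarrow> adj G x y" if "x \<in> S" "y \<in> S" for x y
    using that by (auto simp: adj_def induced_subgraph_def)
  have fV: "f x \<in> verts H" if "x \<in> verts F" for x using bij that by (auto simp: bij_betw_def)
  have "induced_minor_model F (adj G) (verts G) (\<lambda>x. \<beta> (f x))"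
    unfolding induced_minor_model_def
  proof (intro conjI ballI impI)
    fix x assume x: "x \<in> verts F"
    have b: "\<beta> (f x) \<subseteq> S" "conn (adj ?G) (\<beta> (f x))"
      using \<beta> fV[OF x] by (auto simp: induced_minor_model_def VS)
    show "\<beta> (f x) \<subseteq> verts G" using b S by blast
    show "conn (adj G) (\<beta> (f x))" by (rule conn_mono[OF b(2)]) (use b(1) eq in blast)
  next
    fix x y assume xy: "x \<in> verts F" "y \<in> verts F" "x \<noteq> y"
    have ne: "f x \<noteq> f y" using bij xy by (auto simp: bij_betw_def inj_on_def)
    have sub: "\<beta> (f x) \<subseteq> S" "\<beta> (f y) \<subseteq> S"
      using \<beta> fV xy by (auto simp: induced_minor_model_def VS)
    show "\<beta> (f x) \<inter> \<beta> (f y) = {}"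
      using \<beta> fV xy ne by (auto simp: induced_minor_model_def)
    have "touch (adj G) (\<beta> (f x)) (\<beta> (f y)) \<longleftrightarrow> touch (adj ?G) (\<beta> (f x)) (\<beta> (f y))"
      using sub eq unfolding touch_def by blast
    then show "touch (adj G) (\<beta> (f x)) (\<beta> (f y)) \<longleftrightarrow> adj F x y"
      using \<beta> fV xy ne f by (auto simp: induced_minor_model_def)
  qed
  then show "\<exists>\<phi>. induced_minor_model F (adj G) (verts G) \<phi>" by blast
next
  assume "\<exists>\<phi>. induced_minor_model F (adj G) (verts G) \<phi>"
  then obtain \<phi> where \<phi>: "induced_minor_model F (adj G) (verts G) \<phi>" by blast
  have p: "\<And>x. x \<in> verts F \<Longrightarrow> \<phi> x \<subseteq> verts G \<and> conn (adj G) (\<phi> x)"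
    "\<And>u v. u \<in> verts F \<Longrightarrow> v \<in> verts F \<Longrightarrow> u \<noteq> v \<Longrightarrow> \<phi> u \<inter> \<phi> v = {}"
    "\<And>u v. u \<in> verts F \<Longrightarrow> v \<in> verts F \<Longrightarrow> u \<noteq> v \<Longrightarrow> touch (adj G) (\<phi> u) (\<phi> v) \<longleftrightarrow> adj F u v"
    using \<phi> by (auto simp: induced_minor_model_def)
  define S where "S = \<Union>(\<phi> ` verts F)"
  have S: "S \<subseteq> verts G" using p(1) by (auto simp: S_def)
  let ?G = "induced_subgraph G S"
  have VS: "verts ?G = S" by (simp add: induced_subgraph_def)
  have eq: "adj ?G x y \<longleftrightarrow> adj G x y" if "x \<in> S" "y \<in> S" for x y
    using that by (auto simp: adj_def induced_subgraph_def)
  define f where "f v = (SOME x. x \<in> verts F \<and> v \<in> \<phi> x)" for v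
  have fx: "f v = x" if "x \<in> verts F" "v \<in> \<phi> x" for v x
    unfolding f_def by (rule some_equality) (use that p(2) in blast)+
  have fib: "{v \<in> verts ?G. f v = x} = \<phi> x" if "x \<in> verts F" for x
    using that fx unfolding VS by (auto simp: S_def)
  have "\<exists>H'. contracts_to ?G H' \<and> graph_iso F H'"
  proof (rule contracts_to_of_model[where f = f])
    show "contracts_to ?G ?G" by (rule contracts_to.refl)
    show "finite_simple_graph ?G" by (rule simple_induced_subgraph[OF G S])
    show "finite_simple_graph F" by (rule F)
    show "f ` verts ?G = verts F"
    proof
      show "f ` verts ?G \<subseteq> verts F" using fx unfolding VS by (auto simp: S_def)
      show "verts F \<subseteq> f ` verts ?G"
      proof
        fix x assume x: "x \<in> verts F"
        then obtain v where "v \<in> \<phi> x" using p(1) conn_nonempty by blast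
        then show "x \<in> f ` verts ?G" using fx[OF x] fib[OF x] by force
      qed
    qed
    show "conn (adj ?G) {v \<in> verts ?G. f v = w}" if w: "w \<in> verts F" for w
    proof -
      have "\<phi> w \<subseteq> S" using w by (auto simp: S_def)
      then show ?thesis unfolding fib[OF w]
        using eq by (intro conn_mono[OF conjunct2[OF p(1)[OF w]]]) blast
    qed
    show "adj F u w \<longleftrightarrow> touch (adj ?G) {v \<in> verts ?G. f v = u} {v \<in> verts ?G. f v = w}"
      if uw: "u \<in> verts F" "w \<in> verts F" "u \<noteq> w" for u w
    proof -
      have "\<phi> u \<subseteq> S" "\<phi> w \<subseteq> S" using uw by (auto simp: S_def)
      then have "touch (adj ?G) (\<phi> u) (\<phi> w) \<longleftrightarrow> touch (adj G) (\<phi> u) (\<phi> w)"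
        using eq unfolding touch_def by blast
      then show ?thesis unfolding fib[OF uw(1)] fib[OF uw(2)] using p(3)[OF uw] by simp
    qed
  qed
  then show "induced_minor F G" using S unfolding induced_minor_def by blast
qed

lemma simple_X_graph: "finite_simple_graph X_graph"
  by (simp add: finite_simple_graph_def X_graph_def)

section \<open>Matched tree decompositions of width 3 exclude X\<close>

text \<open>At most one vertex of the bag is unmatched, so two of the three are matched, and by
  different edges as they are nonadjacent. These edges fill the bag; hence the third vertex lies on
  one of them, together with a vertex to which it is not adjacent.\<close>

lemma matched_bag_no_independent_triple:
  assumes G: "finite_simple_graph G" and S: "matched_bag G S" "finite S" "card S \<le> 4"
    and xyz: "x \<in> S" "y \<in> S" "z \<in> S" "x \<noteq> y" "y \<noteq> z" "x \<noteq> z"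
    and na: "\<not> adj G x y" "\<not> adj G y z" "\<not> adj G x z"
  shows False
proof -
  from S(1) obtain M where M: "matching (induced_subgraph G S) M"
    and cov: "\<Union>M = S \<or> (\<exists>v \<in> S. \<Union>M = S - {v})" unfolding matched_bag_def by blast
  have ME: "e \<in> edges G" "e \<subseteq> S" if "e \<in> M" for e
    using M that by (auto simp: matching_def induced_subgraph_def)
  have Mdis: "e \<inter> e' = {}" if "e \<in> M" "e' \<in> M" "e \<noteq> e'" for e e'
    using M that by (auto simp: matching_def)
  have two: "card (e \<union> e') = 4 \<and> e \<union> e' \<subseteq> S \<and> finite (e \<union> e') \<and> e \<inter> e' = {}"
    if e: "e \<in> M" "e' \<in> M" "a \<in> e" "b \<in> e'" "a \<noteq> b" "\<not> adj G a b" for e e' a b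
  proof -
    have c: "card e = 2" "card e' = 2" using ME e G by (auto simp: finite_simple_graph_def)
    then have f: "finite e" "finite e'" by (auto intro: card_ge_0_finite)
    have "e \<noteq> e'"
    proof
      assume "e = e'"
      then have "e = {a, b}" using c e f by (auto simp: card_2_iff)
      then show False using e ME by (auto simp: adj_def)
    qed
    then have "e \<inter> e' = {}" using Mdis e by blast
    then show ?thesis using card_Un_disjoint[OF f] c ME e f by auto
  qed
  have full: "e \<union> e' = S" if "e \<in> M" "e' \<in> M" "a \<in> e" "b \<in> e'" "a \<noteq> b" "\<not> adj G a b" for e e' a b
    using two[OF that] S by (intro card_seteq) auto
  have in2: "w \<notin> S" if e: "e \<in> M" "e' \<in> M" "a \<in> e" "b \<in> e'" "a \<noteq> b" "\<not> adj G a b"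
    and w: "w \<noteq> a" "w \<noteq> b" "\<not> adj G a w" "\<not> adj G b w" for e e' a b w
  proof
    assume "w \<in> S"
    then consider "w \<in> e" | "w \<in> e'" using full[OF e] by blast
    then show False
    proof cases
      case 1
      \<comment> \<open>With the same edge taken twice, \<open>two\<close> says that this edge is
        disjoint from itself.\<close>
      then show False using two[of e e a w] e w by (metis Int_absorb empty_iff)
    next
      case 2
      then show False using two[of e' e' b w] e w by (metis Int_absorb empty_iff)
    qed
  qed
  have na': "\<not> adj G y x" "\<not> adj G z y" "\<not> adj G z x" using na adj_sym by metis+
  from cov consider "x \<in> \<Union>M" "y \<in> \<Union>M" | "x \<in> \<Union>M" "z \<in> \<Union>M" | "y \<in> \<Union>M" "z \<in> \<Union>M"
    using xyz by blast
  then show False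
  proof cases
    case 1
    then obtain e e' where "e \<in> M" "e' \<in> M" "x \<in> e" "y \<in> e'" by blast
    from in2[OF this, of z] show False using xyz na by auto
  next
    case 2
    then obtain e e' where "e \<in> M" "e' \<in> M" "x \<in> e" "z \<in> e'" by blast
    from in2[OF this, of y] show False using xyz na na' by auto
  next
    case 3
    then obtain e e' where "e \<in> M" "e' \<in> M" "y \<in> e" "z \<in> e'" by blast
    from in2[OF this, of x] show False using xyz na na' by auto
  qed
qed

lemma X_verts: "x \<in> verts X_graph"
  by (cases x) (auto simp: X_graph_def)

lemma adj_X_graph:
  "adj X_graph x y \<longleftrightarrow> (case x of
     U0 \<Rightarrow> y \<in> {U1, U5, U1', U5'} | U2 \<Rightarrow> y \<in> {U1, U3, U1', U3'} | U4 \<Rightarrow> y \<in> {U3, U5, U3', U5'}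
   | U1 \<Rightarrow> y \<in> {U0, U2} | U1' \<Rightarrow> y \<in> {U0, U2} | U3 \<Rightarrow> y \<in> {U2, U4} | U3' \<Rightarrow> y \<in> {U2, U4}
   | U5 \<Rightarrow> y \<in> {U4, U0} | U5' \<Rightarrow> y \<in> {U4, U0})"
  by (cases x; cases y; simp add: adj_def X_graph_def doubleton_eq_iff)

lemma X_model_not_mtw_le_3:
  assumes G: "finite_simple_graph G"
    and \<phi>: "induced_minor_model X_graph (adj G) (verts G) \<phi>"
    and TB: "matched_tree_decomposition G T B" and card: "\<And>t. t \<in> verts T \<Longrightarrow> card (B t) \<le> 4"
  shows False
proof -
  have p: "\<And>x. \<phi> x \<subseteq> verts G \<and> conn (adj G) (\<phi> x)"
    "\<And>u v. u \<noteq> v \<Longrightarrow> \<phi> u \<inter> \<phi> v = {}"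
    "\<And>u v. u \<noteq> v \<Longrightarrow> touch (adj G) (\<phi> u) (\<phi> v) \<longleftrightarrow> adj X_graph u v"
    using \<phi> X_verts by (auto simp: induced_minor_model_def)
  have td: "tree_decomposition G T B" using TB by (simp add: matched_tree_decomposition_def)
  then obtain t0 where t0: "t0 \<in> verts T"
    by (auto simp: tree_decomposition_def is_tree_def connected_graph_def)
  note rb = tree_decomposition_rooted_bags[OF td t0]
  let ?R = "\<lambda>x y. \<exists>S \<in> B ` verts T. x \<in> S \<and> y \<in> S"
  have RV: "?R x x" if "x \<in> verts G" for x
    using rooted_bags_Union[OF rb] that by blast
  have RE: "?R x y" if "adj G x y" for x y
  proof -
    have "\<exists>t \<in> verts T. {x, y} \<subseteq> B t" using td that unfolding tree_decomposition_def adj_def by blast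
    then show ?thesis by auto
  qed
  \<comment> \<open>All choices among the twins are included; this later forces a bag that misses a
    hub to meet both twins of one side.\<close>
  define I where "I = {(U0, a, b) | a b. a \<in> {U1, U1'} \<and> b \<in> {U5, U5'}} \<union>
    {(U2, a, b) | a b. a \<in> {U1, U1'} \<and> b \<in> {U3, U3'}} \<union>
    {(U4, a, b) | a b. a \<in> {U3, U3'} \<and> b \<in> {U5, U5'}}"
  define \<psi> where "\<psi> = (\<lambda>(h, a, b). \<phi> h \<union> \<phi> a \<union> \<phi> b)"
  have star: "adj X_graph h a \<and> adj X_graph h b \<and> h \<noteq> a \<and> h \<noteq> b" if "(h, a, b) \<in> I" for h a b
    using that unfolding I_def by (auto simp: adj_X_graph)
  have near: "\<exists>u \<in> {h, a, b}. \<exists>u' \<in> {h', a', b'}. u = u' \<or> u \<noteq> u' \<and> adj X_graph u u'"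
    if "(h, a, b) \<in> I" "(h', a', b') \<in> I" for h a b h' a' b'
  proof -
    \<comment> \<open>For different hubs, the first triple contains a vertex between the two, which
      is adjacent to the second hub.\<close>
    have "h = h' \<or> (a \<noteq> h' \<and> adj X_graph a h') \<or> (b \<noteq> h' \<and> adj X_graph b h')"
      using that unfolding I_def by (auto simp: adj_X_graph)
    then show ?thesis by blast
  qed
  have "\<exists>S \<in> B ` verts T. \<forall>C \<in> \<psi> ` I. S \<inter> C \<noteq> {}"
  proof (rule bramble_hit_by_bag[OF rb])
    fix C assume "C \<in> \<psi> ` I"
    then obtain h a b where C: "(h, a, b) \<in> I" "C = \<phi> h \<union> \<phi> a \<union> \<phi> b" by (auto simp: \<psi>_def)
    have ta: "touch (adj G) (\<phi> h) (\<phi> a)" and tb: "touch (adj G) (\<phi> h) (\<phi> b)"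
      using star[OF C(1)] p(3) by auto
    have "conn (adj G) (\<phi> h \<union> \<phi> a)" using conn_Un[OF symp_adj] p(1) ta by blast
    moreover have "touch (adj G) (\<phi> h \<union> \<phi> a) (\<phi> b)" using tb by (auto simp: touch_def)
    ultimately have "conn (adj G) C" unfolding C(2) using conn_Un[OF symp_adj] p(1) by blast
    then have "conn ?R C" by (rule conn_mono) (rule RE)
    then show "C \<subseteq> verts G \<and> conn ?R C" using C p(1) by auto
  next
    fix C C' assume "C \<in> \<psi> ` I" "C' \<in> \<psi> ` I"
    then obtain h a b h' a' b' where C: "(h, a, b) \<in> I" "C = \<phi> h \<union> \<phi> a \<union> \<phi> b"
      "(h', a', b') \<in> I" "C' = \<phi> h' \<union> \<phi> a' \<union> \<phi> b'" by (auto simp: \<psi>_def)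
    obtain u u' where u: "u \<in> {h, a, b}" "u' \<in> {h', a', b'}"
      "u = u' \<or> u \<noteq> u' \<and> adj X_graph u u'" using near[OF C(1,3)] by blast
    have sub: "\<phi> u \<subseteq> C" "\<phi> u' \<subseteq> C'" using u C by auto
    have "touch ?R (\<phi> u) (\<phi> u')"
    proof (cases "u = u'")
      case True
      obtain x where x: "x \<in> \<phi> u" using conn_nonempty[OF conjunct2[OF p(1)[of u]]] by blast
      then have "?R x x" using RV p(1)[of u] by (auto simp del: bex_simps)
      then show ?thesis using True x unfolding touch_def by blast
    next
      case False
      then obtain x y where "x \<in> \<phi> u" "y \<in> \<phi> u'" "adj G x y"
        using u(3) p(3)[of u u'] by (auto simp: touch_def)
      then show ?thesis using RE[of x y] unfolding touch_def by blast
    qed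
    then show "touch ?R C C'" using sub unfolding touch_def by blast
  qed
  then obtain t where t: "t \<in> verts T" and hit: "\<And>h a b. (h, a, b) \<in> I \<Longrightarrow>
      B t \<inter> (\<phi> h \<union> \<phi> a \<union> \<phi> b) \<noteq> {}" by (force simp: \<psi>_def)
  define P where "P u \<longleftrightarrow> B t \<inter> \<phi> u \<noteq> {}" for u
  have hits: "P h \<or> P a \<or> P b" if "(h, a, b) \<in> I" for h a b
    using hit[OF that] by (auto simp: P_def)
  have no: "\<not> (P u \<and> P v \<and> P w)" if uvw: "u \<noteq> v" "v \<noteq> w" "u \<noteq> w"
    "\<not> adj X_graph u v" "\<not> adj X_graph v w" "\<not> adj X_graph u w" for u v w
  proof
    assume "P u \<and> P v \<and> P w"
    then obtain x y z where xyz: "x \<in> B t" "x \<in> \<phi> u" "y \<in> B t" "y \<in> \<phi> v" "z \<in> B t" "z \<in> \<phi> w"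
      by (auto simp: P_def)
    have "matched_bag G (B t)" using TB t by (simp add: matched_tree_decomposition_def)
    moreover have "finite (B t)" using td t G
      by (auto simp: tree_decomposition_def finite_simple_graph_def intro: finite_subset)
    moreover have "x \<noteq> y" "y \<noteq> z" "x \<noteq> z" using xyz p(2) uvw(1-3) by blast+
    moreover have "\<not> adj G x y" "\<not> adj G y z" "\<not> adj G x z"
      using xyz p(3) uvw unfolding touch_def by blast+
    ultimately show False using matched_bag_no_independent_triple[OF G] card[OF t] xyz by blast
  qed
  have h0: "P U0 \<or> P a \<or> P b" if "a \<in> {U1, U1'}" "b \<in> {U5, U5'}" for a b
    using that by (intro hits) (auto simp: I_def)
  have h2: "P U2 \<or> P a \<or> P b" if "a \<in> {U1, U1'}" "b \<in> {U3, U3'}" for a b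
    using that by (intro hits) (auto simp: I_def)
  have h4: "P U4 \<or> P a \<or> P b" if "a \<in> {U3, U3'}" "b \<in> {U5, U5'}" for a b
    using that by (intro hits) (auto simp: I_def)
  \<comment> \<open>A missed hub forces a full pair of twins: if a vertex were missed on either
    side, these two and the hub would form a triple that the bag misses.\<close>
  have c0: "P U0 \<or> P U1 \<and> P U1' \<or> P U5 \<and> P U5'" using h0 by blast
  have c2: "P U2 \<or> P U1 \<and> P U1' \<or> P U3 \<and> P U3'" using h2 by blast
  have c4: "P U4 \<or> P U3 \<and> P U3' \<or> P U5 \<and> P U5'" using h4 by blast
  \<comment> \<open>The nonadjacent triples used are the three hubs, and a pair of twins with the
    opposite hub or with a vertex of another side. Not all hubs are met, so some pair of twins is;
    then the condition at the hub opposite to this pair fails.\<close>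
  have n: "\<not> (P U0 \<and> P U2 \<and> P U4)" "\<not> (P U1 \<and> P U1' \<and> P U4)" "\<not> (P U3 \<and> P U3' \<and> P U0)"
    "\<not> (P U5 \<and> P U5' \<and> P U2)" "\<not> (P U1 \<and> P U1' \<and> P U3)" "\<not> (P U1 \<and> P U1' \<and> P U5)"
    "\<not> (P U3 \<and> P U3' \<and> P U5)"
    by (rule no; simp add: adj_X_graph)+
  from n c0 c2 c4 show False by argo
qed

section \<open>Series-parallel structure of partial 2-trees\<close>

text \<open>Nothing is said about \<open>r p v\<close>, \<open>r v q\<close> or
  \<open>r p q\<close>: an edge between two terminals may be counted to every piece with these
  terminals.\<close>

definition series ::
    "('a \<Rightarrow> 'a \<Rightarrow> bool) \<Rightarrow> 'a \<Rightarrow> 'a \<Rightarrow> 'a \<Rightarrow> 'a set \<Rightarrow> 'a set \<Rightarrow> bool" where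
  "series r p v q D\<^sub>1 D\<^sub>2 \<longleftrightarrow>
     p \<noteq> v \<and> v \<noteq> q \<and> p \<noteq> q \<and> v \<notin> D\<^sub>1 \<and> v \<notin> D\<^sub>2 \<and> p \<notin> D\<^sub>1 \<and> q \<notin> D\<^sub>2 \<and>
     anti r D\<^sub>1 (insert q D\<^sub>2) \<and> anti r D\<^sub>2 (insert p D\<^sub>1)"

lemma anti_rel_mono:
  "anti r' A B \<Longrightarrow> (\<And>x y. x \<in> A \<Longrightarrow> y \<in> B \<Longrightarrow> r x y \<Longrightarrow> r' x y) \<Longrightarrow> anti r A B"
  by (auto simp: anti_def touch_def)

text \<open>\<open>net r p q D\<close>: the vertices of \<open>D\<close> can be eliminated one by one, each having at most two
  neighbours at that time, until only the terminals \<open>p\<close> and \<open>q\<close> are left. The last vertex \<open>v\<close>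
  eliminated splits its part of \<open>D\<close> in series; \<open>D\<^sub>3\<close> is the part parallel to it.\<close>

inductive net :: "('a \<Rightarrow> 'a \<Rightarrow> bool) \<Rightarrow> 'a \<Rightarrow> 'a \<Rightarrow> 'a set \<Rightarrow> bool" for r where
  empty: "p \<noteq> q \<Longrightarrow> net r p q {}"
| eliminate: "net r p v D\<^sub>1 \<Longrightarrow> net r v q D\<^sub>2 \<Longrightarrow> net r p q D\<^sub>3 \<Longrightarrow> series r p v q D\<^sub>1 D\<^sub>2 \<Longrightarrow>
    anti r (insert v (D\<^sub>1 \<union> D\<^sub>2)) D\<^sub>3 \<Longrightarrow> net r p q (insert v (D\<^sub>1 \<union> D\<^sub>2) \<union> D\<^sub>3)"

lemma net_terminals: "net r p q D \<Longrightarrow> p \<noteq> q \<and> p \<notin> D \<and> q \<notin> D"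
  by (induction rule: net.induct) (auto simp: series_def anti_def)

text \<open>The side conditions only forbid edges, so deleting edges preserves them.\<close>

lemma net_mono:
  assumes "net r' p q D" "\<And>x y. x \<in> insert p (insert q D) \<Longrightarrow> y \<in> insert p (insert q D) \<Longrightarrow> r x y \<Longrightarrow> r' x y"
  shows "net r p q D"
  using assms
proof (induction rule: net.induct)
  case (empty p q)
  then show ?case by (simp add: net.empty)
next
  case (eliminate p v D1 q D2 D3)
  show ?case
  proof (rule net.eliminate)
    show "net r p v D1" "net r v q D2" "net r p q D3"
      by (rule eliminate.IH; use eliminate.prems in blast)+
    show "series r p v q D1 D2"
      using eliminate.hyps(4) eliminate.prems unfolding series_def anti_def touch_def by blast
    show "anti r (insert v (D1 \<union> D2)) D3"
      using eliminate.hyps(5) eliminate.prems unfolding anti_def touch_def by blast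
  qed
qed

text \<open>\<open>r'\<close> is the relation after the elimination of \<open>v\<close>, with the
  neighbours \<open>S\<close> of \<open>v\<close> made adjacent. The separation conditions place two
  adjacent vertices in a common one of the three subnets, terminals included, so \<open>v\<close>
  can be inserted there; only in an empty net does it become a new series vertex.\<close>

lemma net_insert_simplicial:
  assumes "net r' p q D" "symp r" "v \<notin> insert p (insert q D)"
    and "\<And>x y. x \<in> insert p (insert q D) \<Longrightarrow> y \<in> insert p (insert q D) \<Longrightarrow> r x y \<Longrightarrow> r' x y"
    and "S \<subseteq> insert p (insert q D)" "finite S" "card S \<le> 2"
    and "\<And>x y. x \<in> S \<Longrightarrow> y \<in> S \<Longrightarrow> x \<noteq> y \<Longrightarrow> r' x y"
    and "\<And>x. x \<in> insert p (insert q D) \<Longrightarrow> r v x \<Longrightarrow> x \<in> S"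
  shows "net r p q (insert v D)"
  using assms(1,3,4,5,8,9)
proof (induction rule: net.induct)
  case (empty p q)
  have "net r p q (insert v ({} \<union> {}) \<union> {})"
    by (rule net.eliminate) (use empty in \<open>auto simp: net.empty series_def anti_def touch_def\<close>)
  then show ?case by simp
next
  case (eliminate p w D1 q D2 D3)
  note hyps = eliminate.hyps and prems = eliminate.prems
  have sep: "series r' p w q D1 D2" "anti r' (insert w (D1 \<union> D2)) D3" by fact+
  note tm = net_terminals[OF hyps(1)] net_terminals[OF hyps(2)] net_terminals[OF hyps(3)]
  let ?V = "insert p (insert q (insert w (D1 \<union> D2) \<union> D3))"
  have rr: "r x y \<Longrightarrow> r' x y" if "x \<in> ?V" "y \<in> ?V" for x y using prems(2) that by blast
  have sep_r: "series r p w q D1 D2" "anti r (insert w (D1 \<union> D2)) D3"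
  proof -
    have "anti r D1 (insert q D2)" "anti r D2 (insert p D1)"
      using sep(1) by (auto simp: series_def intro!: anti_rel_mono[of r' _ _ r] rr)
    then show "series r p w q D1 D2" using sep(1) by (simp add: series_def)
    show "anti r (insert w (D1 \<union> D2)) D3"
      using sep(2) by (rule anti_rel_mono) (auto intro!: rr)
  qed
  have nets: "net r p w D1" "net r w q D2" "net r p q D3"
    by (rule net_mono[OF hyps(1)], erule rr[rotated 2], blast, blast)
       (rule net_mono[OF hyps(2)], erule rr[rotated 2], blast, blast,
        rule net_mono[OF hyps(3)], erule rr[rotated 2], blast, blast)
  have part: "S \<subseteq> {p, w} \<union> D1 \<or> S \<subseteq> {w, q} \<union> D2 \<or> S \<subseteq> {p, q} \<union> D3"
  proof (cases "\<exists>x y. S = {x, y}")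
    case True
    then obtain x y where S: "S = {x, y}" by blast
    have xy: "x \<in> ?V" "y \<in> ?V" "x = y \<or> r' x y \<and> r' y x" using prems(3,4) S by auto
    have no: "\<not> r' a b" if "a \<in> D1 \<and> b \<in> insert q D2 \<or> a \<in> D2 \<and> b \<in> insert p D1 \<or>
        a \<in> insert w (D1 \<union> D2) \<and> b \<in> D3" for a b
      using sep that unfolding series_def anti_def touch_def by fast
    show ?thesis
    proof (cases "x = y")
      case True
      then show ?thesis using xy(1) unfolding S by auto
    next
      case False
      then show ?thesis using xy(1,2) no[of x y] no[of y x] xy(3) unfolding S by auto
    qed
  next
    case False
    then have "S = {}"
      using assms(6,7) by (metis One_nat_def card_1_singletonE card_2_iff card_eq_0_iff insert_absorb2
          le_Suc_eq le_zero_eq numeral_2_eq_2)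
    then show ?thesis by blast
  qed
  have nv: "\<not> r v x \<and> \<not> r x v \<and> x \<noteq> v" if "x \<in> ?V" "x \<notin> S" for x
    using that prems(1) prems(5)[of x] sympD[OF assms(2), of x v] by blast
  have dis: "D1 \<inter> D2 = {}" "D1 \<inter> D3 = {}" "D2 \<inter> D3 = {}" "w \<notin> D3" "q \<notin> D1" "p \<notin> D2" "w \<noteq> p" "w \<noteq> q"
    using sep_r by (auto simp: series_def anti_def)
  consider "S \<subseteq> {p, w} \<union> D1" | "S \<subseteq> {w, q} \<union> D2" | "S \<subseteq> {p, q} \<union> D3"
    using part by blast
  then show ?case
  proof cases
    case 1
    have out: "\<not> r v x \<and> \<not> r x v \<and> x \<noteq> v" if "x \<in> insert q D2 \<union> D3" for x
      by (rule nv) (use that 1 dis tm in auto)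
    have "net r p w (insert v D1)"
    proof (rule eliminate.IH(1))
      show "v \<notin> insert p (insert w D1)" using prems(1) by simp
      show "S \<subseteq> insert p (insert w D1)" using 1 by auto
      show "r' a b" if "a \<in> insert p (insert w D1)" "b \<in> insert p (insert w D1)" "r a b" for a b
        using that(3) by (rule rr[rotated 2]) (use that in auto)
      show "r' a b" if "a \<in> S" "b \<in> S" "a \<noteq> b" for a b using prems(4) that .
      show "a \<in> S" if "a \<in> insert p (insert w D1)" "r v a" for a
        using that(2) by (rule prems(5)[rotated]) (use that in auto)
    qed
    moreover have "series r p w q (insert v D1) D2"
      using sep_r(1) out tm prems(1) by (auto simp: series_def anti_def touch_def)
    moreover have "anti r (insert w (insert v D1 \<union> D2)) D3"
      using sep_r(2) out tm prems(1) by (auto simp: anti_def touch_def)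
    ultimately have "net r p q (insert w (insert v D1 \<union> D2) \<union> D3)"
      using net.eliminate nets by metis
    then show ?thesis by (simp add: insert_commute)
  next
    case 2
    have out: "\<not> r v x \<and> \<not> r x v \<and> x \<noteq> v" if "x \<in> insert p D1 \<union> D3" for x
      by (rule nv) (use that 2 dis tm in auto)
    have "net r w q (insert v D2)"
    proof (rule eliminate.IH(2))
      show "v \<notin> insert w (insert q D2)" using prems(1) by simp
      show "S \<subseteq> insert w (insert q D2)" using 2 by auto
      show "r' a b" if "a \<in> insert w (insert q D2)" "b \<in> insert w (insert q D2)" "r a b" for a b
        using that(3) by (rule rr[rotated 2]) (use that in auto)
      show "r' a b" if "a \<in> S" "b \<in> S" "a \<noteq> b" for a b using prems(4) that .
      show "a \<in> S" if "a \<in> insert w (insert q D2)" "r v a" for a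
        using that(2) by (rule prems(5)[rotated]) (use that in auto)
    qed
    moreover have "series r p w q D1 (insert v D2)"
      using sep_r(1) out tm prems(1) by (auto simp: series_def anti_def touch_def)
    moreover have "anti r (insert w (D1 \<union> insert v D2)) D3"
      using sep_r(2) out tm prems(1) by (auto simp: anti_def touch_def)
    ultimately have "net r p q (insert w (D1 \<union> insert v D2) \<union> D3)"
      using net.eliminate nets by metis
    then show ?thesis by (simp add: insert_commute)
  next
    case 3
    have out: "\<not> r v x \<and> \<not> r x v \<and> x \<noteq> v" if "x \<in> insert w (D1 \<union> D2)" for x
      by (rule nv) (use that 3 dis tm in auto)
    have "net r p q (insert v D3)"
    proof (rule eliminate.IH(3))
      show "v \<notin> insert p (insert q D3)" using prems(1) by simp
      show "S \<subseteq> insert p (insert q D3)" using 3 by auto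
      show "r' a b" if "a \<in> insert p (insert q D3)" "b \<in> insert p (insert q D3)" "r a b" for a b
        using that(3) by (rule rr[rotated 2]) (use that in auto)
      show "r' a b" if "a \<in> S" "b \<in> S" "a \<noteq> b" for a b using prems(4) that .
      show "a \<in> S" if "a \<in> insert p (insert q D3)" "r v a" for a
        using that(2) by (rule prems(5)[rotated]) (use that in auto)
    qed
    moreover have "anti r (insert w (D1 \<union> D2)) (insert v D3)"
      using sep_r(2) out tm prems(1) by (auto simp: anti_def touch_def)
    ultimately have "net r p q (insert w (D1 \<union> D2) \<union> insert v D3)"
      using net.eliminate nets sep_r(1) by metis
    then show ?thesis by (simp add: insert_commute)
  qed
qed

text \<open>\<open>R\<close> and \<open>A\<close> are the new and the old vertices of the bag
  attached last. The vertices of \<open>R\<close> are eliminated one by one, each with at most two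
  neighbours left. This may create edges inside \<open>A\<close>, and therefore the net on
  \<open>V\<close> is assumed for every relation with such additional edges.\<close>

lemma net_add_leaf:
  assumes "symp r" "finite R" "R \<inter> V = {}" "p \<in> V" "q \<in> V" "A \<subseteq> V" "card (R \<union> A) \<le> 3"
    and "finite A"
    and net: "\<And>r'. symp r' \<Longrightarrow> (\<And>x y. x \<in> V \<Longrightarrow> y \<in> V \<Longrightarrow> r' x y \<Longrightarrow> r x y \<or> x \<in> A \<and> y \<in> A) \<Longrightarrow>
      net r' p q (V - {p, q})"
    and nbr: "\<And>x y. x \<in> R \<Longrightarrow> y \<in> V \<Longrightarrow> r x y \<Longrightarrow> y \<in> A"
  shows "net r p q (V \<union> R - {p, q})"
  using assms(2,1,3,7,9,10)
proof (induction R arbitrary: r rule: finite_induct)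
  case empty
  then show ?case by simp
next
  case (insert v R)
  \<comment> \<open>The relation after the elimination of \<open>v\<close>: the rest of the bag is
    completed to a clique.\<close>
  define r' where "r' x y \<longleftrightarrow> r x y \<or> (x \<in> R \<union> A \<and> y \<in> R \<union> A)" for x y
  have sym': "symp r'" using insert.prems(1) by (auto simp: r'_def symp_def)
  have "net r' p q (V \<union> R - {p, q})"
  proof (rule insert.IH)
    show "symp r'" by fact
    show "R \<inter> V = {}" using insert.prems by blast
    show "card (R \<union> A) \<le> 3"
      using card_mono[of "insert v R \<union> A" "R \<union> A"] insert.prems(3) insert.hyps assms(8)
      by (auto simp: subset_insertI)
    show "net s p q (V - {p, q})"
      if "symp s" "\<And>x y. x \<in> V \<Longrightarrow> y \<in> V \<Longrightarrow> s x y \<Longrightarrow> r' x y \<or> x \<in> A \<and> y \<in> A" for s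
      by (rule insert.prems(4)) (use that insert.prems(2) in \<open>auto simp: r'_def\<close>)
    show "y \<in> A" if "x \<in> R" "y \<in> V" "r' x y" for x y
      using that insert.prems(2,5) by (auto simp: r'_def)
  qed
  then have "net r p q (insert v (V \<union> R - {p, q}))"
  proof (rule net_insert_simplicial[where S = "R \<union> A"])
    show "symp r" by fact
    show "v \<notin> insert p (insert q (V \<union> R - {p, q}))" using insert assms(4,5) by auto
    show "R \<union> A \<subseteq> insert p (insert q (V \<union> R - {p, q}))" using assms(6) by blast
    show "finite (R \<union> A)" using insert.hyps assms(8) by blast
    have "v \<notin> R \<union> A" using insert.hyps insert.prems(2) assms(6) by blast
    then show "card (R \<union> A) \<le> 2" using insert.prems(3) insert.hyps assms(8) by simp
    show "r' x y" if "x \<in> R \<union> A" "y \<in> R \<union> A" for x y using that by (simp add: r'_def)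
    show "r' x y" if "r x y" for x y using that by (simp add: r'_def)
    show "x \<in> R \<union> A" if "x \<in> insert p (insert q (V \<union> R - {p, q}))" "r v x" for x
      using that insert.prems(5) assms(4,5) by blast
  qed
  moreover have "insert v (V \<union> R - {p, q}) = V \<union> insert v R - {p, q}"
    using insert.prems(2) assms(4,5) by auto
  ultimately show ?case by simp
qed

text \<open>The bags attached last are eliminated first. The relation \<open>r\<close> varies in the
  induction because this fills in edges among \<open>S \<inter> V\<close>; they stay inside the
  older bag \<open>b\<close>. Rooting at a bag with \<open>p\<close> and \<open>q\<close> keeps the
  two terminals to the end.\<close>

lemma rooted_bags_net:
  assumes "rooted_bags b\<^sub>0 V \<B>" "\<And>S. S \<in> \<B> \<Longrightarrow> finite S \<and> card S \<le> 3" "symp r"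
    and "p \<in> b\<^sub>0" "q \<in> b\<^sub>0" "p \<noteq> q"
    and "\<And>x y. x \<in> V \<Longrightarrow> y \<in> V \<Longrightarrow> r x y \<Longrightarrow> \<exists>S \<in> \<B>. x \<in> S \<and> y \<in> S"
  shows "net r p q (V - {p, q})"
  using assms
proof (induction arbitrary: r rule: rooted_bags.induct)
  case root
  have "net r p q ({p, q} \<union> (b\<^sub>0 - {p, q}) - {p, q})"
    by (rule net_add_leaf[where A = "{p, q}"])
       (use root in \<open>auto simp: net.empty insert_absorb\<close>)
  moreover have "{p, q} \<union> (b\<^sub>0 - {p, q}) = b\<^sub>0" using root by auto
  ultimately show ?case by simp
next
  case (leaf V \<B> b S)
  have UV: "\<Union>\<B> = V" using rooted_bags_Union[OF leaf.hyps(1)] .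
  have b0: "b\<^sub>0 \<subseteq> V" using leaf.hyps(1) by (induction rule: rooted_bags.induct) auto
  have cov: "\<exists>S' \<in> \<B>. x \<in> S' \<and> y \<in> S'" if "x \<in> V" "y \<in> V" "r x y \<or> x \<in> S \<inter> V \<and> y \<in> S \<inter> V" for x y
  proof (cases "x \<in> S \<and> y \<in> S")
    case True
    then show ?thesis using leaf.hyps(2,3) that by blast
  next
    case False
    then show ?thesis using leaf.prems(6)[of x y] that by blast
  qed
  have "net r p q (V \<union> (S - V) - {p, q})"
  proof (rule net_add_leaf[where A = "S \<inter> V"])
    show "symp r" by (rule leaf.prems)
    show "finite (S - V)" "finite (S \<inter> V)" using leaf.prems(1)[of S] by auto
    have "S - V \<union> S \<inter> V = S" by blast
    then show "card (S - V \<union> S \<inter> V) \<le> 3" using leaf.prems(1)[of S] by simp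
    show "p \<in> V" "q \<in> V" using b0 leaf.prems by auto
    show "net r' p q (V - {p, q})"
      if r': "symp r'" "\<And>x y. x \<in> V \<Longrightarrow> y \<in> V \<Longrightarrow> r' x y \<Longrightarrow> r x y \<or> x \<in> S \<inter> V \<and> y \<in> S \<inter> V" for r'
    proof (rule leaf.IH)
      show "\<exists>S' \<in> \<B>. x \<in> S' \<and> y \<in> S'" if "x \<in> V" "y \<in> V" "r' x y" for x y
        using cov[OF that(1,2)] r'(2)[OF that] by blast
    qed (use leaf.prems r' in auto)
    show "y \<in> S \<inter> V" if "x \<in> S - V" "y \<in> V" "r x y" for x y
    proof -
      have "\<exists>S' \<in> insert S \<B>. x \<in> S' \<and> y \<in> S'" using leaf.prems(6)[of x y] that by blast
      moreover have "x \<notin> S'" if "S' \<in> \<B>" for S' using that \<open>x \<in> S - V\<close> UV by blast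
      ultimately show ?thesis using that by blast
    qed
  qed auto
  then show ?case by simp
qed

section \<open>Matched decompositions of two-terminal pieces\<close>

lemma series_sym: "series r p v q D\<^sub>1 D\<^sub>2 \<Longrightarrow> series r q v p D\<^sub>2 D\<^sub>1"
  by (auto simp: series_def)

lemma anti_insert:
  "anti r (insert a A) B \<longleftrightarrow> a \<notin> B \<and> (\<forall>b \<in> B. \<not> r a b) \<and> anti r A B"
  "anti r A (insert b B) \<longleftrightarrow> b \<notin> A \<and> (\<forall>a \<in> A. \<not> r a b) \<and> anti r A B"
  by (auto simp: anti_def touch_def)

lemma anti_Un:
  "anti r (A \<union> A') B \<longleftrightarrow> anti r A B \<and> anti r A' B"
  "anti r A (B \<union> B') \<longleftrightarrow> anti r A B \<and> anti r A B'"
  by (auto simp: anti_def touch_def)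

text \<open>\<open>v\<close> becomes an interior vertex of the left piece and then must not be
  adjacent to \<open>q\<close>, whence the assumption \<open>\<not> r v q\<close>.\<close>

lemma series_assoc:
  assumes "symp r" "series r p v q D\<^sub>1 (insert w (D\<^sub>2 \<union> D\<^sub>3))" "series r v w q D\<^sub>2 D\<^sub>3" "\<not> r v q"
  shows "series r p w q (insert v (D\<^sub>1 \<union> D\<^sub>2)) D\<^sub>3" "series r p v w D\<^sub>1 D\<^sub>2" "\<not> r p w"
proof -
  have s: "r x y \<longleftrightarrow> r y x" for x y using assms(1) by (auto simp: symp_def)
  note h = assms(2-4)[unfolded series_def anti_insert anti_Un]
  show "series r p v w D\<^sub>1 D\<^sub>2" using h unfolding series_def anti_insert anti_Un by simp
  show "\<not> r p w" using h s[of p w] by simp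
  have sv: "\<not> r v b" if "b \<in> D\<^sub>3" for b using h s[of v b] that by simp
  show "series r p w q (insert v (D\<^sub>1 \<union> D\<^sub>2)) D\<^sub>3"
    using h sv unfolding series_def anti_insert anti_Un by auto
qed

lemma series_assoc':
  assumes "symp r" "series r p v q (insert w (D\<^sub>1 \<union> D\<^sub>2)) D\<^sub>3" "series r p w v D\<^sub>1 D\<^sub>2" "\<not> r p v"
  shows "series r p w q D\<^sub>1 (insert v (D\<^sub>2 \<union> D\<^sub>3))" "series r w v q D\<^sub>2 D\<^sub>3" "\<not> r w q"
proof -
  have s: "r x y \<longleftrightarrow> r y x" for x y using assms(1) by (auto simp: symp_def)
  note h = assms(2-4)[unfolded series_def anti_insert anti_Un]
  have sv: "\<not> r v b" if "b \<in> D\<^sub>1" for b using h s[of v b] that by simp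
  show "series r w v q D\<^sub>2 D\<^sub>3" using h unfolding series_def anti_insert anti_Un by auto
  show "\<not> r w q" using h by simp
  show "series r p w q D\<^sub>1 (insert v (D\<^sub>2 \<union> D\<^sub>3))"
    using h sv s[of p v] unfolding series_def anti_insert anti_Un by auto
qed

locale simple_graph =
  fixes G :: "'a ugraph"
  assumes simple: "finite_simple_graph G"
begin

abbreviation r where "r \<equiv> adj G"

lemma r_sym: "r x y \<Longrightarrow> r y x" and r_irrefl: "\<not> r x x" and symp_r: "symp r"
  using adj_sym adj_neq[OF simple] symp_adj by metis+

lemma matched_bag_pair: "r x y \<Longrightarrow> matched_bag G {x, y}"
  unfolding matched_bag_def
  by (intro exI[of _ "{{x, y}}"]) (auto simp: matching_def induced_subgraph_def adj_def)

lemma matched_bag_path: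
  assumes "r x y" "r y z" "x \<noteq> z"
  shows "matched_bag G {x, y, z}"
proof -
  have "x \<noteq> y" "y \<noteq> z" using assms r_irrefl by auto
  then show ?thesis using assms r_sym[OF assms(2)] unfolding matched_bag_def
    by (intro exI[of _ "{{x, y}}"]) (auto simp: matching_def induced_subgraph_def adj_def)
qed

lemma matched_bag_two_edges:
  assumes "r a b" "r c d" "{a, b} \<inter> {c, d} = {}"
  shows "matched_bag G {a, b, c, d}"
  using assms unfolding matched_bag_def
  by (intro exI[of _ "{{a, b}, {c, d}}"]) (auto simp: matching_def induced_subgraph_def adj_def)

lemma matched_bag_neighbour:
  assumes "matched_bag G S" "x \<in> S"
  shows "\<exists>y \<in> S. r x y"
proof -
  from assms(1) obtain M where M: "matching (induced_subgraph G S) M" and cov: "\<Union>M = S \<or>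
      (\<exists>v \<in> S. \<Union>M = S - {v} \<and> (\<exists>w \<in> \<Union>M. {v, w} \<in> edges G))"
    unfolding matched_bag_def by (elim exE conjE)
  have ME: "e \<in> edges G" "e \<subseteq> S" if "e \<in> M" for e
    using M that by (auto simp: matching_def induced_subgraph_def)
  show ?thesis
  proof (cases "x \<in> \<Union>M")
    case True
    then obtain e where e: "e \<in> M" "x \<in> e" by blast
    obtain a b where "e = {a, b}" "r a b" using edge_adjE[OF simple ME(1)[OF e(1)]] by metis
    then show ?thesis using e ME(2)[OF e(1)] r_sym[of a b] by auto
  next
    case False
    then have "\<Union>M \<noteq> S" using assms(2) by blast
    then obtain v w where v: "\<Union>M = S - {v}" "w \<in> \<Union>M" "{v, w} \<in> edges G" using cov by blast
    then have "v = x" using False assms(2) by blast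
    then show ?thesis using v by (auto simp: adj_def)
  qed
qed

text \<open>Bags of at most four vertices mean width at most 3. The set \<open>V\<close> stands for
  the subgraph that it induces, since the main induction runs over vertex subsets of one fixed
  graph.\<close>

definition matched_dec :: "'a set \<Rightarrow> 'a set set \<Rightarrow> bool" where
  "matched_dec V \<B> \<longleftrightarrow> glued_bags V \<B> \<and> (\<forall>S \<in> \<B>. matched_bag G S \<and> card S \<le> 4) \<and>
     (\<forall>x \<in> V. \<forall>y \<in> V. r x y \<longrightarrow> (\<exists>S \<in> \<B>. x \<in> S \<and> y \<in> S))"

lemma matched_dec_glue:
  assumes "matched_dec V\<^sub>1 \<B>\<^sub>1" "matched_dec V\<^sub>2 \<B>\<^sub>2" "b\<^sub>1 \<in> \<B>\<^sub>1" "b\<^sub>2 \<in> \<B>\<^sub>2" "V\<^sub>1 \<inter> V\<^sub>2 \<subseteq> b\<^sub>1 \<inter> b\<^sub>2"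
    and "\<And>x y. x \<in> V\<^sub>1 - V\<^sub>2 \<Longrightarrow> y \<in> V\<^sub>2 - V\<^sub>1 \<Longrightarrow> \<not> r x y"
  shows "matched_dec (V\<^sub>1 \<union> V\<^sub>2) (\<B>\<^sub>1 \<union> \<B>\<^sub>2)"
  unfolding matched_dec_def
proof (intro conjI ballI impI)
  show "glued_bags (V\<^sub>1 \<union> V\<^sub>2) (\<B>\<^sub>1 \<union> \<B>\<^sub>2)"
    using assms(1-5) unfolding matched_dec_def by (blast intro: glued_bags.glue)
  show "matched_bag G S" "card S \<le> 4" if "S \<in> \<B>\<^sub>1 \<union> \<B>\<^sub>2" for S
    using assms(1,2) that by (auto simp: matched_dec_def)
  fix x y assume xy: "x \<in> V\<^sub>1 \<union> V\<^sub>2" "y \<in> V\<^sub>1 \<union> V\<^sub>2" "r x y"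
  have "x \<in> V\<^sub>1 \<and> y \<in> V\<^sub>1 \<or> x \<in> V\<^sub>2 \<and> y \<in> V\<^sub>2"
    using assms(6)[of x y] assms(6)[of y x] xy r_sym[OF xy(3)] by blast
  then show "\<exists>S \<in> \<B>\<^sub>1 \<union> \<B>\<^sub>2. x \<in> S \<and> y \<in> S"
    using assms(1,2) xy(3) unfolding matched_dec_def by (meson UnI1 UnI2)
qed

lemma matched_dec_single:
  "matched_bag G S \<Longrightarrow> card S \<le> 4 \<Longrightarrow> matched_dec S {S}"
  by (auto simp: matched_dec_def glued_bags.single)

lemma matched_dec_bag:
  assumes "matched_dec V \<B>" "x \<in> V"
  obtains b where "b \<in> \<B>" "x \<in> b"
  using assms glued_bags_Union unfolding matched_dec_def by blast

definition good :: "'a \<Rightarrow> 'a \<Rightarrow> 'a set \<Rightarrow> bool" where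
  "good p q D \<longleftrightarrow> (\<exists>\<B>. matched_dec (insert p (insert q D)) \<B> \<and> (\<exists>S \<in> \<B>. p \<in> S \<and> q \<in> S))"

lemma good_sym: "good p q D \<Longrightarrow> good q p D"
  unfolding good_def by (metis insert_commute)

lemma good_parallel:
  assumes "good p q D" "good p q D'" "anti r D D'"
  shows "good p q (D \<union> D')"
proof -
  obtain \<B> b where B: "matched_dec (insert p (insert q D)) \<B>" "b \<in> \<B>" "p \<in> b" "q \<in> b"
    using assms(1) by (auto simp: good_def)
  obtain \<B>' b' where B': "matched_dec (insert p (insert q D')) \<B>'" "b' \<in> \<B>'" "p \<in> b'" "q \<in> b'"
    using assms(2) by (auto simp: good_def)
  have "matched_dec (insert p (insert q D) \<union> insert p (insert q D')) (\<B> \<union> \<B>')"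
    by (rule matched_dec_glue[OF B(1) B'(1) B(2) B'(2)])
       (use assms(3) B B' in \<open>auto simp: anti_def touch_def\<close>)
  moreover have "insert p (insert q D) \<union> insert p (insert q D') = insert p (insert q (D \<union> D'))" by blast
  ultimately show ?thesis using B unfolding good_def by auto
qed

text \<open>The key step: the bag containing \<open>p\<close> and \<open>v\<close> provides a neighbour \<open>p'\<close> of \<open>p\<close>, and
  \<open>{p, p', v, q}\<close> is matched by the edges \<open>pp'\<close> and \<open>vq\<close>.\<close>

lemma good_series_edge:
  assumes "good p v D\<^sub>1" "good v q D\<^sub>2" "r v q" "series r p v q D\<^sub>1 D\<^sub>2"
  shows "good p q (insert v (D\<^sub>1 \<union> D\<^sub>2))"
proof -
  note ser = assms(4)[unfolded series_def anti_def touch_def]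
  obtain \<B>1 b1 where B1: "matched_dec (insert p (insert v D\<^sub>1)) \<B>1" "b1 \<in> \<B>1" "p \<in> b1" "v \<in> b1"
    using assms(1) by (auto simp: good_def)
  obtain \<B>2 b2 where B2: "matched_dec (insert v (insert q D\<^sub>2)) \<B>2" "b2 \<in> \<B>2" "v \<in> b2" "q \<in> b2"
    using assms(2) by (auto simp: good_def)
  have b1: "b1 \<subseteq> insert p (insert v D\<^sub>1)" "matched_bag G b1"
    using B1 glued_bags_Union unfolding matched_dec_def by blast+
  obtain p' where p': "p' \<in> b1" "r p p'" using matched_bag_neighbour[OF b1(2) B1(3)] by blast
  have p'2: "p' \<in> insert v D\<^sub>1" "p' \<noteq> p" using p' b1(1) r_irrefl by auto
  let ?S = "{p, p', v, q}"
  have "matched_bag G ?S"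
  proof (cases "p' = v")
    case True
    then show ?thesis using matched_bag_path[of p v q] p' assms(3) ser by simp
  next
    case False
    then show ?thesis using p' p'2 ser assms(3) by (intro matched_bag_two_edges) auto
  qed
  moreover have "card ?S \<le> 4"
    by (simp add: card_insert_if)
  ultimately have S: "matched_dec ?S {?S}" by (rule matched_dec_single)
  have qb: "insert p (insert v D\<^sub>1) \<inter> ?S \<subseteq> b1 \<inter> ?S" using B1(3,4) p'(1) ser by auto
  have 1: "matched_dec (insert p (insert v D\<^sub>1) \<union> ?S) (\<B>1 \<union> {?S})"
    by (rule matched_dec_glue[OF B1(1) S B1(2) _ qb]) (use p'2 ser in auto)
  have 2: "matched_dec ((insert p (insert v D\<^sub>1) \<union> ?S) \<union> insert v (insert q D\<^sub>2)) ((\<B>1 \<union> {?S}) \<union> \<B>2)"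
    by (rule matched_dec_glue[OF 1 B2(1) _ B2(2), of ?S])
       (use B2(3,4) p'2 ser r_sym[of p] in auto)
  have "(insert p (insert v D\<^sub>1) \<union> ?S) \<union> insert v (insert q D\<^sub>2) =
      insert p (insert q (insert v (D\<^sub>1 \<union> D\<^sub>2)))" using p'2 by auto
  with 2 show ?thesis unfolding good_def by auto
qed

section \<open>Linked and thick pieces\<close>

definition linked :: "'a \<Rightarrow> 'a \<Rightarrow> 'a set \<Rightarrow> bool" where
  "linked p q D \<longleftrightarrow> (\<exists>Z. conn r Z \<and> p \<in> Z \<and> q \<in> Z \<and> Z \<subseteq> insert p (insert q D))"

text \<open>One third of a model of \<^const>\<open>X_graph\<close>: halves \<open>A\<close> and \<open>B\<close> of two of the vertices
  \<open>u\<^sub>0, u\<^sub>2, u\<^sub>4\<close>, and the two vertices of degree 2 between them.\<close>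

definition thick_parts :: "'a \<Rightarrow> 'a \<Rightarrow> 'a set \<Rightarrow> 'a set \<Rightarrow> 'a set \<Rightarrow> 'a set \<Rightarrow> 'a set \<Rightarrow> bool" where
  "thick_parts p q D A B S S' \<longleftrightarrow> p \<in> A \<and> q \<in> B \<and> A \<subseteq> insert p D \<and> B \<subseteq> insert q D \<and> S \<subseteq> D \<and> S' \<subseteq> D \<and>
     conn r A \<and> conn r B \<and> conn r S \<and> conn r S' \<and> anti r A B \<and> anti r S S' \<and>
     S \<inter> (A \<union> B) = {} \<and> S' \<inter> (A \<union> B) = {} \<and>
     touch r S A \<and> touch r S B \<and> touch r S' A \<and> touch r S' B"

text \<open>The terminals are enlarged to connected sets \<open>A\<close> and \<open>B\<close>
  because thickness then survives series composition with a linked piece, which one of the two sets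
  absorbs.\<close>

definition thick :: "'a \<Rightarrow> 'a \<Rightarrow> 'a set \<Rightarrow> bool" where
  "thick p q D \<longleftrightarrow> (\<exists>A B S S'. thick_parts p q D A B S S')"

lemma linked_sym: "linked p q D \<Longrightarrow> linked q p D"
  unfolding linked_def by (metis insert_commute)

lemma linked_edge: "r p q \<Longrightarrow> linked p q D"
  unfolding linked_def using conn_insert[OF symp_r conn_singleton, of p p q]
  by (intro exI[of _ "{q, p}"]) auto

lemma linked_series:
  assumes "linked p v D\<^sub>1" "linked v q D\<^sub>2"
  shows "linked p q (insert v (D\<^sub>1 \<union> D\<^sub>2))"
proof -
  obtain Z where Z: "conn r Z" "p \<in> Z" "v \<in> Z" "Z \<subseteq> insert p (insert v D\<^sub>1)"
    using assms(1) by (auto simp: linked_def)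
  obtain Z' where Z': "conn r Z'" "v \<in> Z'" "q \<in> Z'" "Z' \<subseteq> insert v (insert q D\<^sub>2)"
    using assms(2) by (auto simp: linked_def)
  have "conn r (Z \<union> Z')" using conn_Un[OF symp_r Z(1) Z'(1)] Z Z' by blast
  then show ?thesis unfolding linked_def using Z Z' by (intro exI[of _ "Z \<union> Z'"]) auto
qed

lemma thick_sym: "thick p q D \<Longrightarrow> thick q p D"
proof -
  assume "thick p q D"
  then obtain A B S S' where "thick_parts p q D A B S S'" by (auto simp: thick_def)
  then have "thick_parts q p D B A S S'"
    using anti_sym[OF symp_r] by (auto simp: thick_parts_def)
  then show ?thesis unfolding thick_def by blast
qed

lemma thick_not_adj: "thick p q D \<Longrightarrow> \<not> r p q"
  by (auto simp: thick_def thick_parts_def anti_def touch_def)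

lemma thick_linked:
  assumes "thick p q D"
  shows "linked p q D"
proof -
  obtain A B S S' where t: "thick_parts p q D A B S S'" using assms by (auto simp: thick_def)
  have "touch r A S" using t touch_sym[OF symp_r] by (auto simp: thick_parts_def)
  then have "conn r (A \<union> S)"
    using t conn_Un[OF symp_r] unfolding thick_parts_def by blast
  moreover have "touch r (A \<union> S) B" using t by (auto simp: thick_parts_def touch_def)
  ultimately have "conn r (A \<union> S \<union> B)"
    using t conn_Un[OF symp_r] unfolding thick_parts_def by blast
  then show ?thesis unfolding linked_def
    using t by (intro exI[of _ "A \<union> S \<union> B"]) (auto simp: thick_parts_def)
qed

text \<open>The connected set \<open>Z\<close> through the second piece is added to
  \<open>B\<close>. Nonadjacency of \<open>p\<close> and \<open>q\<close> keeps \<open>A\<close> and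
  the enlarged set apart.\<close>

lemma thick_series_linked:
  assumes "thick p v D\<^sub>1" "linked v q D\<^sub>2" "series r p v q D\<^sub>1 D\<^sub>2" "\<not> r p q"
  shows "thick p q (insert v (D\<^sub>1 \<union> D\<^sub>2))"
proof -
  obtain A B S S' where "thick_parts p v D\<^sub>1 A B S S'" using assms(1) by (auto simp: thick_def)
  note t = this[unfolded thick_parts_def]
  obtain Z where Z: "conn r Z" "v \<in> Z" "q \<in> Z" "Z \<subseteq> insert v (insert q D\<^sub>2)"
    using assms(2) by (auto simp: linked_def)
  note ser = assms(3)[unfolded series_def]
  have BZ: "conn r (B \<union> Z)" using conn_Un[OF symp_r, of B Z] t Z by blast
  have vA: "v \<notin> A" using t by (auto simp: anti_def)
  have AZ: "anti r A Z"
  proof -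
    have "x \<noteq> y \<and> \<not> r x y" if "x \<in> A" "y \<in> Z" for x y
    proof -
      have x: "x = p \<or> x \<in> D\<^sub>1" and y: "y = v \<or> y = q \<or> y \<in> D\<^sub>2" using that t Z by auto
      show ?thesis
      proof (cases "y = v")
        case True
        then show ?thesis using t that vA by (auto simp: anti_def touch_def)
      next
        case False
        then show ?thesis using x y ser assms(4) r_sym[of x y] by (auto simp: anti_def touch_def)
      qed
    qed
    then show ?thesis by (auto simp: anti_def touch_def)
  qed
  have "D\<^sub>1 \<inter> Z = {}" using Z(4) ser by (auto simp: anti_def)
  then have SZ: "S \<inter> Z = {}" "S' \<inter> Z = {}" using t by blast+
  have "thick_parts p q (insert v (D\<^sub>1 \<union> D\<^sub>2)) A (B \<union> Z) S S'"
    unfolding thick_parts_def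
  proof (intro conjI)
    show "anti r A (B \<union> Z)" using AZ t by (auto simp: anti_def touch_def)
    show "touch r S (B \<union> Z)" "touch r S' (B \<union> Z)" using t by (auto simp: touch_def)
  qed (use t Z BZ SZ in auto)
  then show ?thesis unfolding thick_def by blast
qed

lemma linked_series_thick:
  assumes "linked p v D\<^sub>1" "thick v q D\<^sub>2" "series r p v q D\<^sub>1 D\<^sub>2" "\<not> r p q"
  shows "thick p q (insert v (D\<^sub>1 \<union> D\<^sub>2))"
  using thick_sym[OF thick_series_linked[OF thick_sym[OF assms(2)] linked_sym[OF assms(1)]
      series_sym[OF assms(3)]]] assms(4) r_sym by (auto simp: Un_commute)

lemma edge_series_good:
  assumes "good p v D\<^sub>1" "r p v" "good v q D\<^sub>2" "series r p v q D\<^sub>1 D\<^sub>2"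
  shows "good p q (insert v (D\<^sub>1 \<union> D\<^sub>2))"
  using good_sym[OF good_series_edge[OF good_sym[OF assms(3)] good_sym[OF assms(1)] r_sym[OF assms(2)]
      series_sym[OF assms(4)]]] by (simp add: Un_commute)

text \<open>A link with \<open>k = 0\<close> need not be a single edge: its terminals are adjacent,
  but \<open>D\<close> may be nonempty.\<close>

definition link :: "'a \<Rightarrow> 'a \<Rightarrow> 'a set \<Rightarrow> nat \<Rightarrow> bool" where
  "link p q D k \<longleftrightarrow> good p q D \<and> (k = 0 \<and> r p q \<or> k = 1 \<and> thick p q D)"

text \<open>The number \<open>n\<close> in \<open>chain p q D n\<close> counts the thick links.\<close>

inductive chain :: "'a \<Rightarrow> 'a \<Rightarrow> 'a set \<Rightarrow> nat \<Rightarrow> bool" where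
  base: "link p q D k \<Longrightarrow> chain p q D k"
| cons: "link p v D\<^sub>1 k \<Longrightarrow> chain v q D\<^sub>2 n \<Longrightarrow> series r p v q D\<^sub>1 D\<^sub>2 \<Longrightarrow> \<not> r p q \<Longrightarrow>
    chain p q (insert v (D\<^sub>1 \<union> D\<^sub>2)) (k + n)"

lemma link_linked: "link p q D k \<Longrightarrow> linked p q D"
  using linked_edge thick_linked unfolding link_def by blast

lemma chain_linked: "chain p q D n \<Longrightarrow> linked p q D"
  by (induction rule: chain.induct) (auto intro: link_linked linked_series)

lemma chain_thick: "chain p q D n \<Longrightarrow> n \<ge> 1 \<Longrightarrow> thick p q D"
proof (induction rule: chain.induct)
  case (base p q D k)
  then show ?case by (auto simp: link_def)
next
  case (cons p v D1 k q D2 n)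
  show ?case
  proof (cases "k = 0")
    case True
    then show ?thesis using linked_series_thick[OF link_linked] cons by auto
  next
    case False
    then have "thick p v D1" using cons by (auto simp: link_def)
    then show ?thesis using thick_series_linked chain_linked cons by blast
  qed
qed

lemma insert_Un_assoc:
  "insert w (insert v (D\<^sub>1 \<union> D\<^sub>2) \<union> D\<^sub>3) = insert v (D\<^sub>1 \<union> insert w (D\<^sub>2 \<union> D\<^sub>3))"
  by auto

text \<open>Rebracketing moves the first edge link of the chain to the good piece
  \<open>p\<close>-\<open>v\<close>, where \<open>good_series_edge\<close> applies; this is repeated
  along the chain.\<close>

lemma good_series_chain_0:
  "chain v q D\<^sub>2 n \<Longrightarrow> n = 0 \<Longrightarrow> good p v D\<^sub>1 \<Longrightarrow> series r p v q D\<^sub>1 D\<^sub>2 \<Longrightarrow> good p q (insert v (D\<^sub>1 \<union> D\<^sub>2))"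
proof (induction arbitrary: p D\<^sub>1 rule: chain.induct)
  case (base v q D k)
  then show ?case using good_series_edge by (auto simp: link_def)
next
  case (cons v w E1 k q E2 n)
  note as = series_assoc[OF symp_r cons.prems(3) cons.hyps(3,4)]
  have "good p w (insert v (D\<^sub>1 \<union> E1))"
    using cons as(2) by (intro good_series_edge) (auto simp: link_def)
  then have "good p q (insert w (insert v (D\<^sub>1 \<union> E1) \<union> E2))"
    using cons.IH[OF _ _ as(1)] cons.prems(1) by blast
  then show ?case by (simp only: insert_Un_assoc)
qed

text \<open>A thick link is good by definition. The links after it are appended by
  \<open>good_series_chain_0\<close> and those before it prepended by
  \<open>edge_series_good\<close>; all of them are edge links.\<close>

lemma chain_le_1_good: "chain p q D n \<Longrightarrow> n \<le> 1 \<Longrightarrow> good p q D"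
proof (induction rule: chain.induct)
  case (base p q D k)
  then show ?case by (auto simp: link_def)
next
  case (cons p v D1 k q D2 n)
  show ?case
  proof (cases "k = 0")
    case True
    then show ?thesis using cons by (intro edge_series_good) (auto simp: link_def)
  next
    case False
    then have "n = 0" "good p v D1" using cons by (auto simp: link_def)
    then show ?thesis using good_series_chain_0[OF cons.hyps(2) _ _ cons.hyps(3)] by blast
  qed
qed

text \<open>The cut vertex \<open>w\<close> is the far end of the first thick link, which leaves one
  thick link on either side.\<close>

lemma chain_2_split:
  "chain p q D n \<Longrightarrow> n = 2 \<Longrightarrow>
    \<exists>w E\<^sub>1 E\<^sub>2. D = insert w (E\<^sub>1 \<union> E\<^sub>2) \<and> series r p w q E\<^sub>1 E\<^sub>2 \<and> good p w E\<^sub>1 \<and> good w q E\<^sub>2"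
proof (induction rule: chain.induct)
  case (base p q D k)
  then show ?case by (auto simp: link_def)
next
  case (cons p v D1 k q D2 n)
  show ?case
  proof (cases "k = 0")
    case True
    then have n: "n = 2" using cons by simp
    obtain w E1 E2 where w: "D2 = insert w (E1 \<union> E2)" "series r v w q E1 E2" "good v w E1" "good w q E2"
      using cons.IH[OF n] by blast
    have "\<not> r v q" using thick_not_adj[OF chain_thick[OF cons.hyps(2)]] n by simp
    note as = series_assoc[OF symp_r cons.hyps(3)[unfolded w(1)] w(2) this]
    have "good p w (insert v (D1 \<union> E1))"
      using cons.hyps(1) True w(3) as(2) by (intro edge_series_good) (auto simp: link_def)
    then show ?thesis using as(1) w(1,4) insert_Un_assoc by metis
  next
    case False
    then have "n = 1" "good p v D1" using cons by (auto simp: link_def)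
    then show ?thesis using chain_le_1_good[OF cons.hyps(2)] cons.hyps(3) by auto
  qed
qed

definition two_thick :: "'a \<Rightarrow> 'a \<Rightarrow> 'a set \<Rightarrow> bool" where
  "two_thick p q D \<longleftrightarrow> \<not> r p q \<and>
    (\<exists>w E\<^sub>1 E\<^sub>2. D = insert w (E\<^sub>1 \<union> E\<^sub>2) \<and> series r p w q E\<^sub>1 E\<^sub>2 \<and> thick p w E\<^sub>1 \<and> thick w q E\<^sub>2)"

text \<open>Edge links in front are absorbed by the first thick link, at whose far end the chain is
  cut. The rest still has a thick link and is therefore thick.\<close>

lemma chain_two_thick: "chain p q D n \<Longrightarrow> n \<ge> 2 \<Longrightarrow> two_thick p q D"
proof (induction rule: chain.induct)
  case (base p q D k)
  then show ?case by (auto simp: link_def)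
next
  case (cons p v D1 k q D2 n)
  show ?case
  proof (cases "k = 0")
    case True
    then have n: "n \<ge> 2" using cons by simp
    obtain w E1 E2 where w: "D2 = insert w (E1 \<union> E2)" "series r v w q E1 E2" "thick v w E1" "thick w q E2"
      using cons.IH[OF n] by (auto simp: two_thick_def)
    have "\<not> r v q" using thick_not_adj[OF chain_thick[OF cons.hyps(2)]] n by simp
    note as = series_assoc[OF symp_r cons.hyps(3)[unfolded w(1)] w(2) this]
    have "thick p w (insert v (D1 \<union> E1))"
      using linked_series_thick[OF link_linked[OF cons.hyps(1)] w(3) as(2,3)] .
    then show ?thesis unfolding two_thick_def using as(1) w(1,4) cons.hyps(4) insert_Un_assoc by metis
  next
    case False
    then have "n \<ge> 1" "thick p v D1" using cons by (auto simp: link_def)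
    then show ?thesis unfolding two_thick_def using chain_thick[OF cons.hyps(2)] cons.hyps(3,4) by blast
  qed
qed

text \<open>The cut is again at the far end of the first thick link; two thick links remain behind
  it.\<close>

lemma chain_three_thick:
  "chain p q D n \<Longrightarrow> n \<ge> 3 \<Longrightarrow>
    \<exists>w E\<^sub>1 E\<^sub>2. D = insert w (E\<^sub>1 \<union> E\<^sub>2) \<and> series r p w q E\<^sub>1 E\<^sub>2 \<and> thick p w E\<^sub>1 \<and> two_thick w q E\<^sub>2"
proof (induction rule: chain.induct)
  case (base p q D k)
  then show ?case by (auto simp: link_def)
next
  case (cons p v D1 k q D2 n)
  show ?case
  proof (cases "k = 0")
    case True
    then have n: "n \<ge> 3" using cons by simp
    obtain w E1 E2 where w: "D2 = insert w (E1 \<union> E2)" "series r v w q E1 E2" "thick v w E1" "two_thick w q E2"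
      using cons.IH[OF n] by blast
    have "\<not> r v q" using thick_not_adj[OF chain_thick[OF cons.hyps(2)]] n by simp
    note as = series_assoc[OF symp_r cons.hyps(3)[unfolded w(1)] w(2) this]
    have "thick p w (insert v (D1 \<union> E1))"
      using linked_series_thick[OF link_linked[OF cons.hyps(1)] w(3) as(2,3)] .
    then show ?thesis using as(1) w(1,4) insert_Un_assoc by metis
  next
    case False
    then have "n \<ge> 2" "thick p v D1" using cons by (auto simp: link_def)
    then show ?thesis using chain_two_thick[OF cons.hyps(2)] cons.hyps(3) by blast
  qed
qed

text \<open>The result is given as a first link and a remaining chain because
  \<open>chain.cons\<close> demands nonadjacent terminals, whereas at the root edge \<open>p\<close>
  and \<open>q\<close> are adjacent.\<close>

lemma chain_append_uncons:
  "chain p v D\<^sub>1 m \<Longrightarrow> chain v q D\<^sub>2 n \<Longrightarrow> series r p v q D\<^sub>1 D\<^sub>2 \<Longrightarrow>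
    \<exists>x E\<^sub>1 E\<^sub>2 k l. insert v (D\<^sub>1 \<union> D\<^sub>2) = insert x (E\<^sub>1 \<union> E\<^sub>2) \<and> series r p x q E\<^sub>1 E\<^sub>2 \<and>
      link p x E\<^sub>1 k \<and> chain x q E\<^sub>2 l \<and> k + l = m + n"
proof (induction rule: chain.induct)
  case (base p v D k)
  then show ?case by blast
next
  case (cons p w E1 k v E2 l)
  note as = series_assoc'[OF symp_r cons.prems(2) cons.hyps(3,4)]
  obtain x F1 F2 k' l' where x: "insert v (E2 \<union> D\<^sub>2) = insert x (F1 \<union> F2)" "series r w x q F1 F2"
    "link w x F1 k'" "chain x q F2 l'" "k' + l' = l + n"
    using cons.IH[OF cons.prems(1) as(2)] by blast
  have "chain w q (insert v (E2 \<union> D\<^sub>2)) (l + n)"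
    using chain.cons[OF x(3,4,2) as(3)] x(1,5) by simp
  then have "insert v (insert w (E1 \<union> E2) \<union> D\<^sub>2) = insert w (E1 \<union> insert v (E2 \<union> D\<^sub>2)) \<and>
    series r p w q E1 (insert v (E2 \<union> D\<^sub>2)) \<and> link p w E1 k \<and> chain w q (insert v (E2 \<union> D\<^sub>2)) (l + n) \<and>
    k + (l + n) = k + l + n"
    using as(1) cons.hyps(1) by (simp only: insert_Un_assoc) simp
  then show ?case by blast
qed

lemma chain_append:
  assumes "chain p v D\<^sub>1 m" "chain v q D\<^sub>2 n" "series r p v q D\<^sub>1 D\<^sub>2" "\<not> r p q"
  shows "chain p q (insert v (D\<^sub>1 \<union> D\<^sub>2)) (m + n)"
  using chain_append_uncons[OF assms(1-3)] chain.cons assms(4) by metis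

end

section \<open>Thick links and the graph X\<close>

context simple_graph
begin

lemma matched_dec_pair:
  assumes "r x y"
  shows "matched_dec {x, y} {{x, y}}"
proof -
  have "card {x, y} \<le> 4" by (cases "x = y") auto
  then show ?thesis by (rule matched_dec_single[OF matched_bag_pair[OF assms]])
qed

section \<open>Three thick pieces in a cycle\<close>

definition cyclic :: "'a \<Rightarrow> 'a \<Rightarrow> 'a \<Rightarrow> 'a set \<Rightarrow> 'a set \<Rightarrow> 'a set \<Rightarrow> bool" where
  "cyclic p u q D\<^sub>1 D\<^sub>2 D\<^sub>3 \<longleftrightarrow> p \<noteq> u \<and> u \<noteq> q \<and> q \<noteq> p \<and> {p, u, q} \<inter> (D\<^sub>1 \<union> D\<^sub>2 \<union> D\<^sub>3) = {} \<and>
     anti r D\<^sub>1 D\<^sub>2 \<and> anti r D\<^sub>2 D\<^sub>3 \<and> anti r D\<^sub>3 D\<^sub>1 \<and>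
     anti r D\<^sub>1 {q} \<and> anti r D\<^sub>2 {p} \<and> anti r D\<^sub>3 {u}"

lemma cyclic_rotate: "cyclic p u q D\<^sub>1 D\<^sub>2 D\<^sub>3 \<Longrightarrow> cyclic u q p D\<^sub>2 D\<^sub>3 D\<^sub>1"
  by (auto simp: cyclic_def)

text \<open>A hub is the union of the halves that the two thick pieces at a terminal contribute. The
  claims are made from the viewpoint of one side of the cycle; \<open>cyclic_rotate\<close> yields
  the other two.\<close>

lemma thick_cycle_parts:
  assumes c: "cyclic p u q D\<^sub>1 D\<^sub>2 D\<^sub>3"
    and t1: "thick_parts p u D\<^sub>1 A\<^sub>1 B\<^sub>1 S\<^sub>1 S\<^sub>1'" and t2: "thick_parts u q D\<^sub>2 A\<^sub>2 B\<^sub>2 S\<^sub>2 S\<^sub>2'"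
    and t3: "thick_parts q p D\<^sub>3 A\<^sub>3 B\<^sub>3 S\<^sub>3 S\<^sub>3'"
  shows "conn r (B\<^sub>1 \<union> A\<^sub>2)" and "anti r (B\<^sub>3 \<union> A\<^sub>1) (B\<^sub>1 \<union> A\<^sub>2)"
    and "T \<in> {S\<^sub>1, S\<^sub>1'} \<Longrightarrow> anti r T (B\<^sub>2 \<union> A\<^sub>3)"
    and "T \<in> {S\<^sub>1, S\<^sub>1'} \<Longrightarrow> T' \<in> {S\<^sub>2, S\<^sub>2'} \<Longrightarrow> anti r T T'"
    and "T \<in> {S\<^sub>1, S\<^sub>1'} \<Longrightarrow> T \<inter> (B\<^sub>3 \<union> A\<^sub>1) = {} \<and> touch r T (B\<^sub>3 \<union> A\<^sub>1)"
    and "T \<in> {S\<^sub>1, S\<^sub>1'} \<Longrightarrow> T \<inter> (B\<^sub>1 \<union> A\<^sub>2) = {} \<and> touch r T (B\<^sub>1 \<union> A\<^sub>2)"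
proof -
  note c = c[unfolded cyclic_def] and t1 = t1[unfolded thick_parts_def]
    and t2 = t2[unfolded thick_parts_def] and t3 = t3[unfolded thick_parts_def]
  show "conn r (B\<^sub>1 \<union> A\<^sub>2)" using conn_Un[OF symp_r, of B\<^sub>1 A\<^sub>2] t1 t2 by blast
  have subs: "B\<^sub>3 \<subseteq> insert p D\<^sub>3" "A\<^sub>1 \<subseteq> insert p D\<^sub>1" "B\<^sub>1 \<subseteq> insert u D\<^sub>1" "A\<^sub>2 \<subseteq> insert u D\<^sub>2" "p \<in> A\<^sub>1" "u \<in> B\<^sub>1"
    using t1 t2 t3 by simp_all
  have aS: "\<not> r y x \<and> y \<noteq> x" if "anti r X Y" "x \<in> X" "y \<in> Y" for X Y x y
    using that r_sym[of y x] by (auto simp: anti_def touch_def)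
  have a: "\<not> r x y \<and> x \<noteq> y" if "anti r X Y" "x \<in> X" "y \<in> Y" for X Y x y
    using that by (auto simp: anti_def touch_def)
  show "anti r (B\<^sub>3 \<union> A\<^sub>1) (B\<^sub>1 \<union> A\<^sub>2)"
  proof -
    have "\<not> r x y \<and> x \<noteq> y" if x: "x \<in> B\<^sub>3 \<union> A\<^sub>1" and y: "y \<in> B\<^sub>1 \<union> A\<^sub>2" for x y
    proof (cases "x \<in> A\<^sub>1 \<and> y \<in> B\<^sub>1")
      case True
      then show ?thesis using a[of A\<^sub>1 B\<^sub>1 x y] t1 by blast
    next
      case False
      then have "x \<in> D\<^sub>3 \<and> (y = u \<or> y \<in> D\<^sub>1 \<or> y \<in> D\<^sub>2) \<or> (x = p \<or> x \<in> D\<^sub>1) \<and> y \<in> D\<^sub>2"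
        using x y subs by auto
      then consider "x \<in> D\<^sub>3" "y = u" | "x \<in> D\<^sub>3" "y \<in> D\<^sub>1" | "x \<in> D\<^sub>3" "y \<in> D\<^sub>2" | "x = p" "y \<in> D\<^sub>2" | "x \<in> D\<^sub>1" "y \<in> D\<^sub>2"
        by blast
      then show ?thesis
      proof cases
        case 1 then show ?thesis using a[of D\<^sub>3 "{u}" x y] c by blast
      next
        case 2 then show ?thesis using a[of D\<^sub>3 D\<^sub>1 x y] c by blast
      next
        case 3 then show ?thesis using aS[of D\<^sub>2 D\<^sub>3 y x] c by blast
      next
        case 4 then show ?thesis using aS[of D\<^sub>2 "{p}" y x] c by blast
      next
        case 5 then show ?thesis using a[of D\<^sub>1 D\<^sub>2 x y] c by blast
      qed
    qed
    then show ?thesis by (auto simp: anti_def touch_def)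
  qed
  {
    assume T: "T \<in> {S\<^sub>1, S\<^sub>1'}"
    then have TD: "T \<subseteq> D\<^sub>1" using t1 by blast
    have 31: "\<not> r x y \<and> x \<noteq> y" if "x \<in> D\<^sub>1" "y \<in> D\<^sub>3" for x y using aS[of D\<^sub>3 D\<^sub>1 y x] c that by blast
    have 12: "\<not> r x y \<and> x \<noteq> y" if "x \<in> D\<^sub>1" "y \<in> insert q D\<^sub>2" for x y
      using a[of D\<^sub>1 D\<^sub>2 x y] a[of D\<^sub>1 "{q}" x y] c that by blast
    have "B\<^sub>2 \<union> A\<^sub>3 \<subseteq> insert q D\<^sub>2 \<union> D\<^sub>3" using t2 t3 by blast
    then have "\<not> r x y \<and> x \<noteq> y" if "x \<in> T" "y \<in> B\<^sub>2 \<union> A\<^sub>3" for x y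
      using 31[of x y] 12[of x y] TD that by blast
    then show "anti r T (B\<^sub>2 \<union> A\<^sub>3)" unfolding anti_def touch_def by blast
    show "anti r T T'" if "T' \<in> {S\<^sub>2, S\<^sub>2'}"
    proof -
      have "T' \<subseteq> D\<^sub>2" using that t2 by blast
      then have "\<not> r x y \<and> x \<noteq> y" if "x \<in> T" "y \<in> T'" for x y using 12[of x y] TD that by blast
      then show ?thesis unfolding anti_def touch_def by blast
    qed
    have "B\<^sub>3 \<inter> D\<^sub>1 = {}" using t3 c by (auto simp: anti_def)
    moreover have "A\<^sub>2 \<inter> D\<^sub>1 = {}" using t2 c by (auto simp: anti_def)
    moreover have "T \<inter> A\<^sub>1 = {}" "T \<inter> B\<^sub>1 = {}" "touch r T A\<^sub>1" "touch r T B\<^sub>1" using T t1 by auto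
    ultimately show "T \<inter> (B\<^sub>3 \<union> A\<^sub>1) = {} \<and> touch r T (B\<^sub>3 \<union> A\<^sub>1)"
      "T \<inter> (B\<^sub>1 \<union> A\<^sub>2) = {} \<and> touch r T (B\<^sub>1 \<union> A\<^sub>2)"
      using TD unfolding touch_def by blast+
  }
qed

lemma thick_cycle_X:
  assumes c: "cyclic p u q D\<^sub>1 D\<^sub>2 D\<^sub>3" and V: "{p, u, q} \<union> D\<^sub>1 \<union> D\<^sub>2 \<union> D\<^sub>3 \<subseteq> V"
    and t: "thick p u D\<^sub>1" "thick u q D\<^sub>2" "thick q p D\<^sub>3"
  shows "\<exists>\<phi>. induced_minor_model X_graph r V \<phi>"
proof -
  obtain A1 B1 S1 S1' where t1: "thick_parts p u D\<^sub>1 A1 B1 S1 S1'" using t by (auto simp: thick_def)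
  obtain A2 B2 S2 S2' where t2: "thick_parts u q D\<^sub>2 A2 B2 S2 S2'" using t by (auto simp: thick_def)
  obtain A3 B3 S3 S3' where t3: "thick_parts q p D\<^sub>3 A3 B3 S3 S3'" using t by (auto simp: thick_def)
  note c2 = cyclic_rotate[OF c]
  note c3 = cyclic_rotate[OF c2]
  note P1 = thick_cycle_parts[OF c t1 t2 t3] and P2 = thick_cycle_parts[OF c2 t2 t3 t1]
    and P3 = thick_cycle_parts[OF c3 t3 t1 t2]
  \<comment> \<open>The hubs \<open>U0\<close>, \<open>U2\<close>, \<open>U4\<close> sit at
    \<open>p\<close>, \<open>u\<close>, \<open>q\<close>, and each thick piece supplies the two
    vertices between its hubs.\<close>
  define \<phi> where "\<phi> x = (case x of U0 \<Rightarrow> B3 \<union> A1 | U2 \<Rightarrow> B1 \<union> A2 | U4 \<Rightarrow> B2 \<union> A3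
    | U1 \<Rightarrow> S1 | U1' \<Rightarrow> S1' | U3 \<Rightarrow> S2 | U3' \<Rightarrow> S2' | U5 \<Rightarrow> S3 | U5' \<Rightarrow> S3')" for x
  have sub: "\<phi> x \<subseteq> V" for x
  proof -
    have "S1 \<union> S1' \<union> A1 \<union> B1 \<subseteq> V"
      using t1[unfolded thick_parts_def] V by (auto simp: subset_iff)
    moreover have "S2 \<union> S2' \<union> A2 \<union> B2 \<subseteq> V"
      using t2[unfolded thick_parts_def] V by (auto simp: subset_iff)
    moreover have "S3 \<union> S3' \<union> A3 \<union> B3 \<subseteq> V"
      using t3[unfolded thick_parts_def] V by (auto simp: subset_iff)
    ultimately show ?thesis by (cases x) (simp_all add: \<phi>_def)
  qed
  have con: "conn r (\<phi> x)" for x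
    using t1 t2 t3 P1(1) P2(1) P3(1) unfolding thick_parts_def by (cases x) (simp_all add: \<phi>_def)
  \<comment> \<open>Disjointness and adjacency in one predicate, so that a single table settles all
    pairs of vertices of \<open>X_graph\<close>.\<close>
  define ok where "ok A B e \<longleftrightarrow> A \<inter> B = {} \<and> (touch r A B \<longleftrightarrow> e)" for A B e
  have ok_sym: "ok A B e \<Longrightarrow> ok B A e" for A B e
    using touch_sym[OF symp_r] by (auto simp: ok_def)
  have ok_anti: "anti r A B \<Longrightarrow> ok A B False" for A B by (simp add: ok_def anti_def)
  have ok_touch: "A \<inter> B = {} \<and> touch r A B \<Longrightarrow> ok A B True" for A B by (simp add: ok_def)
  have hubs: "ok (\<phi> U0) (\<phi> U2) False" "ok (\<phi> U2) (\<phi> U4) False" "ok (\<phi> U4) (\<phi> U0) False"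
    using P1(2) P2(2) P3(2) by (auto intro!: ok_anti simp: \<phi>_def)
  have opp: "ok (\<phi> U1) (\<phi> U4) False" "ok (\<phi> U1') (\<phi> U4) False" "ok (\<phi> U3) (\<phi> U0) False"
    "ok (\<phi> U3') (\<phi> U0) False" "ok (\<phi> U5) (\<phi> U2) False" "ok (\<phi> U5') (\<phi> U2) False"
    using P1(3) P2(3) P3(3) by (auto intro!: ok_anti simp: \<phi>_def)
  have twins: "ok (\<phi> U1) (\<phi> U1') False" "ok (\<phi> U3) (\<phi> U3') False" "ok (\<phi> U5) (\<phi> U5') False"
    using t1 t2 t3 by (auto intro!: ok_anti simp: \<phi>_def thick_parts_def)
  have strands: "ok (\<phi> x) (\<phi> y) False" if "x \<in> {U1, U1'} \<and> y \<in> {U3, U3'} \<or> x \<in> {U3, U3'} \<and> y \<in> {U5, U5'}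
      \<or> x \<in> {U5, U5'} \<and> y \<in> {U1, U1'}" for x y
  proof (rule ok_anti)
    show "anti r (\<phi> x) (\<phi> y)"
      using that by (elim disjE conjE insertE emptyE; simp add: \<phi>_def P1(4) P2(4) P3(4))
  qed
  have inc: "ok (\<phi> U1) (\<phi> U0) True" "ok (\<phi> U1') (\<phi> U0) True" "ok (\<phi> U1) (\<phi> U2) True" "ok (\<phi> U1') (\<phi> U2) True"
    "ok (\<phi> U3) (\<phi> U2) True" "ok (\<phi> U3') (\<phi> U2) True" "ok (\<phi> U3) (\<phi> U4) True" "ok (\<phi> U3') (\<phi> U4) True"
    "ok (\<phi> U5) (\<phi> U4) True" "ok (\<phi> U5') (\<phi> U4) True" "ok (\<phi> U5) (\<phi> U0) True" "ok (\<phi> U5') (\<phi> U0) True"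
    unfolding \<phi>_def X_vertex.case
    by (intro ok_touch P1(5) P1(6) P2(5) P2(6) P3(5) P3(6); simp)+
  have st: "ok (\<phi> U1) (\<phi> U3) False" "ok (\<phi> U1) (\<phi> U3') False" "ok (\<phi> U1') (\<phi> U3) False" "ok (\<phi> U1') (\<phi> U3') False"
    "ok (\<phi> U3) (\<phi> U5) False" "ok (\<phi> U3) (\<phi> U5') False" "ok (\<phi> U3') (\<phi> U5) False" "ok (\<phi> U3') (\<phi> U5') False"
    "ok (\<phi> U5) (\<phi> U1) False" "ok (\<phi> U5) (\<phi> U1') False" "ok (\<phi> U5') (\<phi> U1) False" "ok (\<phi> U5') (\<phi> U1') False"
    by (rule strands; simp)+
  note all = hubs opp twins st inc
  have "ok (\<phi> x) (\<phi> y) (adj X_graph x y)" if "x \<noteq> y" for x y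
    using that by (cases x; cases y; simp add: adj_X_graph all all[THEN ok_sym])
  then have "induced_minor_model X_graph r V \<phi>"
    using sub con unfolding induced_minor_model_def ok_def by blast
  then show ?thesis by blast
qed

lemma thick_of_strands:
  assumes "\<not> r p q" "p \<noteq> q" "p \<notin> D" "q \<notin> D" "anti r S S'"
    and "S \<subseteq> D" "conn r S" "touch r S {p}" "touch r S {q}"
    and "S' \<subseteq> D" "conn r S'" "touch r S' {p}" "touch r S' {q}"
  shows "thick p q D"
proof -
  have "thick_parts p q D {p} {q} S S'"
    using assms by (auto simp: thick_parts_def conn_singleton anti_def touch_def)
  then show ?thesis by (auto simp: thick_def)
qed

section \<open>Pieces cut off by two vertices\<close>

definition attached :: "'a set \<Rightarrow> 'a \<Rightarrow> 'a \<Rightarrow> 'a set \<Rightarrow> bool" where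
  "attached V p q D \<longleftrightarrow> p \<in> V \<and> q \<in> V \<and> p \<noteq> q \<and> D \<subseteq> V \<and> p \<notin> D \<and> q \<notin> D \<and>
     (\<forall>x \<in> D. \<forall>y \<in> V. r x y \<longrightarrow> y \<in> insert p (insert q D))"

lemma attached_Un: "attached V p q D \<Longrightarrow> attached V p q D' \<Longrightarrow> attached V p q (D \<union> D')"
  by (auto simp: attached_def)

lemma attached_part:
  assumes "attached V p q (C \<union> D)" "anti r C D"
  shows "attached V p q C"
proof -
  note att = assms(1)[unfolded attached_def] and an = assms(2)[unfolded anti_def touch_def]
  have "y \<in> insert p (insert q C)" if "x \<in> C" "y \<in> V" "r x y" for x y
  proof -
    have "y \<in> insert p (insert q (C \<union> D))" using att that by blast
    then show ?thesis using an that by blast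
  qed
  then show ?thesis using att unfolding attached_def by simp
qed

lemma attached_complement:
  "attached V p q D \<Longrightarrow> attached V p q (V - insert p (insert q D))"
  by (auto simp: attached_def dest: r_sym)

lemma attached_series:
  assumes "attached V p q (insert v (D\<^sub>1 \<union> D\<^sub>2))" "series r p v q D\<^sub>1 D\<^sub>2"
  shows "attached V p v D\<^sub>1" "attached V v q D\<^sub>2"
proof -
  note att = assms(1)[unfolded attached_def] and ser = assms(2)[unfolded series_def anti_def touch_def]
  have "y \<in> insert p (insert v D\<^sub>1)" if "x \<in> D\<^sub>1" "y \<in> V" "r x y" for x y
    using att ser that by blast
  then show "attached V p v D\<^sub>1" using att ser by (auto simp: attached_def)
  have "y \<in> insert v (insert q D\<^sub>2)" if "x \<in> D\<^sub>2" "y \<in> V" "r x y" for x y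
    using att ser that by blast
  then show "attached V v q D\<^sub>2" using att ser by (auto simp: attached_def)
qed

lemma attached_anti_complement:
  "attached V p q D \<Longrightarrow> anti r D (V - insert p (insert q D))"
  by (auto simp: attached_def anti_def touch_def)

end

text \<open>The situation of a minimal counterexample \<open>V\<close>: \<open>smaller\<close> is
  the induction hypothesis of \<open>matched_dec_exists\<close>, where disconnected sets and cut
  vertices are treated directly.\<close>

locale biconnected_part = simple_graph +
  fixes V :: "'a set"
  assumes finite_V: "finite V"
    and biconnected: "c \<in> V \<Longrightarrow> conn r (V - {c})"
    and X_free: "\<not> induced_minor_model X_graph r V \<phi>"
    and no_isolated: "x \<in> V \<Longrightarrow> \<exists>y \<in> V. r x y"
    and smaller: "W \<subset> V \<Longrightarrow> (\<And>x. x \<in> W \<Longrightarrow> \<exists>y \<in> W. r x y) \<Longrightarrow> \<exists>\<B>. matched_dec W \<B>"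
begin

text \<open>A component of \<open>D\<close> that missed the terminal \<open>a\<close> would be
  closed in \<open>V - {b}\<close>, with \<open>b\<close> the other terminal, and hence equal to
  \<open>V - {b}\<close> by 2-connectedness, although that set contains \<open>a\<close>.\<close>

lemma strand_exists:
  assumes "attached V p q D" "D \<noteq> {}"
  obtains S where "S \<subseteq> D" "conn r S" "touch r S {p}" "touch r S {q}"
proof -
  note att = assms(1)[unfolded attached_def]
  have finD: "finite D" using att finite_V finite_subset by blast
  obtain d where "d \<in> D" using assms(2) by blast
  then obtain S where S: "S \<subseteq> D" "d \<in> S" "conn r S" "\<And>x y. x \<in> S \<Longrightarrow> y \<in> D \<Longrightarrow> r x y \<Longrightarrow> y \<in> S"
    using component_exists[OF symp_r finD] by metis
  have reach: "touch r S {a}" if ab: "a \<in> {p, q}" "b \<in> {p, q}" "a \<noteq> b" for a b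
  proof (rule ccontr)
    assume no: "\<not> touch r S {a}"
    have "S = V - {b}"
    proof (rule connD)
      show "conn r (V - {b})" using biconnected ab att by blast
      show "S \<subseteq> V - {b}" "S \<noteq> {}" using S att ab by auto
      fix x y assume x: "x \<in> S" "y \<in> V - {b}" "r x y"
      then have "y \<in> insert p (insert q D)" using S(1) att by blast
      moreover have "y \<noteq> a" using no x by (auto simp: touch_def)
      ultimately have "y \<in> D" using x ab by auto
      then show "y \<in> S" using S(4) x by blast
    qed
    then show False using S(1) att ab by blast
  qed
  show thesis using that[OF S(1,3)] reach att by blast
qed

text \<open>If \<open>p\<close> were joined to \<open>v\<close> neither by an edge nor through
  \<open>D\<^sub>1\<close>, then \<open>q\<close> would be a cut vertex separating \<open>v\<close>
  and \<open>D\<^sub>2\<close> from \<open>p\<close>. The other side is symmetric.\<close>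

lemma series_linked_nonempty:
  assumes "attached V p q (insert v (D\<^sub>1 \<union> D\<^sub>2))" "series r p v q D\<^sub>1 D\<^sub>2"
  shows "r p v \<or> D\<^sub>1 \<noteq> {}" "r v q \<or> D\<^sub>2 \<noteq> {}"
proof -
  note att = assms(1)[unfolded attached_def] and ser = assms(2)[unfolded series_def anti_def touch_def]
  show "r p v \<or> D\<^sub>1 \<noteq> {}"
  proof (rule ccontr)
    assume "\<not> ?thesis"
    then have no: "\<not> r p v" "D\<^sub>1 = {}" by auto
    have "insert v D\<^sub>2 = V - {q}"
    proof (rule connD)
      show "conn r (V - {q})" using biconnected att by blast
      show "insert v D\<^sub>2 \<subseteq> V - {q}" "insert v D\<^sub>2 \<noteq> {}" using att no ser by auto
      fix x y assume x: "x \<in> insert v D\<^sub>2" "y \<in> V - {q}" "r x y"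
      then have "y = p \<or> y \<in> insert v D\<^sub>2" using att no by auto
      moreover have "y \<noteq> p" using x no ser r_sym[of v p] by auto
      ultimately show "y \<in> insert v D\<^sub>2" by blast
    qed
    moreover have "p \<notin> insert v D\<^sub>2" "p \<in> V - {q}" using att ser by auto
    ultimately show False by blast
  qed
  show "r v q \<or> D\<^sub>2 \<noteq> {}"
  proof (rule ccontr)
    assume "\<not> ?thesis"
    then have no: "\<not> r v q" "D\<^sub>2 = {}" by auto
    have "insert v D\<^sub>1 = V - {p}"
    proof (rule connD)
      show "conn r (V - {p})" using biconnected att by blast
      show "insert v D\<^sub>1 \<subseteq> V - {p}" "insert v D\<^sub>1 \<noteq> {}" using att no ser by auto
      fix x y assume x: "x \<in> insert v D\<^sub>1" "y \<in> V - {p}" "r x y"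
      then have "y = q \<or> y \<in> insert v D\<^sub>1" using att no by auto
      moreover have "y \<noteq> q" using x no ser by auto
      ultimately show "y \<in> insert v D\<^sub>1" by blast
    qed
    moreover have "q \<notin> insert v D\<^sub>1" "q \<in> V - {p}" using att ser by auto
    ultimately show False by blast
  qed
qed

text \<open>Each terminal has the other as a neighbour, so no vertex of the piece is isolated and
  minimality applies; the bag that covers the edge \<open>pq\<close> contains both
  terminals.\<close>

lemma good_edge:
  assumes "attached V p q D" "r p q" "insert p (insert q D) \<noteq> V"
  shows "good p q D"
proof -
  note att = assms(1)[unfolded attached_def]
  have "insert p (insert q D) \<subset> V" using att assms(3) by blast
  moreover have "\<exists>y \<in> insert p (insert q D). r x y" if "x \<in> insert p (insert q D)" for x
  proof (cases "x \<in> D")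
    case True
    then show ?thesis using no_isolated[of x] att by blast
  next
    case False
    then show ?thesis using that assms(2) r_sym[OF assms(2)] by blast
  qed
  ultimately obtain \<B> where "matched_dec (insert p (insert q D)) \<B>" using smaller by blast
  then show ?thesis unfolding good_def using assms(2) unfolding matched_dec_def by blast
qed

text \<open>Two thick links in series, together with a strand of \<open>D'\<close> and one outside, form a model
  of \<^const>\<open>X_graph\<close>.\<close>

lemma parallel_chain_le_1:
  assumes D: "attached V p q D" and D': "attached V p q D'" "D' \<noteq> {}" "anti r D D'"
    and out: "V \<noteq> insert p (insert q (D \<union> D'))" and ch: "chain p q D n" and na: "\<not> r p q"
  shows "n \<le> 1"
proof (rule ccontr)
  assume "\<not> n \<le> 1"
  then obtain w E1 E2 where w: "D = insert w (E1 \<union> E2)" "series r p w q E1 E2" "thick p w E1" "thick w q E2"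
    using chain_two_thick[OF ch] by (auto simp: two_thick_def)
  let ?O = "V - insert p (insert q (D \<union> D'))"
  note att = attached_Un[OF D D'(1)]
  have O: "attached V p q ?O" "?O \<noteq> {}"
    using attached_complement[OF att] att out unfolding attached_def by blast+
  have an: "anti r D ?O" "anti r D' ?O"
    using attached_anti_complement[OF att] by (auto simp: anti_def touch_def)
  obtain S where S: "S \<subseteq> D'" "conn r S" "touch r S {p}" "touch r S {q}"
    using strand_exists[OF D'(1,2)] .
  obtain S' where S': "S' \<subseteq> ?O" "conn r S'" "touch r S' {p}" "touch r S' {q}"
    using strand_exists[OF O] .
  have "anti r S S'" using an(2) S(1) S'(1) unfolding anti_def touch_def by blast
  then have "thick p q (D' \<union> ?O)"
    using S S' na D'(1) by (intro thick_of_strands[of p q _ S S']) (auto simp: attached_def)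
  then have t: "thick q p (D' \<union> ?O)" by (rule thick_sym)
  have DO: "anti r D (D' \<union> ?O)" using an D'(3) by (simp add: anti_Un)
  have "cyclic p w q E1 E2 (D' \<union> ?O)"
    unfolding cyclic_def
  proof (intro conjI)
    show "anti r E2 (D' \<union> ?O)" using DO w(1) by (simp add: anti_insert anti_Un)
    show "anti r (D' \<union> ?O) E1" "anti r (D' \<union> ?O) {w}"
      using anti_sym[OF symp_r DO] unfolding w(1) by (auto simp: anti_def touch_def)
    show "{p, w, q} \<inter> (E1 \<union> E2 \<union> (D' \<union> ?O)) = {}"
      using D D'(1) w(2) DO unfolding w(1) attached_def series_def anti_def by auto
  qed (use w(2) in \<open>auto simp: series_def anti_def touch_def\<close>)
  moreover have "{p, w, q} \<union> E1 \<union> E2 \<union> (D' \<union> ?O) \<subseteq> V"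
    using D D'(1) unfolding w(1) attached_def by blast
  ultimately show False using thick_cycle_X[OF _ _ w(3,4) t] X_free by metis
qed

text \<open>Adjacent terminals make the piece a single link by minimality. Otherwise its series part
  is a chain, and that is all if the parallel part \<open>D3\<close> is empty. If not,
  \<open>insert p (insert q D) \<noteq> V\<close> provides a third strand outside, so both parallel
  parts have at most one thick link each and are good, and their union is a single thick
  link.\<close>

lemma net_chain:
  "net r p q D \<Longrightarrow> attached V p q D \<Longrightarrow> insert p (insert q D) \<noteq> V \<Longrightarrow> r p q \<or> D \<noteq> {} \<Longrightarrow>
    \<exists>n. chain p q D n"
proof (induction rule: net.induct)
  case (empty p q)
  then show ?case using good_edge[of p q "{}"] chain.base[of p q "{}" 0] by (auto simp: link_def)
next
  case (eliminate p v D1 q D2 D3)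
  let ?C = "insert v (D1 \<union> D2)"
  let ?D = "?C \<union> D3"
  note ser = eliminate.hyps(4) and an = eliminate.hyps(5) and att = eliminate.prems(1)
  show ?case
  proof (cases "r p q")
    case True
    then show ?thesis using good_edge[OF att] eliminate.prems chain.base[of p q ?D 0]
      by (auto simp: link_def)
  next
    case False
    have attC: "attached V p q ?C" using attached_part[OF att an] .
    have att3: "attached V p q D3"
      by (rule attached_part[OF _ anti_sym[OF symp_r an]]) (use att in \<open>simp only: Un_commute\<close>)
    note att12 = attached_series[OF attC ser] and ne = series_linked_nonempty[OF attC ser]
    have qV: "q \<in> V" "p \<in> V" "v \<in> V" using att by (auto simp: attached_def)
    have o1: "insert p (insert v D1) \<noteq> V" using qV ser by (auto simp: series_def anti_def)
    have o2: "insert v (insert q D2) \<noteq> V" using qV ser by (auto simp: series_def anti_def)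
    have o3: "insert p (insert q D3) \<noteq> V" using qV ser an by (auto simp: series_def anti_def)
    obtain n1 where n1: "chain p v D1 n1" using eliminate.IH(1)[OF att12(1) o1 ne(1)] by blast
    obtain n2 where n2: "chain v q D2 n2" using eliminate.IH(2)[OF att12(2) o2 ne(2)] by blast
    have C: "chain p q ?C (n1 + n2)" by (rule chain_append[OF n1 n2 ser False])
    show ?thesis
    proof (cases "D3 = {}")
      case True
      then show ?thesis using C by auto
    next
      case D3: False
      obtain m where m: "chain p q D3 m" using eliminate.IH(3)[OF att3 o3] D3 by blast
      have oD: "V \<noteq> insert p (insert q (?C \<union> D3))" "V \<noteq> insert p (insert q (D3 \<union> ?C))"
        using eliminate.prems(2) by (auto simp: Un_commute)
      have "n1 + n2 \<le> 1" using parallel_chain_le_1[OF attC att3 D3 an oD(1) C False] .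
      moreover have "m \<le> 1"
        using parallel_chain_le_1[OF att3 attC _ anti_sym[OF symp_r an] oD(2) m False] by blast
      ultimately have "good p q ?C" "good p q D3" using chain_le_1_good C m by blast+
      then have g: "good p q ?D" using good_parallel an by blast
      obtain S where S: "S \<subseteq> ?C" "conn r S" "touch r S {p}" "touch r S {q}"
        using strand_exists[OF attC] by blast
      obtain S' where S': "S' \<subseteq> D3" "conn r S'" "touch r S' {p}" "touch r S' {q}"
        using strand_exists[OF att3 D3] .
      have "anti r S S'" using an S(1) S'(1) unfolding anti_def touch_def by blast
      then have "thick p q ?D"
        using S S' False att by (intro thick_of_strands[of p q _ S S']) (auto simp: attached_def)
      then show ?thesis using g chain.base[of p q ?D 1] by (auto simp: link_def)
    qed
  qed
qed

text \<open>The edge \<open>ab\<close> closes the chain to a cycle. With at most one thick link the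
  chain is good as it stands, with two the cycle is reopened elsewhere, and with three there is a
  model of \<open>X_graph\<close>.\<close>

lemma root_edge_good:
  assumes ab: "r a b" and ser: "series r a x b E\<^sub>1 E\<^sub>2"
    and link: "link a x E\<^sub>1 k" and ch: "chain x b E\<^sub>2 n" and V: "insert a (insert b (insert x (E\<^sub>1 \<union> E\<^sub>2))) = V"
  shows "\<exists>\<B>. matched_dec V \<B>"
proof -
  have ba: "good b a {}"
    unfolding good_def using matched_dec_pair[OF r_sym[OF ab]] by (intro exI[of _ "{{b, a}}"]) simp
  have fin: ?thesis if "good a b (insert x (E\<^sub>1 \<union> E\<^sub>2))" using that V by (auto simp: good_def)
  \<comment> \<open>The terminals are changed to \<open>w\<close> and \<open>b\<close>: one arc is
    the good piece \<open>w\<close>-\<open>b\<close>, the other one is the edge \<open>ba\<close> in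
    series with the good piece \<open>a\<close>-\<open>w\<close>.\<close>
  have rotate: ?thesis if w: "insert x (E\<^sub>1 \<union> E\<^sub>2) = insert w (F1 \<union> F2)" "series r a w b F1 F2"
    "good a w F1" "good w b F2" for w F1 F2
  proof -
    note s = w(2)[unfolded series_def anti_insert]
    have "series r b a w {} F1"
      using s r_irrefl ab by (auto simp: series_def anti_def touch_def)
    from edge_series_good[OF ba r_sym[OF ab] w(3) this] have g: "good b w (insert a F1)" by simp
    have "anti r (insert a F1) F2" using s r_sym[of a] by (auto simp: anti_insert)
    then have "good b w (insert a F1 \<union> F2)" using good_parallel[OF g good_sym[OF w(4)]] by blast
    moreover have "insert b (insert w (insert a F1 \<union> F2)) = V" unfolding V[symmetric] w(1) by auto
    ultimately show ?thesis unfolding good_def by metis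
  qed
  \<comment> \<open>The edge \<open>ba\<close> gets no side of its own in the cycle of three thick
    pieces: the last piece absorbs it and runs from \<open>w\<close> to \<open>a\<close>.\<close>
  have close: False if w: "insert x (E\<^sub>1 \<union> E\<^sub>2) = insert u (F1 \<union> insert w (F2 \<union> F3))"
    "series r a u b F1 (insert w (F2 \<union> F3))" "series r u w b F2 F3"
    "thick a u F1" "thick u w F2" "thick w b F3" "\<not> r u b" for u w F1 F2 F3
  proof -
    note s = w(2)[unfolded series_def anti_insert anti_Un] w(3)[unfolded series_def anti_insert anti_Un]
    have wa: "\<not> r w a" using s by blast
    have "series r w b a F3 {}" using s by (auto simp: series_def anti_def touch_def)
    from thick_series_linked[OF w(6) linked_edge[OF r_sym[OF ab]] this wa]
    have t: "thick w a (insert b F3)" by simp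
    have "anti r F3 F1" "\<forall>y \<in> F1. \<not> r b y" using s anti_sym[OF symp_r] r_sym by blast+
    then have "anti r (insert b F3) F1" using s by (auto simp: anti_insert)
    moreover have "anti r (insert b F3) {u}"
      using s w(7) r_sym[of b u] by (auto simp: anti_def touch_def)
    moreover have "anti r F1 F2" "anti r F2 (insert b F3)" using s by (auto simp: anti_insert)
    moreover have "anti r F1 {w}" "anti r F2 {a}" using s by (auto simp: anti_def touch_def)
    ultimately have "cyclic a u w F1 F2 (insert b F3)"
      unfolding cyclic_def using s by auto
    moreover have "{a, u, w} \<union> F1 \<union> F2 \<union> insert b F3 \<subseteq> V" using V w(1) by blast
    ultimately show False using thick_cycle_X[OF _ _ w(4,5) t] X_free by metis
  qed
  \<comment> \<open>\<open>k\<close> is 1 if the first link is thick, and \<open>n\<close> counts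
    the thick links of the remaining chain.\<close>
  consider "k = 0" "n \<le> 1" | "k = 0" "n = 2" | "k = 0" "n \<ge> 3" | "k = 1" "n = 0" | "k = 1" "n = 1" | "k = 1" "n \<ge> 2"
    using link by (force simp: link_def)
  then show ?thesis
  proof cases
    case 1
    then show ?thesis
      using edge_series_good[OF _ _ chain_le_1_good[OF ch] ser] link fin by (auto simp: link_def)
  next
    case 2
    then obtain w F1 F2 where w: "E\<^sub>2 = insert w (F1 \<union> F2)" "series r x w b F1 F2" "good x w F1" "good w b F2"
      using chain_2_split[OF ch] by blast
    have "\<not> r x b" using thick_not_adj[OF chain_thick[OF ch]] 2 by simp
    note as = series_assoc[OF symp_r ser[unfolded w(1)] w(2) this]
    have "good a w (insert x (E\<^sub>1 \<union> F1))"
      using link 2 w(3) as(2) by (intro edge_series_good) (auto simp: link_def)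
    from rotate[OF _ as(1) this w(4)] show ?thesis unfolding w(1) by (simp only: insert_Un_assoc)
  next
    case 3
    then obtain u F1 F2 where u: "E\<^sub>2 = insert u (F1 \<union> F2)" "series r x u b F1 F2" "thick x u F1" "two_thick u b F2"
      using chain_three_thick[OF ch] by blast
    obtain w H1 H2 where w: "F2 = insert w (H1 \<union> H2)" "series r u w b H1 H2" "thick u w H1" "thick w b H2" "\<not> r u b"
      using u(4) by (auto simp: two_thick_def)
    have "\<not> r x b" using thick_not_adj[OF chain_thick[OF ch]] 3 by simp
    note as = series_assoc[OF symp_r ser[unfolded u(1)] u(2) this]
    have t: "thick a u (insert x (E\<^sub>1 \<union> F1))"
      using linked_series_thick[OF link_linked[OF link] u(3) as(2,3)] .
    have "insert x (E\<^sub>1 \<union> E\<^sub>2) = insert u (insert x (E\<^sub>1 \<union> F1) \<union> insert w (H1 \<union> H2))"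
      unfolding u(1) w(1) by auto
    from close[OF this as(1)[unfolded w(1)] w(2) t w(3,4,5)] show ?thesis by blast
  next
    case 4
    then show ?thesis using good_series_chain_0[OF ch _ _ ser] link fin by (auto simp: link_def)
  next
    case 5
    then show ?thesis using rotate[OF HOL.refl ser _ chain_le_1_good[OF ch]] link by (auto simp: link_def)
  next
    case 6
    then obtain w F1 F2 where w: "E\<^sub>2 = insert w (F1 \<union> F2)" "series r x w b F1 F2" "thick x w F1" "thick w b F2" "\<not> r x b"
      using chain_two_thick[OF ch] by (auto simp: two_thick_def)
    have "thick a x E\<^sub>1" using link 6 by (auto simp: link_def)
    from close[OF _ ser[unfolded w(1)] w(2) this w(3-5)] show ?thesis unfolding w(1) by blast
  qed
qed

text \<open>If the root edge has vertices on two parallel sides, each side together with the edge is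
  a smaller piece with adjacent terminals, hence good. Otherwise there is one series side, and the
  edge closes it to a cycle.\<close>

lemma matched_dec_root:
  assumes ab: "r a b" "a \<in> V" "b \<in> V" and net: "net r a b (V - {a, b})"
  shows "\<exists>\<B>. matched_dec V \<B>"
  using net
proof cases
  case empty
  then have "V = {a, b}" using ab by blast
  then show ?thesis using matched_dec_pair[OF ab(1)] by blast
next
  case (eliminate v D1 D2 D3)
  let ?C = "insert v (D1 \<union> D2)"
  note ser = eliminate(5) and an = eliminate(6)
  have V: "insert a (insert b (?C \<union> D3)) = V" using eliminate(1) ab by blast
  have "a \<noteq> b" using ab r_irrefl by auto
  then have att: "attached V a b (?C \<union> D3)"
    unfolding attached_def using eliminate(1) ab by blast
  have attC: "attached V a b ?C" using attached_part[OF att an] .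
  have att3: "attached V a b D3"
    by (rule attached_part[OF _ anti_sym[OF symp_r an]]) (use att in \<open>simp only: Un_commute\<close>)
  show ?thesis
  proof (cases "D3 = {}")
    case False
    have "insert a (insert b ?C) \<noteq> V" using False V an att3 unfolding attached_def anti_def by blast
    then have "good a b ?C" using good_edge[OF attC ab(1)] by blast
    moreover have "insert a (insert b D3) \<noteq> V"
      using V an attC unfolding attached_def anti_def by blast
    then have "good a b D3" using good_edge[OF att3 ab(1)] by blast
    ultimately have "good a b (?C \<union> D3)" using good_parallel an by blast
    then show ?thesis using V unfolding good_def by auto
  next
    case True
    note att12 = attached_series[OF attC ser] and ne = series_linked_nonempty[OF attC ser]
    have o1: "insert a (insert v D1) \<noteq> V" using ab(3) ser by (auto simp: series_def anti_def)
    have o2: "insert v (insert b D2) \<noteq> V" using ab(2) ser by (auto simp: series_def anti_def)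
    obtain n1 where n1: "chain a v D1 n1" using net_chain[OF eliminate(2) att12(1) o1 ne(1)] by blast
    obtain n2 where n2: "chain v b D2 n2" using net_chain[OF eliminate(3) att12(2) o2 ne(2)] by blast
    obtain x E1 E2 k l where x: "?C = insert x (E1 \<union> E2)" "series r a x b E1 E2" "link a x E1 k" "chain x b E2 l"
      using chain_append_uncons[OF n1 n2 ser] by blast
    show ?thesis
      by (rule root_edge_good[OF ab(1) x(2-4)]) (use V True x(1) in auto)
  qed
qed

end

text \<open>\<open>V\<close> ranges over the vertex subsets without isolated vertices, since the
  parts of a split and the pieces in \<open>good_edge\<close> are induced subgraphs; hence nets are
  assumed for all vertex subsets.\<close>

lemma (in simple_graph) matched_dec_exists:
  assumes net: "\<And>V a b. V \<subseteq> verts G \<Longrightarrow> a \<in> V \<Longrightarrow> b \<in> V \<Longrightarrow> r a b \<Longrightarrow> net r a b (V - {a, b})"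
    and X: "\<And>\<phi>. \<not> induced_minor_model X_graph r (verts G) \<phi>"
    and "V \<subseteq> verts G" "\<And>x. x \<in> V \<Longrightarrow> \<exists>y \<in> V. r x y"
  shows "\<exists>\<B>. matched_dec V \<B>"
  using assms(3,4)
proof (induction "card V" arbitrary: V rule: less_induct)
  case less
  have fin: "finite V" using less.prems(1) simple finite_subset by (auto simp: finite_simple_graph_def)
  have IH: "\<exists>\<B>. matched_dec W \<B>" if "W \<subset> V" "\<And>x. x \<in> W \<Longrightarrow> \<exists>y \<in> W. r x y" for W
    by (rule less.hyps) (use that less.prems psubset_card_mono[OF fin] in auto)
  \<comment> \<open>\<open>C\<close> is empty if \<open>V\<close> is disconnected, and otherwise
    consists of a cut vertex. A cut vertex has neighbours on both sides, so it is isolated in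
    neither part.\<close>
  have split: ?case if Q: "Q \<subseteq> V - C" "Q \<noteq> {}" "V - C \<noteq> Q"
      "\<And>x y. x \<in> Q \<Longrightarrow> y \<in> V - C \<Longrightarrow> r x y \<Longrightarrow> y \<in> Q"
      and C: "C \<subseteq> V" "\<And>c. c \<in> C \<Longrightarrow> C = {c} \<and> (\<exists>y \<in> Q. r c y) \<and> (\<exists>y \<in> V - C - Q. r c y)" for Q C
  proof -
    have "\<exists>y \<in> C \<union> Q. r x y" if "x \<in> C \<union> Q" for x
      using that less.prems(2)[of x] Q(1,4) C by blast
    moreover have "C \<union> Q \<subset> V" using Q C by blast
    ultimately obtain \<B>1 where B1: "matched_dec (C \<union> Q) \<B>1" using IH by blast
    have cl: "y \<notin> Q" if "x \<in> V - C - Q" "r x y" for x y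
      using that Q(4)[of y x] r_sym by blast
    have "\<exists>y \<in> V - Q. r x y" if x: "x \<in> V - Q" for x
    proof (cases "x \<in> C")
      case True
      then show ?thesis using C(2) by blast
    next
      case False
      then show ?thesis using x less.prems(2)[of x] cl[of x] by blast
    qed
    moreover have "V - Q \<subset> V" using Q by blast
    ultimately obtain \<B>2 where B2: "matched_dec (V - Q) \<B>2" using IH by blast
    have int: "(C \<union> Q) \<inter> (V - Q) = C" using Q C by blast
    obtain b1 b2 where b: "b1 \<in> \<B>1" "b2 \<in> \<B>2" "C \<subseteq> b1 \<inter> b2"
    proof (cases "C = {}")
      case True
      have "\<B>1 \<noteq> {}" "\<B>2 \<noteq> {}" using B1 B2 glued_bags_nonempty by (auto simp: matched_dec_def)
      then show thesis using that True by blast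
    next
      case False
      then obtain c where c: "C = {c}" "c \<in> C" using C(2) by blast
      obtain b1 where "b1 \<in> \<B>1" "c \<in> b1" using matched_dec_bag[OF B1, of c] c by blast
      moreover obtain b2 where "b2 \<in> \<B>2" "c \<in> b2"
        using matched_dec_bag[OF B2, of c] c C(1) Q(1) by blast
      ultimately show thesis using that c by blast
    qed
    have "matched_dec ((C \<union> Q) \<union> (V - Q)) (\<B>1 \<union> \<B>2)"
      by (rule matched_dec_glue[OF B1 B2 b(1,2)]) (use b(3) int Q(4) in blast)+
    moreover have "(C \<union> Q) \<union> (V - Q) = V" using Q C by blast
    ultimately show ?thesis by auto
  qed
  consider "V = {}" | "V \<noteq> {}" "\<not> conn r V" | c where "conn r V" "c \<in> V" "\<not> conn r (V - {c})"
    | "V \<noteq> {}" "\<And>c. c \<in> V \<Longrightarrow> conn r (V - {c})" by blast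
  then show ?case
  proof cases
    case 1
    \<comment> \<open>The empty set is decomposed by one empty bag, covered by the empty
      matching.\<close>
    have "matched_bag G {}" unfolding matched_bag_def
      by (intro exI[of _ "{}"]) (auto simp: matching_def)
    then show ?thesis using matched_dec_single[of "{}"] 1 by auto
  next
    case 2
    then obtain Q where "Q \<subseteq> V" "Q \<noteq> {}" "\<forall>x \<in> Q. \<forall>y \<in> V. r x y \<longrightarrow> y \<in> Q" "Q \<noteq> V"
      unfolding conn_def by blast
    then show ?thesis by (intro split[of Q "{}"]) auto
  next
    case 3
    have "V - {c} \<noteq> {}" using less.prems(2)[OF 3(2)] r_irrefl by blast
    then obtain Q where Q: "Q \<subseteq> V - {c}" "Q \<noteq> {}" "\<And>x y. x \<in> Q \<Longrightarrow> y \<in> V - {c} \<Longrightarrow> r x y \<Longrightarrow> y \<in> Q"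
        "Q \<noteq> V - {c}"
      using 3(3) unfolding conn_def by blast
    have "\<exists>y \<in> Q. r c y"
    proof (rule ccontr)
      assume no: "\<not> ?thesis"
      have "Q = V"
        by (rule connD[OF 3(1)]) (use Q no r_sym in blast)+
      then show False using Q 3(2) by blast
    qed
    moreover have "\<exists>y \<in> V - {c} - Q. r c y"
    proof (rule ccontr)
      assume no: "\<not> ?thesis"
      have "V - {c} - Q = V"
      proof (rule connD[OF 3(1)])
        show "V - {c} - Q \<noteq> {}" using Q by blast
        fix x y assume x: "x \<in> V - {c} - Q" "y \<in> V" "r x y"
        have "y \<noteq> c" using no x r_sym by blast
        moreover have "y \<notin> Q" using Q(3)[of y x] x r_sym by blast
        ultimately show "y \<in> V - {c} - Q" using x by blast
      qed blast
      then show False using 3(2) by blast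
    qed
    ultimately show ?thesis using Q 3(2) by (intro split[of Q "{c}"]) auto
  next
    case 4
    interpret biconnected_part G V
    proof
      show "finite V" by (rule fin)
      show "conn r (V - {c})" if "c \<in> V" for c using 4(2) that .
      show "\<not> induced_minor_model X_graph r V \<phi>" for \<phi>
        using X[of \<phi>] less.prems(1) unfolding induced_minor_model_def by blast
      show "\<exists>y \<in> V. r x y" if "x \<in> V" for x using less.prems(2) that .
      show "\<exists>\<B>. matched_dec W \<B>" if "W \<subset> V" "\<And>x. x \<in> W \<Longrightarrow> \<exists>y \<in> W. r x y" for W
        using IH that .
    qed
    obtain a b where ab: "a \<in> V" "b \<in> V" "r a b" using 4(1) less.prems(2) by blast
    show ?thesis by (rule matched_dec_root[OF ab(3,1,2) net[OF less.prems(1) ab]])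
  qed
qed

section \<open>From bag sizes to widths\<close>

lemma card_bag_le_width:
  assumes "tree_decomposition G T B" "t \<in> verts T"
  shows "card (B t) \<le> width T B + 1"
proof -
  have "finite (verts T)" using assms(1)
    by (simp add: tree_decomposition_def is_tree_def finite_simple_graph_def)
  then have "card (B t) \<le> Max ((\<lambda>t. card (B t)) ` verts T)" using assms(2) by (intro Max_ge) auto
  then show ?thesis by (simp add: width_def)
qed

text \<open>Were all values larger than \<open>numeral k\<close>, its successor would be a lower
  bound; so a bound on the infimum is met by a member of the set.\<close>

lemma Inf_enat_le_numeral:
  assumes "Inf {enat (f x y) | x y. P x y} \<le> numeral k"
  obtains x y where "P x y" "f x y \<le> numeral k"
proof -
  have "\<not> enat (Suc (numeral k)) \<le> Inf {enat (f x y) | x y. P x y}"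
  proof
    assume "enat (Suc (numeral k)) \<le> Inf {enat (f x y) | x y. P x y}"
    then have "enat (Suc (numeral k)) \<le> enat (numeral k)"
      using assms unfolding numeral_eq_enat by (rule order_trans)
    then show False unfolding enat_ord_simps by (rule notE[OF Suc_n_not_le_n])
  qed
  then obtain x y where "P x y" "\<not> enat (Suc (numeral k)) \<le> enat (f x y)"
    unfolding le_Inf_iff by blast
  then show thesis using that[of x y] unfolding enat_ord_simps not_le less_Suc_eq_le by blast
qed

theorem theorem9:
  fixes G :: "'a ugraph"
  assumes "finite_simple_graph G"
    and "no_isolated_vertices G"
    and "treewidth G \<le> 2"
  shows "induced_minor_free X_graph G \<longleftrightarrow> mtw G \<le> 3"
proof
  interpret simple_graph G by standard (rule assms(1))
  obtain T :: "nat ugraph" and B where td: "tree_decomposition G T B" and w: "width T B \<le> 2"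
    using assms(3) unfolding treewidth_def by (rule Inf_enat_le_numeral)
  \<comment> \<open>The bags are cut down to \<open>V\<close>, and a bag containing both ends of the
    edge \<open>ab\<close> serves as the root.\<close>
  have net: "net r a b (V - {a, b})" if V: "V \<subseteq> verts G" and ab: "a \<in> V" "b \<in> V" "r a b" for V a b
  proof -
    have cov: "\<exists>t \<in> verts T. x \<in> B t \<and> y \<in> B t" if "r x y" for x y
    proof -
      have "\<exists>t \<in> verts T. {x, y} \<subseteq> B t" using td that unfolding tree_decomposition_def adj_def by blast
      then show ?thesis by simp
    qed
    obtain t0 where t0: "t0 \<in> verts T" "a \<in> B t0" "b \<in> B t0" using cov[OF ab(3)] by blast
    have "rooted_bags (B t0 \<inter> V) (verts G \<inter> V) ((\<lambda>S. S \<inter> V) ` B ` verts T)"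
      by (rule rooted_bags_restrict[OF tree_decomposition_rooted_bags[OF td t0(1)]])
    then have rb: "rooted_bags (B t0 \<inter> V) V ((\<lambda>S. S \<inter> V) ` B ` verts T)"
      using V by (simp add: Int_absorb1)
    have finB: "finite (B t)" if "t \<in> verts T" for t
    proof (rule finite_subset)
      show "B t \<subseteq> verts G" using td that by (simp add: tree_decomposition_def)
      show "finite (verts G)" using simple by (simp add: finite_simple_graph_def)
    qed
    show ?thesis
    proof (rule rooted_bags_net[OF rb])
      fix S assume "S \<in> (\<lambda>S. S \<inter> V) ` B ` verts T"
      then obtain t where t: "t \<in> verts T" "S = B t \<inter> V" by blast
      have "card (B t) \<le> 3" using card_bag_le_width[OF td t(1)] w by simp
      then show "finite S \<and> card S \<le> 3"
        using t(2) finB[OF t(1)] card_mono[OF finB[OF t(1)], of S] by auto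
    next
      show "symp r" by (rule symp_r)
      show "a \<in> B t0 \<inter> V" "b \<in> B t0 \<inter> V" "a \<noteq> b" using t0 ab r_irrefl by auto
      fix x y assume xy: "x \<in> V" "y \<in> V" "r x y"
      then obtain t where "t \<in> verts T" "x \<in> B t" "y \<in> B t" using cov[of x y] by blast
      then show "\<exists>S \<in> (\<lambda>S. S \<inter> V) ` B ` verts T. x \<in> S \<and> y \<in> S"
        using xy by (intro bexI[of _ "B t \<inter> V"]) auto
    qed
  qed
  assume "induced_minor_free X_graph G"
  then have X: "\<And>\<phi>. \<not> induced_minor_model X_graph r (verts G) \<phi>"
    using induced_minor_iff_model[OF assms(1) simple_X_graph] by (auto simp: induced_minor_free_def)
  \<comment> \<open>This qualifies the whole vertex set for the induction over vertex
    subsets.\<close>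
  have "\<exists>y \<in> verts G. r x y" if x: "x \<in> verts G" for x
  proof -
    obtain e where e: "e \<in> edges G" "x \<in> e" 
      using assms(2) x unfolding no_isolated_vertices_def by blast
    obtain u v where "e = {u, v}" "r u v" "u \<in> verts G" "v \<in> verts G"
      using edge_adjE[OF simple e(1)] by metis
    then show ?thesis using e(2) r_sym[of u v] by auto
  qed
  then obtain \<B> where \<B>: "matched_dec (verts G) \<B>" using matched_dec_exists[OF net X] by blast
  then have gb: "glued_bags (verts G) \<B>" and mb: "\<And>S. S \<in> \<B> \<Longrightarrow> matched_bag G S \<and> card S \<le> 4"
    and cov: "\<And>x y. x \<in> verts G \<Longrightarrow> y \<in> verts G \<Longrightarrow> r x y \<Longrightarrow> \<exists>S \<in> \<B>. x \<in> S \<and> y \<in> S"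
    by (auto simp: matched_dec_def)
  obtain T' :: "nat ugraph" and B' where T': "is_tree T'" "B' ` verts T' = \<B>"
    "\<And>v. v \<in> verts G \<Longrightarrow> conn (adj T') {t \<in> verts T'. v \<in> B' t}"
    using glued_bags_tree[OF gb, of "{}"] by auto
  have "\<exists>t \<in> verts T'. e \<subseteq> B' t" if e: "e \<in> edges G" for e
  proof -
    obtain x y where xy: "e = {x, y}" "r x y" "x \<in> verts G" "y \<in> verts G"
      using edge_adjE[OF simple e] by metis
    then have "\<exists>S \<in> B' ` verts T'. x \<in> S \<and> y \<in> S" using cov T'(2) by simp
    then show ?thesis using xy(1) by auto
  qed
  moreover have "B' t \<subseteq> verts G" if "t \<in> verts T'" for t
    using glued_bags_Union[OF gb] T'(2) that by blast
  ultimately have "tree_decomposition G T' B'"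
    unfolding tree_decomposition_def connected_graph_induced_iff using T'(1,3) by blast
  then have mtd: "matched_tree_decomposition G T' B'"
    unfolding matched_tree_decomposition_def using mb T'(2) by blast
  have fin: "finite (verts T')" "verts T' \<noteq> {}"
    using T'(1) by (auto simp: is_tree_def finite_simple_graph_def connected_graph_def)
  have "Max ((\<lambda>t. card (B' t)) ` verts T') \<le> 4" using fin mb T'(2) by (subst Max_le_iff) auto
  then have "enat (width T' B') \<le> 3" by (simp add: width_def numeral_eq_enat)
  moreover have "mtw G \<le> enat (width T' B')"
    unfolding mtw_def by (rule Inf_lower) (use mtd in blast)
  ultimately show "mtw G \<le> 3" by simp
next
  assume "mtw G \<le> 3"
  then obtain T :: "nat ugraph" and B where td: "matched_tree_decomposition G T B" and w: "width T B \<le> 3"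
    unfolding mtw_def by (rule Inf_enat_le_numeral)
  have td': "tree_decomposition G T B" using td by (simp add: matched_tree_decomposition_def)
  have "card (B t) \<le> 4" if "t \<in> verts T" for t
    using card_bag_le_width[OF td' that] w by simp
  then have "\<not> induced_minor_model X_graph (adj G) (verts G) \<phi>" for \<phi>
    using X_model_not_mtw_le_3[OF assms(1) _ td] by blast
  then show "induced_minor_free X_graph G"
    using induced_minor_iff_model[OF assms(1) simple_X_graph] by (auto simp: induced_minor_free_def)
qed

end
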